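(* Let $(\mathbf X_{n+1},\mathbf Y_{n+1},\mathbf V_{n+1})$ have distribution $\mathbb P_n$. Assume $$M<m\,\frac{\int_{\mathcal B((\tilde x,R),R)}\lambda_* e^{-\lambda_* r}\,dx\,dr}{\int_{D\setminus\mathcal B((\tilde x,R),R)}\lambda_* e^{-\lambda_* r}\,dx\,dr},$$ and let $(y_A,\lambda_A)$ be the unique solution described below. (i) For every $\varepsilon>0$, $\lim_{n\to\infty}\mathbb P_n(|Y_{n+1}-y_A|>\varepsilon)=0$. (ii) The marginal distribution of $X_{n+1}$ under $\mathbb P_n$ is uniform on $D_b'$. Moreover, conditionally on $\{X_{n+1}=x\}$, the empirical measure $\mathbb Q_n$ converges weakly, in probability, to $\nu_{x,y_A,\lambda_A}$ as $n\to\infty$.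
   Context: Fix an integer $d\ge 2$, a bounded domain $D_b\subset\mathbb R^{d-1}$ with smooth boundary, and $R>0$. Assume that $D_b$ satisfies the inner ball condition with radius $R$: for every $x\in\partial D_b$ there is a unique open $(d-1)$-dimensional ball of radius $R$ contained in $D_b$ whose boundary is tangent to $\partial D_b$ at $x$, and $x$ is the only point of intersection of that ball's boundary with $\partial D_b$. Let $D=D_b\times[0,\infty)\subset\mathbb R^d$, and assume a closed ball of radius $R$ fits in the interior of $D$. Points of $\mathbb R^d$ are written $(x,y)$ with $x\in\mathbb R^{d-1}$ and $y\in\mathbb R$. $\mathcal B(z,r)$ denotes the open ball with center $z$ and radius $r$. Let $D_b'=\{x\in D_b:\mathcal B((x,y),R)\subset D\text{ for all }y>R\}$. In integrals $\int_{D\setminus\mathcal B((\tilde x,y),R)}(\cdot)\,dx\,dr$, $\tilde x$ is an arbitrary point of $D_b'$ (the value does not depend on the choice), $dx$ is Lebesgue measure on $\mathbb R^{d-1}$, and $dr$ is Lebesgue measure in the vertical coordinate. Fix $m>0$, $M>0$, $g>0$ and $E>MgR$. Set $m_i=m/n$ for $1\le i\le n$ and $m_{n+1}=M$. Let $\mathbf D_{n,E}$ be the set of $(\mathbf x_{n+1},\mathbf y_{n+1},\mathbf v_{n+1})$ satisfying all of the following: - $x_i\in D_b$ and $y_i\ge0$ for $i\le n$; - $x_{n+1}\in D_b'$ and $y_{n+1}\ge R$; - $v_i\in\mathbb R^d$ for all $i$; - $(x_k,y_k)\in D\setminus\mathcal B((x_{n+1},y_{n+1}),R)$ for $k\le n$;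 - $\sum_{i=1}^{n+1}\big(m_igy_i+\tfrac12m_i\|v_i\|^2\big)=E$. The probability measure $\mathbb P_n$ on $\mathbf D_{n,E}$ is defined as follows. The positions have Lebesgue density proportional to $\big(E-\sum_{i=1}^{n+1}m_iy_ig\big)^{((n+1)d-2)/2}$ on the admissible positions with $\sum_i m_iy_ig\le E$. Given the positions, $(\sqrt{m_1}v_1,\dots,\sqrt{m_{n+1}}v_{n+1})$ is uniform on the centered sphere in $\mathbb R^{(n+1)d}$ of radius $\big(2E-2\sum_i m_iy_ig\big)^{1/2}$. Define $\lambda_*$ as the unique $\lambda>0$ with $$\frac{dmg}{2\lambda}+mg\,\frac{\int_{D\setminus\mathcal B((\tilde x,R),R)}r\lambda e^{-\lambda r}\,dx\,dr}{\int_{D\setminus\mathcal B((\tilde x,R),R)}\lambda e^{-\lambda r}\,dx\,dr}+MgR=E.$$ Under the displayed hypothesis, $(y_A,\lambda_A)$ is the unique solution with $y\ge R$, $\lambda>0$ of the two equations $$M=m\,\frac{\int_{\mathcal B((\tilde x,y),R)}\lambda e^{-\lambda r}\,dx\,dr}{\int_{D\setminus\mathcal B((\tilde x,y),R)}\lambda e^{-\lambda r}\,dx\,dr},$$ $$\frac{dmg}{2\lambda}+mg\,\frac{\int_{D\setminus\mathcal B((\tilde x,y),R)}r\lambda e^{-\lambda r}\,dx\,dr}{\int_{D\setminus\mathcal B((\tilde x,y),R)}\lambda e^{-\lambda r}\,dx\,dr}+Mgy=E.$$ For $\hat x\in D_b'$, $y'\ge R$ and $\lambda>0$, $\nu_{\hat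 x,y',\lambda}$ is the probability measure on $D$ with density proportional to $\mathbf 1_{D\setminus\mathcal B((\hat x,y'),R)}(x,y)\,\lambda e^{-\lambda y}$ with respect to $dx\,dy$. The empirical measure of the gas is $\mathbb Q_n=\frac1n\sum_{i=1}^n\delta_{(X_i,Y_i)}$. *)

theory Defs
  imports "HOL-Probability.Probability"
begin

fun iter_pd :: "'a::euclidean_space list \<Rightarrow> ('a \<Rightarrow> real) \<Rightarrow> 'a \<Rightarrow> real" where
  "iter_pd [] f = f"
| "iter_pd (u # us) f = (\<lambda>z. frechet_derivative (iter_pd us f) (at z) u)"

definition smooth_on :: "'a::euclidean_space set \<Rightarrow> ('a \<Rightarrow> real) \<Rightarrow> bool" where
  "smooth_on U f \<longleftrightarrow> open U \<and> (\<forall>us. set us \<subseteq> Basis \<longrightarrow> iter_pd us f differentiable_on U)"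

definition smooth_boundary :: "'a::euclidean_space set \<Rightarrow> bool" where
  "smooth_boundary S \<longleftrightarrow>
     (\<forall>p\<in>frontier S. \<exists>U \<phi>. open U \<and> p \<in> U \<and> smooth_on U \<phi> \<and>
        (\<forall>z\<in>U. frechet_derivative \<phi> (at z) \<noteq> (\<lambda>_. 0)) \<and>
        S \<inter> U = {z\<in>U. \<phi> z < 0})"

definition inner_ball_condition :: "'a::euclidean_space set \<Rightarrow> real \<Rightarrow> bool" where
  "inner_ball_condition S R \<longleftrightarrow>
     (\<forall>x\<in>frontier S. \<exists>!c. ball c R \<subseteq> S \<and> sphere c R \<inter> frontier S = {x})"

text \<open>Points of R^d are pairs (x,y) with x in R^(d-1) (the type 'a) and y real.
  Note that the norm on a product type is the Euclidean one.\<close>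

definition cyl :: "'a::euclidean_space set \<Rightarrow> ('a \<times> real) set" where
  "cyl Db = Db \<times> {0..}"

definition Dbp :: "'a::euclidean_space set \<Rightarrow> real \<Rightarrow> 'a set" where
  "Dbp Db R = {x\<in>Db. \<forall>y>R. ball (x, y) R \<subseteq> cyl Db}"

definition I_out :: "'a::euclidean_space set \<Rightarrow> real \<Rightarrow> 'a \<Rightarrow> real \<Rightarrow> real \<Rightarrow> real" where
  "I_out Db R xt y lam = (LINT z : (cyl Db - ball (xt, y) R) | lborel. lam * exp (- lam * snd z))"

definition I_out1 :: "'a::euclidean_space set \<Rightarrow> real \<Rightarrow> 'a \<Rightarrow> real \<Rightarrow> real \<Rightarrow> real" where
  "I_out1 Db R xt y lam = (LINT z : (cyl Db - ball (xt, y) R) | lborel. snd z * lam * exp (- lam * snd z))"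

definition I_ball :: "real \<Rightarrow> 'a::euclidean_space \<Rightarrow> real \<Rightarrow> real \<Rightarrow> real" where
  "I_ball R xt y lam = (LINT z : ball (xt, y) R | lborel. lam * exp (- lam * snd z))"

text \<open>Energy equation (with d = DIM('a) + 1).\<close>
definition energy_eq :: "'a::euclidean_space set \<Rightarrow> real \<Rightarrow> 'a \<Rightarrow> real \<Rightarrow> real \<Rightarrow> real \<Rightarrow> real \<Rightarrow> real \<Rightarrow> real \<Rightarrow> bool" where
  "energy_eq Db R xt m M g E y lam \<longleftrightarrow>
     real (DIM('a) + 1) * m * g / (2 * lam) + m * g * I_out1 Db R xt y lam / I_out Db R xt y lam
       + M * g * y = E"

definition balance_eq :: "'a::euclidean_space set \<Rightarrow> real \<Rightarrow> 'a \<Rightarrow> real \<Rightarrow> real \<Rightarrow> real \<Rightarrow> real \<Rightarrow> bool" where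
  "balance_eq Db R xt m M y lam \<longleftrightarrow> M = m * I_ball R xt y lam / I_out Db R xt y lam"

definition ndens :: "'b measure \<Rightarrow> ('b \<Rightarrow> real) \<Rightarrow> 'b measure" where
  "ndens N f = density N (\<lambda>z. ennreal (f z) / (\<integral>\<^sup>+ w. ennreal (f w) \<partial>N))"

definition nu :: "'a::euclidean_space set \<Rightarrow> real \<Rightarrow> 'a \<Rightarrow> real \<Rightarrow> real \<Rightarrow> ('a \<times> real) measure" where
  "nu Db R xh y' lam =
     ndens lborel (\<lambda>z. indicator (cyl Db - ball (xh, y') R) z * lam * exp (- lam * snd z))"

text \<open>Particles are indexed 0..n: indices i < n are the gas particles (mass m/n),
  index n is the piston (mass M).\<close>
definition mass :: "real \<Rightarrow> real \<Rightarrow> nat \<Rightarrow> nat \<Rightarrow> real" where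
  "mass m M n i = (if i < n then m / real n else M)"

definition potential :: "real \<Rightarrow> real \<Rightarrow> real \<Rightarrow> nat \<Rightarrow> (nat \<Rightarrow> 'a \<times> real) \<Rightarrow> real" where
  "potential m M g n p = (\<Sum>i\<le>n. mass m M n i * g * snd (p i))"

definition admissible ::
  "'a::euclidean_space set \<Rightarrow> real \<Rightarrow> real \<Rightarrow> real \<Rightarrow> real \<Rightarrow> real \<Rightarrow> nat \<Rightarrow> (nat \<Rightarrow> 'a \<times> real) set" where
  "admissible Db R m M g E n =
     {p. (\<forall>i<n. p i \<in> cyl Db - ball (p n) R) \<and> fst (p n) \<in> Dbp Db R \<and> snd (p n) \<ge> R
         \<and> potential m M g n p \<le> E}"

definition pos_dens ::
  "'a::euclidean_space set \<Rightarrow> real \<Rightarrow> real \<Rightarrow> real \<Rightarrow> real \<Rightarrow> real \<Rightarrow> nat \<Rightarrow> (nat \<Rightarrow> 'a \<times> real) \<Rightarrow> real" where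
  "pos_dens Db R m M g E n p =
     indicator (admissible Db R m M g E n) p *
     (E - potential m M g n p) powr ((real ((n + 1) * (DIM('a) + 1)) - 2) / 2)"

abbreviation conf_space :: "nat \<Rightarrow> (nat \<Rightarrow> 'a::euclidean_space \<times> real) measure" where
  "conf_space n \<equiv> PiM {..n} (\<lambda>_. lborel)"

text \<open>Uniform (normalised surface) measure on the centred sphere of radius rho in R^((n+1)d),
  obtained as radial projection of the uniform measure on the unit ball.\<close>
definition sphere_unif :: "nat \<Rightarrow> real \<Rightarrow> (nat \<Rightarrow> 'a::euclidean_space \<times> real) measure" where
  "sphere_unif n rho =
     distr (uniform_measure (conf_space n) {w \<in> space (conf_space n). (\<Sum>i\<le>n. (norm (w i))\<^sup>2) \<le> 1})
       (conf_space n)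
       (\<lambda>w. \<lambda>i\<in>{..n}. (rho / sqrt (\<Sum>j\<le>n. (norm (w j))\<^sup>2)) *\<^sub>R w i)"

definition vel_kernel ::
  "real \<Rightarrow> real \<Rightarrow> real \<Rightarrow> real \<Rightarrow> nat \<Rightarrow> (nat \<Rightarrow> 'a::euclidean_space \<times> real)
     \<Rightarrow> ((nat \<Rightarrow> 'a \<times> real) \<times> (nat \<Rightarrow> 'a \<times> real)) measure" where
  "vel_kernel m M g E n p =
     distr (sphere_unif n (sqrt (2 * E - 2 * potential m M g n p)))
       (conf_space n \<Otimes>\<^sub>M conf_space n)
       (\<lambda>w. (p, \<lambda>i\<in>{..n}. (1 / sqrt (mass m M n i)) *\<^sub>R w i))"

definition Pn ::
  "'a::euclidean_space set \<Rightarrow> real \<Rightarrow> real \<Rightarrow> real \<Rightarrow> real \<Rightarrow> real \<Rightarrow> nat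
     \<Rightarrow> ((nat \<Rightarrow> 'a \<times> real) \<times> (nat \<Rightarrow> 'a \<times> real)) measure" where
  "Pn Db R m M g E n =
     ndens (conf_space n) (pos_dens Db R m M g E n) \<bind> vel_kernel m M g E n"

text \<open>P_n conditioned on X_{n+1} = x: the horizontal piston coordinate is frozen at x,
  all other coordinates keep the same (unnormalised) density.\<close>
definition Pn_cond ::
  "'a::euclidean_space set \<Rightarrow> real \<Rightarrow> real \<Rightarrow> real \<Rightarrow> real \<Rightarrow> real \<Rightarrow> nat \<Rightarrow> 'a
     \<Rightarrow> ((nat \<Rightarrow> 'a \<times> real) \<times> (nat \<Rightarrow> 'a \<times> real)) measure" where
  "Pn_cond Db R m M g E n x =
     ndens (PiM {..n} (\<lambda>i. if i < n then lborel else distr lborel borel (\<lambda>y::real. (x, y))))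
       (pos_dens Db R m M g E n) \<bind> vel_kernel m M g E n"

definition empirical :: "nat \<Rightarrow> (nat \<Rightarrow> 'a::euclidean_space \<times> real) \<Rightarrow> ('a \<times> real) measure" where
  "empirical n p = distr (uniform_count_measure {..<n}) borel p"

definition weak_conv_in_prob ::
  "'b::topological_space set \<Rightarrow> (nat \<Rightarrow> 'w measure) \<Rightarrow> (nat \<Rightarrow> 'w \<Rightarrow> 'b measure) \<Rightarrow> 'b measure \<Rightarrow> bool" where
  "weak_conv_in_prob S P Q \<nu> \<longleftrightarrow>
     (\<forall>f :: 'b \<Rightarrow> real. continuous_on S f \<and> bounded (f ` S) \<longrightarrow>
        (\<forall>e>0. (\<lambda>n. measure (P n) {\<omega> \<in> space (P n). \<bar>(\<integral>z. f z \<partial>Q n \<omega>) - (\<integral>z. f z \<partial>\<nu>)\<bar> > e})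
                \<longlonglongrightarrow> 0))"

end

theory Submission
  imports Defs
begin

text \<open>
  Write \<open>\<kappa>\<close> for the exponent of the position density, \<open>q = M / m\<close> and \<open>\<beta> = n \<lambda> / (m g)\<close> with
  \<open>\<lambda> = \<lambda>\<^sub>A\<close>. For the kinetic energy \<open>u\<close> one has
  \<open>u^\<kappa> = (\<kappa> / (e \<beta>))^\<kappa> e^(\<beta> u) \<psi>(\<beta> u / \<kappa>)^\<kappa>\<close> with \<open>\<psi> t = t e^(1 - t) \<le> 1\<close>.
  Hence, for a piston at \<open>(x, y)\<close>, the gas has the law of \<open>n\<close> independent particles with
  distribution \<open>\<nu>\<^bsub>x,y,\<lambda>\<^esub>\<close>, reweighted by \<open>\<psi>(\<beta> u / \<kappa>)^\<kappa>\<close>, and \<open>y\<close> carries the weight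
  \<open>(e^(-\<lambda> q y) J(y))^n\<close>, \<open>J\<close> being the integral of \<open>e^(-\<lambda> h)\<close> outside the ball.
  By the balance equation \<open>J(y) / J(y\<^sub>A) = 1 + q (1 - e^(-s))\<close> with \<open>s = \<lambda> (y - y\<^sub>A)\<close>, so the weight is at
  most \<open>e^(-n q (s - 1 + e^(-s)))\<close> relative to \<open>y\<^sub>A\<close>: the piston height concentrates at \<open>y\<^sub>A\<close>
  exponentially fast. By the energy equation and the law of large numbers \<open>\<beta> u / \<kappa>\<close> is
  near \<open>1\<close> when \<open>y\<close> is near \<open>y\<^sub>A\<close>, so the reweighting costs only a subexponential factor in the normalisation.
  Hoeffding's inequality under the product law, with the continuity of \<open>y \<mapsto> \<nu>\<^bsub>x,y,\<lambda>\<^esub>\<close>,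
  then gives the convergence of the empirical measure. Since the ball lies inside the container,
  horizontal slices of its complement have a volume that does not depend on \<open>x\<close>; this makes the
  horizontal position of the piston uniform.
\<close>

section \<open>Products of identical probability spaces\<close>

text \<open>The value of \<open>\<beta>\<close> is forced: a gas particle at height \<open>h\<close>
  costs energy \<open>m * g * h / n\<close>, so only
  \<open>\<beta> = n * \<lambda> / (m * g)\<close> turns \<open>e^(\<beta> u)\<close> into a product
  of factors \<open>e^(-\<lambda> h)\<close>. The energy equation then says that the mean energy
  left for the velocities is \<open>d * m * g / (2 * \<lambda>)\<close>, the limit of
  \<open>\<kappa> / \<beta>\<close>; this is where \<open>\<psi>\<close> attains its maximum 1. The
  obstacle is the energy constraint, which couples all particles. The bound
  \<open>\<psi> \<le> 1\<close> removes it from upper bounds: an event of probability at most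
  \<open>e^(-c n)\<close> under the product law keeps this bound in the numerator. The normalisation
  only has to exceed \<open>e^(-\<epsilon> n)\<close> for every \<open>\<epsilon>\<close>, so a
  crude event of probability 1/2 from Chebyshev's inequality is enough. That lower bound integrates
  over heights just above \<open>y\<^sub>A\<close>, since the argument relies on
  \<open>y\<^sub>A \<ge> R\<close> alone and heights below \<open>R\<close> are inadmissible. All
  estimates are made at a frozen horizontal piston position; averaging them over positions gives the
  claim on the unconditioned height.\<close>

lemma PiM_density:
  assumes I: "finite I" and N: "sigma_finite_measure N" and f [measurable]: "f \<in> borel_measurable N"
    and p: "prob_space (density N f)"
  shows "PiM I (\<lambda>_. density N f) = density (PiM I (\<lambda>_. N)) (\<lambda>z. \<Prod>i\<in>I. f (z i))"
proof -
  interpret N: product_sigma_finite "\<lambda>_. N" using N by (simp add: product_sigma_finite_def)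
  interpret D: product_prob_space "\<lambda>_. density N f" by (intro product_prob_spaceI p)
  show ?thesis
  proof (rule D.PiM_eqI[symmetric])
    show "sets (density (PiM I (\<lambda>_. N)) (\<lambda>z. \<Prod>i\<in>I. f (z i))) = sets (PiM I (\<lambda>_. density N f))"
      unfolding sets_density by (rule sets_PiM_cong) simp_all
    fix A assume A: "\<And>i. i \<in> I \<Longrightarrow> A i \<in> sets (density N f)"
    hence [measurable]: "\<And>i. i \<in> I \<Longrightarrow> A i \<in> sets N" by simp
    have [measurable]: "PiE I A \<in> sets (PiM I (\<lambda>_. N))" using I A by (intro sets_PiM_I_finite) auto
    have fm: "(\<lambda>z. \<Prod>i\<in>I. f (z i)) \<in> borel_measurable (PiM I (\<lambda>_. N))" by measurable
    have "emeasure (density (PiM I (\<lambda>_. N)) (\<lambda>z. \<Prod>i\<in>I. f (z i))) (PiE I A)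
       = (\<integral>\<^sup>+z. (\<Prod>i\<in>I. f (z i)) * indicator (PiE I A) z \<partial>PiM I (\<lambda>_. N))"
      by (rule emeasure_density[OF fm]) measurable
    also have "\<dots> = (\<integral>\<^sup>+z. (\<Prod>i\<in>I. f (z i) * indicator (A i) (z i)) \<partial>PiM I (\<lambda>_. N))"
    proof (rule nn_integral_cong)
      fix z assume "z \<in> space (PiM I (\<lambda>_. N))"
      hence "z \<in> PiE I A \<longleftrightarrow> (\<forall>i\<in>I. z i \<in> A i)"
        by (auto simp: space_PiM PiE_def)
      hence "indicator (PiE I A) z = (\<Prod>i\<in>I. indicator (A i) (z i) :: ennreal)"
        using I by (cases "\<forall>i\<in>I. z i \<in> A i") (simp_all add: indicator_def prod_zero_iff)
      thus "(\<Prod>i\<in>I. f (z i)) * indicator (PiE I A) z = (\<Prod>i\<in>I. f (z i) * indicator (A i) (z i))"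
        by (simp add: prod.distrib)
    qed
    also have "\<dots> = (\<Prod>i\<in>I. \<integral>\<^sup>+z. f z * indicator (A i) z \<partial>N)"
      by (rule N.product_nn_integral_prod[OF I]) measurable
    also have "\<dots> = (\<Prod>i\<in>I. emeasure (density N f) (A i))"
      by (rule prod.cong[OF refl], rule emeasure_density[symmetric]) measurable
    finally show "emeasure (density (PiM I (\<lambda>_. N)) (\<lambda>z. \<Prod>i\<in>I. f (z i))) (PiE I A)
      = (\<Prod>i\<in>I. emeasure (density N f) (A i))" .
  qed (use I in auto)
qed

lemma (in prob_space) indep_vars_PiM_coordinates:
  assumes [measurable]: "f \<in> borel_measurable M" and I: "finite I" "I \<noteq> {}"
  shows "prob_space.indep_vars (PiM I (\<lambda>_. M)) (\<lambda>_. borel) (\<lambda>i z. f (z i) :: real) I"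
proof -
  have F: "prob_space (PiM I (\<lambda>_. M))" by (rule prob_space_PiM) (rule prob_space_axioms)
  have comp: "distr (PiM I (\<lambda>_. M)) borel (\<lambda>z. f (z i)) = distr M borel f" if i: "i \<in> I" for i
  proof -
    have "distr (PiM I (\<lambda>_. M)) borel (\<lambda>z. f (z i)) = distr (distr (PiM I (\<lambda>_. M)) M (\<lambda>z. z i)) borel f"
      using i by (subst distr_distr) (auto simp: comp_def)
    thus ?thesis using i by (simp add: distr_PiM_component[of I "\<lambda>_. M", OF prob_space_axioms])
  qed
  \<comment> \<open>The pushforward rule asks for probability measures on the target side as well.
    Only their sigma algebra matters, so a point mass on \<open>borel\<close> serves.\<close>
  let ?N = "return borel (0 :: real)"
  have "distr (PiM I (\<lambda>_. M)) (PiM I (\<lambda>_. borel)) (\<lambda>z. \<lambda>i\<in>I. f (z i))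
      = distr (PiM I (\<lambda>_. M)) (PiM I (\<lambda>_. ?N)) (compose I f)"
    by (rule distr_cong) (auto simp: compose_def intro!: sets_PiM_cong)
  also have "\<dots> = PiM I (\<lambda>_. distr M ?N f)"
    by (rule distr_PiM_finite_prob_space'[OF I(1)])
       (use prob_space_axioms in \<open>auto intro!: prob_space_return simp: measurable_return2\<close>)
  also have "\<dots> = PiM I (\<lambda>i. distr (PiM I (\<lambda>_. M)) borel (\<lambda>z. f (z i)))"
    by (rule PiM_cong) (auto simp: comp intro!: distr_cong)
  finally show ?thesis
    by (subst prob_space.indep_vars_iff_distr_eq_PiM'[OF F I(2)]) auto
qed

lemma (in prob_space) integral_PiM_coordinate:
  assumes "f \<in> borel_measurable M" "i \<in> I"
  shows "(\<integral>z. f (z i) \<partial>PiM I (\<lambda>_. M)) = (\<integral>w. f w \<partial>M :: real)"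
    and "integrable (PiM I (\<lambda>_. M)) (\<lambda>z. f (z i)) \<longleftrightarrow> integrable M f"
proof -
  have d: "distr (PiM I (\<lambda>_. M)) M (\<lambda>z. z i) = M"
    by (rule distr_PiM_component[of I "\<lambda>_. M"]) (use prob_space_axioms assms in auto)
  have m: "(\<lambda>z. z i) \<in> PiM I (\<lambda>_. M) \<rightarrow>\<^sub>M M" using assms by measurable
  show "(\<integral>z. f (z i) \<partial>PiM I (\<lambda>_. M)) = (\<integral>w. f w \<partial>M)"
    using integral_distr[OF m assms(1)] by (simp add: d)
  show "integrable (PiM I (\<lambda>_. M)) (\<lambda>z. f (z i)) \<longleftrightarrow> integrable M f"
    using integrable_distr_eq[OF m assms(1)] by (simp add: d)
qed

text \<open>The bound on \<open>f\<close> is only almost sure, because the test functions are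
  bounded on the container and the gas law charges nothing else. The range \<open>{-B..B}\<close> of
  width \<open>2 * B\<close> produces the constant in the exponent.\<close>

lemma (in prob_space) Hoeffding_PiM:
  fixes n :: nat
  assumes [measurable]: "f \<in> borel_measurable M" and f: "AE w in M. \<bar>f w\<bar> \<le> B" and B: "B > 0"
    and e: "e \<ge> 0" and n: "n \<ge> 1"
  shows "measure (PiM {..<n} (\<lambda>_. M)) {z \<in> space (PiM {..<n} (\<lambda>_. M)). \<bar>(\<Sum>i<n. f (z i)) / n - (\<integral>w. f w \<partial>M)\<bar> \<ge> e}
     \<le> 2 * exp (- (real n * e\<^sup>2 / (2 * B\<^sup>2)))"
proof -
  let ?P = "PiM {..<n} (\<lambda>_. M)"
  have ne: "{..<n} \<noteq> {}" using n lessThan_empty_iff[of n] by simp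
  interpret F: prob_space ?P by (rule prob_space_PiM) (rule prob_space_axioms)
  have ind: "F.indep_vars (\<lambda>_. borel) (\<lambda>i z. f (z i)) {..<n}"
    by (rule indep_vars_PiM_coordinates) (use ne in auto)
  interpret H: Hoeffding_ineq ?P "{..<n}" "\<lambda>i z. f (z i)" "\<lambda>_. - B" "\<lambda>_. B" "real n * (\<integral>w. f w \<partial>M)"
  proof unfold_locales
    show "real n * (\<integral>w. f w \<partial>M) \<equiv> \<Sum>i<n. F.expectation (\<lambda>z. f (z i))"
      by (rule eq_reflection) (simp add: integral_PiM_coordinate)
    fix i assume i: "i \<in> {..<n}"
    have "AE z in ?P. \<bar>f (z i)\<bar> \<le> B"
      using AE_PiM_component[of "{..<n}" "\<lambda>_. M" i "\<lambda>w. \<bar>f w\<bar> \<le> B"] prob_space_axioms i f by auto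
    thus "AE z in ?P. f (z i) \<in> {-B..B}" by eventually_elim auto
  qed (use ind in auto)
  have "{z \<in> space ?P. \<bar>(\<Sum>i<n. f (z i)) / n - (\<integral>w. f w \<partial>M)\<bar> \<ge> e}
     = {z \<in> space ?P. \<bar>(\<Sum>i<n. f (z i)) - real n * (\<integral>w. f w \<partial>M)\<bar> \<ge> real n * e}"
  proof (intro Collect_cong conj_cong refl)
    fix z
    have "\<bar>(\<Sum>i<n. f (z i)) - real n * (\<integral>w. f w \<partial>M)\<bar> = real n * \<bar>(\<Sum>i<n. f (z i)) / n - (\<integral>w. f w \<partial>M)\<bar>"
    proof -
      have "(\<Sum>i<n. f (z i)) - real n * (\<integral>w. f w \<partial>M) = real n * ((\<Sum>i<n. f (z i)) / n - (\<integral>w. f w \<partial>M))"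
        using n by (simp add: field_simps)
      thus ?thesis by (simp add: abs_mult)
    qed
    thus "(e \<le> \<bar>(\<Sum>i<n. f (z i)) / n - (\<integral>w. f w \<partial>M)\<bar>)
       = (real n * e \<le> \<bar>(\<Sum>i<n. f (z i)) - real n * (\<integral>w. f w \<partial>M)\<bar>)"
      using n by simp
  qed
  moreover have "F.prob {z \<in> space ?P. \<bar>(\<Sum>i<n. f (z i)) - real n * (\<integral>w. f w \<partial>M)\<bar> \<ge> real n * e}
      \<le> 2 * exp (- 2 * (real n * e)\<^sup>2 / (\<Sum>i<n. (B - - B)\<^sup>2))"
    by (rule H.Hoeffding_ineq_abs_ge) (use n B e in auto)
  moreover have "- 2 * (real n * e)\<^sup>2 / (\<Sum>i<n. (B - - B)\<^sup>2) = - (real n * e\<^sup>2 / (2 * B\<^sup>2))"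
    using n B by (simp add: power2_eq_square field_simps)
  ultimately show ?thesis by simp
qed

text \<open>Serves the particle heights, which are unbounded and so out of reach of Hoeffding's
  inequality. After centring, independence kills the mixed products in the square of the sum. The
  variance is then replaced by the larger second moment, which is easier to bound uniformly in the
  piston height.\<close>

lemma (in prob_space) Chebyshev_PiM:
  fixes n :: nat and e :: real
  assumes [measurable]: "f \<in> borel_measurable M" and f2: "integrable M (\<lambda>w. (f w)\<^sup>2 :: real)"
    and e: "e > 0" and n: "n \<ge> 1"
  shows "measure (PiM {..<n} (\<lambda>_. M)) {z \<in> space (PiM {..<n} (\<lambda>_. M)). \<bar>(\<Sum>i<n. f (z i)) / n - (\<integral>w. f w \<partial>M)\<bar> \<ge> e}
     \<le> (\<integral>w. (f w)\<^sup>2 \<partial>M) / (n * e\<^sup>2)"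
proof -
  let ?P = "PiM {..<n} (\<lambda>_. M)"
  have ne: "{..<n} \<noteq> {}" using n lessThan_empty_iff[of n] by simp
  interpret F: prob_space ?P by (rule prob_space_PiM) (rule prob_space_axioms)
  have fint: "integrable M f" using f2 by (rule square_integrable_imp_integrable[rotated]) simp
  define \<mu> where "\<mu> = (\<integral>w. f w \<partial>M)"
  define h where "h w = f w - \<mu>" for w
  have h [measurable]: "h \<in> borel_measurable M" unfolding h_def by measurable
  have hint: "integrable M h" unfolding h_def using fint by simp
  have h0: "(\<integral>w. h w \<partial>M) = 0" using fint by (simp add: h_def \<mu>_def prob_space)
  have h2: "integrable M (\<lambda>w. (h w)\<^sup>2)"
    using f2 fint by (simp add: h_def power2_diff)
  have hv: "(\<integral>w. (h w)\<^sup>2 \<partial>M) \<le> (\<integral>w. (f w)\<^sup>2 \<partial>M)"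
    using variance_eq[OF fint f2] by (simp add: h_def \<mu>_def)
  have ind: "F.indep_vars (\<lambda>_. borel) (\<lambda>i z. h (z i)) {..<n}"
    by (rule indep_vars_PiM_coordinates) (use ne in auto)
  have coord: "integrable ?P (\<lambda>z. h (z i))" "(\<integral>z. h (z i) \<partial>?P) = 0" if "i < n" for i
    using integral_PiM_coordinate[OF h, of i "{..<n}"] hint h0 that by auto
  have cross: "integrable ?P (\<lambda>z. h (z i) * h (z j))"
       "(\<integral>z. h (z i) * h (z j) \<partial>?P) = (if i = j then (\<integral>w. (h w)\<^sup>2 \<partial>M) else 0)"
    if ij: "i < n" "j < n" for i j
  proof -
    have "integrable ?P (\<lambda>z. h (z i) * h (z j)) \<and>
       (\<integral>z. h (z i) * h (z j) \<partial>?P) = (if i = j then (\<integral>w. (h w)\<^sup>2 \<partial>M) else 0)"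
    proof (cases "i = j")
      case True
      have "(\<lambda>w. (h w)\<^sup>2) \<in> borel_measurable M" by measurable
      from integral_PiM_coordinate[OF this, of i "{..<n}"] show ?thesis
        using ij h2 True by (simp add: power2_eq_square)
    next
      case False
      have sub: "F.indep_vars (\<lambda>_. borel) (\<lambda>i z. h (z i)) {i, j}"
        by (rule F.indep_vars_subset[OF ind]) (use ij in auto)
      have int: "integrable ?P (\<lambda>z. h (z k))" if "k \<in> {i, j}" for k
        using coord ij that by blast
      have fin: "finite {i, j}" by simp
      from F.indep_vars_integrable[OF fin sub int] F.indep_vars_lebesgue_integral[OF fin sub int]
      show ?thesis using False coord(2)[OF ij(1)] by simp
    qed
    thus "integrable ?P (\<lambda>z. h (z i) * h (z j))"
       "(\<integral>z. h (z i) * h (z j) \<partial>?P) = (if i = j then (\<integral>w. (h w)\<^sup>2 \<partial>M) else 0)" by blast+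
  qed
  have sq: "(\<Sum>i<n. h (z i))\<^sup>2 = (\<Sum>i<n. \<Sum>j<n. h (z i) * h (z j))" for z
    by (simp add: power2_eq_square sum_product)
  have row: "integrable ?P (\<lambda>z. \<Sum>j<n. h (z i) * h (z j))" if "i < n" for i
    by (rule Bochner_Integration.integrable_sum) (simp add: cross that)
  have Sint: "integrable ?P (\<lambda>z. (\<Sum>i<n. h (z i))\<^sup>2)"
    unfolding sq by (rule Bochner_Integration.integrable_sum) (simp add: row)
  have "(\<integral>z. (\<Sum>i<n. h (z i))\<^sup>2 \<partial>?P) = (\<Sum>i<n. \<integral>z. (\<Sum>j<n. h (z i) * h (z j)) \<partial>?P)"
    unfolding sq by (rule Bochner_Integration.integral_sum) (simp add: row)
  also have "\<dots> = (\<Sum>i<n. \<Sum>j<n. \<integral>z. h (z i) * h (z j) \<partial>?P)"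
    by (rule sum.cong[OF refl], rule Bochner_Integration.integral_sum) (simp add: cross)
  also have "\<dots> = (\<Sum>i<n. \<Sum>j<n. if i = j then (\<integral>w. (h w)\<^sup>2 \<partial>M) else 0)"
    by (intro sum.cong refl) (simp add: cross)
  also have "\<dots> = real n * (\<integral>w. (h w)\<^sup>2 \<partial>M)" by simp
  finally have var: "(\<integral>z. (\<Sum>i<n. h (z i))\<^sup>2 \<partial>?P) = real n * (\<integral>w. (h w)\<^sup>2 \<partial>M)" .
  have "(\<integral>z. (\<Sum>i<n. h (z i)) \<partial>?P) = (\<Sum>i<n. \<integral>z. h (z i) \<partial>?P)"
    by (rule Bochner_Integration.integral_sum) (simp add: coord)
  hence mean: "(\<integral>z. (\<Sum>i<n. h (z i)) \<partial>?P) = 0" by (simp add: coord)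
  have Sm [measurable]: "(\<lambda>z. \<Sum>i<n. h (z i)) \<in> borel_measurable ?P" by measurable
  have "{z \<in> space ?P. \<bar>(\<Sum>i<n. f (z i)) / n - (\<integral>w. f w \<partial>M)\<bar> \<ge> e}
     = {z \<in> space ?P. \<bar>(\<Sum>i<n. h (z i))\<bar> \<ge> real n * e}"
  proof (intro Collect_cong conj_cong refl)
    fix z
    have "\<bar>(\<Sum>i<n. h (z i))\<bar> = real n * \<bar>(\<Sum>i<n. f (z i)) / n - (\<integral>w. f w \<partial>M)\<bar>"
    proof -
      have "(\<Sum>i<n. h (z i)) = real n * ((\<Sum>i<n. f (z i)) / n - (\<integral>w. f w \<partial>M))"
        using n by (simp add: h_def \<mu>_def sum_subtractf field_simps)
      thus ?thesis by (simp add: abs_mult)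
    qed
    thus "(e \<le> \<bar>(\<Sum>i<n. f (z i)) / n - (\<integral>w. f w \<partial>M)\<bar>) = (real n * e \<le> \<bar>(\<Sum>i<n. h (z i))\<bar>)"
      using n by simp
  qed
  moreover have "F.prob {z \<in> space ?P. \<bar>(\<Sum>i<n. h (z i))\<bar> \<ge> real n * e} \<le> real n * (\<integral>w. (h w)\<^sup>2 \<partial>M) / (real n * e)\<^sup>2"
    using F.Chebyshev_inequality[OF Sm Sint, of "real n * e"] n e by (simp add: mean var)
  moreover have "real n * (\<integral>w. (h w)\<^sup>2 \<partial>M) / (real n * e)\<^sup>2 = (\<integral>w. (h w)\<^sup>2 \<partial>M) / (n * e\<^sup>2)"
    using n e by (simp add: power2_eq_square field_simps)
  moreover have "(\<integral>w. (h w)\<^sup>2 \<partial>M) / (n * e\<^sup>2) \<le> (\<integral>w. (f w)\<^sup>2 \<partial>M) / (n * e\<^sup>2)"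
    by (intro divide_right_mono hv) auto
  ultimately show ?thesis by simp
qed

section \<open>Elementary estimates for exponentials\<close>

lemma exp_minus_superlinear:
  fixes e :: real
  assumes "e > 0"
  obtains k where "k > 0" "\<And>s. \<bar>s\<bar> \<ge> e \<Longrightarrow> k * \<bar>s\<bar> \<le> s - 1 + exp (- s)"
proof
  define \<theta> :: "real \<Rightarrow> real" where "\<theta> s = s - 1 + exp (- s)" for s
  define k where "k = min (\<theta> e) (\<theta> (- e)) / e"
  have pos: "\<theta> s > 0" if "s \<noteq> 0" for s
    using that exp_minus_greater[of s] by (simp add: \<theta>_def)
  show "k > 0" using pos[of e] pos[of "-e"] assms by (simp add: k_def)
  fix s :: real assume s: "\<bar>s\<bar> \<ge> e"
  \<comment> \<open>The function \<open>\<theta>\<close> is convex and vanishes at 0, and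
    \<open>u * s\<close> is one of \<open>e\<close>, \<open>- e\<close>. Convexity along the segment
    from 0 to \<open>s\<close> bounds \<open>\<theta> (u * s)\<close> by
    \<open>u * \<theta> s\<close>, which means growth at least linear.\<close>
  define u where "u = e / \<bar>s\<bar>"
  have u: "0 \<le> u" "u \<le> 1" using s assms by (auto simp: u_def)
  have "exp (1 * ((1 - u) *\<^sub>R 0 + u *\<^sub>R (- s))) \<le> (1 - u) * exp (1 * 0) + u * exp (1 * (- s))"
    using u by (intro convex_onD[OF convex_on_exp]) auto
  hence "\<theta> (u * s) \<le> u * \<theta> s" by (simp add: \<theta>_def algebra_simps)
  moreover have "u * s = e \<or> u * s = - e" using s assms by (auto simp: u_def abs_if)
  ultimately have "min (\<theta> e) (\<theta> (- e)) \<le> u * \<theta> s" by auto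
  hence "k * \<bar>s\<bar> \<le> \<theta> s" using s assms by (simp add: k_def u_def field_simps)
  thus "k * \<bar>s\<bar> \<le> s - 1 + exp (- s)" by (simp add: \<theta>_def)
qed

lemma nn_integral_exp_minus:
  assumes "l > 0"
  shows "(\<integral>\<^sup>+h. indicator {0..} h * ennreal (exp (- l * h)) \<partial>lborel) = ennreal (1 / l)"
proof -
  interpret prob_space "density lborel (exponential_density l)"
    using prob_space_exponential_density[OF assms] .
  let ?I = "\<integral>\<^sup>+h. indicator {0..} h * ennreal (exp (- l * h)) \<partial>lborel"
  have "(\<integral>\<^sup>+h. ennreal (exponential_density l h) \<partial>lborel) = 1"
    using emeasure_space_1 by (simp add: emeasure_density)
  also have "(\<integral>\<^sup>+h. ennreal (exponential_density l h) \<partial>lborel)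
     = (\<integral>\<^sup>+h. ennreal l * (indicator {0..} h * ennreal (exp (- l * h))) \<partial>lborel)"
  proof (rule nn_integral_cong)
    fix h :: real
    have "ennreal l * ennreal (exp (- l * h)) = ennreal (l * exp (- h * l))"
      using assms by (simp add: ennreal_mult mult.commute)
    thus "ennreal (exponential_density l h) = ennreal l * (indicator {0..} h * ennreal (exp (- l * h)))"
      by (auto simp: exponential_density_def indicator_def)
  qed
  also have "\<dots> = ennreal l * ?I"
    by (rule nn_integral_cmult) measurable
  finally have *: "ennreal l * ?I = 1" .
  have "ennreal (1 / l) * ennreal l = 1" using assms by (subst ennreal_mult[symmetric]) auto
  hence "?I = ennreal (1 / l) * (ennreal l * ?I)" by (simp only: mult.assoc[symmetric] mult_1)
  thus ?thesis unfolding * by simp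
qed

section \<open>Geometry of the container\<close>

lemma emeasure_lborel_open_pos:
  fixes S :: "'a::euclidean_space set"
  assumes "open S" "S \<noteq> {}"
  shows "emeasure lborel S > 0"
proof -
  have "emeasure lborel S \<noteq> 0"
  proof
    assume "emeasure lborel S = 0"
    hence "S \<in> null_sets lborel" using assms by (auto simp: null_sets_def)
    hence "negligible S" by (simp add: negligible_iff_null_sets null_sets_completionI)
    thus False using assms open_not_negligible by blast
  qed
  thus ?thesis by (simp add: zero_less_iff_neq_zero)
qed

text \<open>If \<open>h\<close> is farther than \<open>R\<close> from \<open>y\<close>, the root of
  a negative number is negative and the ball on the right is empty, so no case distinction is
  needed.\<close>

lemma mem_ball_Pair_iff:
  fixes x p :: "'a::real_normed_vector" and y h R :: real
  assumes "R > 0"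
  shows "(p, h) \<in> ball (x, y) R \<longleftrightarrow> p \<in> ball x (sqrt (R\<^sup>2 - (h - y)\<^sup>2))"
proof -
  have "(p, h) \<in> ball (x, y) R \<longleftrightarrow> sqrt ((dist x p)\<^sup>2 + (dist y h)\<^sup>2) < sqrt (R\<^sup>2)"
    using assms by (simp add: dist_Pair_Pair power2_commute)
  also have "\<dots> \<longleftrightarrow> (dist x p)\<^sup>2 + (dist y h)\<^sup>2 < R\<^sup>2"
    by (simp only: real_sqrt_less_iff)
  also have "\<dots> \<longleftrightarrow> (dist x p)\<^sup>2 < R\<^sup>2 - (h - y)\<^sup>2"
    by (simp add: dist_real_def power2_commute algebra_simps)
  also have "\<dots> \<longleftrightarrow> sqrt ((dist x p)\<^sup>2) < sqrt (R\<^sup>2 - (h - y)\<^sup>2)"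
    by (simp only: real_sqrt_less_iff)
  finally show ?thesis by simp
qed

lemma fst_borel [measurable]: "fst \<in> borel_measurable (borel :: ('a::second_countable_topology \<times> 'b::second_countable_topology) measure)"
  by (intro borel_measurable_continuous_onI continuous_intros)

lemma snd_borel [measurable]: "snd \<in> borel_measurable (borel :: ('a::second_countable_topology \<times> 'b::second_countable_topology) measure)"
  by (intro borel_measurable_continuous_onI continuous_intros)

locale piston =
  fixes Db :: "'a::euclidean_space set" and R m M g E :: real
  assumes Db_open: "open Db" and Db_bdd: "bounded Db" and R_pos: "R > 0"
    and ball_fits: "\<exists>z. cball z R \<subseteq> interior (cyl Db)"
    and m_pos: "m > 0" and M_pos: "M > 0" and g_pos: "g > 0" and E_gt: "E > M * g * R"
begin

abbreviation "out x y \<equiv> cyl Db - ball (x, y) R"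

text \<open>The equator of a ball centred above \<open>x\<close> is a copy of
  \<open>ball x R\<close>; conversely, a ball centred higher than \<open>R\<close> projects into
  \<open>ball x R\<close> and stays above the floor. A condition on all heights thus becomes one on
  \<open>Db\<close> alone.\<close>

lemma Dbp_eq: "Dbp Db R = {x. ball x R \<subseteq> Db}"
proof (intro set_eqI iffI)
  fix x assume x: "x \<in> Dbp Db R"
  have "p \<in> Db" if "p \<in> ball x R" for p
  proof -
    have "(p, R + 1) \<in> ball (x, R + 1) R"
      using that R_pos by (simp add: dist_Pair_Pair)
    moreover have "ball (x, R + 1) R \<subseteq> cyl Db"
      using x by (simp add: Dbp_def)
    ultimately show ?thesis by (auto simp: cyl_def)
  qed
  thus "x \<in> {x. ball x R \<subseteq> Db}" by auto
next
  fix x assume "x \<in> {x. ball x R \<subseteq> Db}"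
  hence x: "ball x R \<subseteq> Db" by simp
  have "ball (x, y) R \<subseteq> cyl Db" if "y > R" for y
  proof
    fix z assume z: "z \<in> ball (x, y) R"
    have "dist x (fst z) < R" "dist y (snd z) < R"
      using z dist_fst_le[of "(x, y)" z] dist_snd_le[of "(x, y)" z] by auto
    with x that show "z \<in> cyl Db"
      by (cases z) (auto simp: cyl_def dist_real_def subset_eq)
  qed
  moreover have "x \<in> Db" using x R_pos by auto
  ultimately show "x \<in> Dbp Db R" by (simp add: Dbp_def)
qed

text \<open>The definition of \<open>Dbp\<close> speaks of heights above \<open>R\<close> only. The
  height \<open>R\<close> itself, a piston resting on the floor, is covered because the ball is
  open.\<close>

lemma ball_subset_cyl:
  assumes "x \<in> Dbp Db R" "y \<ge> R"
  shows "ball (x, y) R \<subseteq> cyl Db"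
proof
  fix z assume z: "z \<in> ball (x, y) R"
  have "dist x (fst z) < R" "dist y (snd z) < R"
    using z dist_fst_le[of "(x, y)" z] dist_snd_le[of "(x, y)" z] by auto
  with assms show "z \<in> cyl Db"
    by (cases z) (auto simp: cyl_def dist_real_def subset_eq Dbp_eq)
qed

lemma closed_Dbp: "closed (Dbp Db R)"
proof -
  have "Dbp Db R = (\<Inter>p\<in>-Db. {x. R \<le> dist x p})"
    by (auto simp: Dbp_eq subset_eq not_less) (meson ComplI not_less)
  moreover have "closed {x::'a. R \<le> dist x p}" for p
    by (intro closed_Collect_le continuous_intros)
  ultimately show ?thesis by auto
qed

lemma Dbp_borel [measurable]: "Dbp Db R \<in> sets borel"
  using closed_Dbp by (rule borel_closed)

lemma Db_borel [measurable]: "Db \<in> sets borel"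
  using Db_open by (rule borel_open)

lemma cyl_borel [measurable]: "cyl Db \<in> sets borel"
  unfolding cyl_def by (simp add: borel_Times)

lemma out_borel [measurable]: "out x y \<in> sets borel"
  using cyl_borel by auto

text \<open>Projecting the given closed ball puts a compact ball of radius \<open>R\<close> into the
  open set \<open>Db\<close>, so some room is left around it. That room gives \<open>Dbp\<close>
  positive volume and shows that the piston cannot fill a whole cross section.\<close>

lemma exists_larger_ball: "\<exists>x e. e > 0 \<and> ball x (R + e) \<subseteq> Db"
proof -
  obtain x y where xy: "cball (x, y) R \<subseteq> interior (cyl Db)"
    using ball_fits by auto
  have sub: "cball x R \<subseteq> Db"
  proof
    fix p assume "p \<in> cball x R"
    hence "(p, y) \<in> cball (x, y) R" by (simp add: dist_Pair_Pair)
    with xy show "p \<in> Db" using interior_subset[of "cyl Db"] by (auto simp: cyl_def)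
  qed
  show ?thesis
  proof (cases "Db = UNIV")
    case True thus ?thesis by (intro exI[of _ x] exI[of _ 1]) auto
  next
    case False
    have "\<exists>d>0. \<forall>p\<in>cball x R. \<forall>q\<in>-Db. d \<le> dist p q"
      by (rule separate_compact_closed) (use sub Db_open in auto)
    then obtain d where d: "d > 0" "\<And>p q. p \<in> cball x R \<Longrightarrow> q \<in> - Db \<Longrightarrow> d \<le> dist p q"
      by blast
    have "ball x (R + d) \<subseteq> Db"
    proof (rule ccontr)
      assume "\<not> ?thesis"
      then obtain q where "q \<in> ball x (R + d)" and q: "q \<notin> Db" by blast
      hence q: "dist x q < R + d" "q \<notin> Db" by auto
      have qR: "dist x q > R" using q sub by (meson ComplD linorder_not_less mem_cball subsetD)
      \<comment> \<open>The point where the segment from \<open>x\<close> to \<open>q\<close> leaves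
        the closed ball. Its distance to \<open>q\<close> is \<open>dist x q - R\<close>, less than
        the separation \<open>d\<close>.\<close>
      define p where "p = x + (R / dist x q) *\<^sub>R (q - x)"
      have "dist x p = R"
        using qR R_pos by (cases "q = x") (auto simp: p_def dist_norm norm_minus_commute)
      hence "p \<in> cball x R" by simp
      moreover have "dist p q < d"
      proof -
        have "p - q = (R / dist x q - 1) *\<^sub>R (q - x)"
          by (simp add: p_def algebra_simps)
        hence "dist p q = \<bar>R / dist x q - 1\<bar> * dist x q"
          by (simp add: dist_norm norm_minus_commute)
        also have "\<dots> = dist x q - R" using qR R_pos by (cases "q = x") (auto simp: abs_if field_simps)
        finally show ?thesis using q by simp
      qed
      ultimately show False using d(2)[of p q] q by auto
    qed
    thus ?thesis using d by auto
  qed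
qed

lemma emeasure_Db_finite: "emeasure lborel Db < \<infinity>"
  using Db_bdd by (rule emeasure_bounded_finite)

lemma Dbp_pos: "emeasure lborel (Dbp Db R) > 0"
proof -
  obtain x e where e: "e > 0" "ball x (R + e) \<subseteq> Db" using exists_larger_ball by auto
  have "ball x e \<subseteq> Dbp Db R"
  proof
    fix p assume "p \<in> ball x e"
    hence "ball p R \<subseteq> ball x (R + e)"
      by (intro ball_subset_ball_iff[THEN iffD2]) (auto simp: dist_commute)
    with e show "p \<in> Dbp Db R" by (auto simp: Dbp_eq)
  qed
  hence "emeasure lborel (ball x e) \<le> emeasure lborel (Dbp Db R)"
    by (intro emeasure_mono) auto
  moreover have "emeasure lborel (ball x e) > 0"
    using e by (intro emeasure_lborel_open_pos) auto
  ultimately show ?thesis by auto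
qed

lemma Dbp_finite: "emeasure lborel (Dbp Db R) < \<infinity>"
  by (rule emeasure_bounded_finite) (use Db_bdd in \<open>auto simp: Dbp_def intro: bounded_subset\<close>)

text \<open>Since \<open>Db\<close> contains a ball of radius larger than \<open>R\<close>, no
  closed ball of radius \<open>R\<close> covers it, and what remains is open and nonempty. Gas over
  \<open>Db - ball x R\<close> never meets the piston, whatever its height.\<close>

lemma Db_minus_ball_pos: "emeasure lborel (Db - ball x R) > 0"
proof -
  obtain x' e where e: "e > 0" "ball x' (R + e) \<subseteq> Db" using exists_larger_ball by auto
  have "\<not> Db \<subseteq> cball x R"
  proof
    assume "Db \<subseteq> cball x R"
    hence "ball x' (R + e) \<subseteq> cball x R" using e by auto
    thus False using e R_pos by (auto simp: ball_subset_cball_iff) (smt (verit) zero_le_dist)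
  qed
  hence "Db - cball x R \<noteq> {}" by auto
  moreover have "open (Db - cball x R)" using Db_open by auto
  ultimately have "emeasure lborel (Db - cball x R) > 0"
    using emeasure_lborel_open_pos by blast
  also have "emeasure lborel (Db - cball x R) \<le> emeasure lborel (Db - ball x R)"
    by (intro emeasure_mono) auto
  finally show ?thesis .
qed

text \<open>What matters is that \<open>x\<close> is absent on the right: Fubini with the height
  outermost meets only slice volumes, and these are translation invariant.\<close>

lemma nn_integral_out:
  assumes x: "x \<in> Dbp Db R" and [measurable]: "f \<in> borel_measurable borel"
  shows "(\<integral>\<^sup>+z. indicator (out x y) z * f (snd z) \<partial>lborel)
     = (\<integral>\<^sup>+h. (emeasure lborel Db - emeasure lborel (ball (0::'a) (sqrt (R\<^sup>2 - (h - y)\<^sup>2))))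
              * indicator {0..} h * f h \<partial>lborel)"
proof -
  let ?r = "\<lambda>h. sqrt (R\<^sup>2 - (h - y)\<^sup>2)"
  have [measurable]: "(\<lambda>z::'a \<times> real. indicator (out x y) z * f (snd z)) \<in> borel_measurable (borel \<Otimes>\<^sub>M borel)"
    unfolding borel_prod by measurable
  have "(\<integral>\<^sup>+z. indicator (out x y) z * f (snd z) \<partial>lborel)
     = (\<integral>\<^sup>+z. indicator (out x y) z * f (snd z) \<partial>(lborel \<Otimes>\<^sub>M lborel))"
    by (simp only: lborel_prod)
  also have "\<dots> = (\<integral>\<^sup>+h. \<integral>\<^sup>+p. indicator (out x y) (p, h) * f h \<partial>lborel \<partial>lborel)"
    by (subst lborel_pair.nn_integral_snd[symmetric]) auto
  also have "\<dots> = (\<integral>\<^sup>+h. (emeasure lborel Db - emeasure lborel (ball (0::'a) (?r h)))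
              * indicator {0..} h * f h \<partial>lborel)"
  proof (rule nn_integral_cong)
    fix h :: real
    \<comment> \<open>A slice radius is at most \<open>R\<close>, so the slice lies in
      \<open>Db\<close> and its volume can simply be subtracted. At heights off the ball the radius
      is not positive and the slice is empty.\<close>
    have sub: "ball x (?r h) \<subseteq> Db"
    proof -
      have "?r h \<le> sqrt (R\<^sup>2)" by (intro real_sqrt_le_mono) auto
      hence "ball x (?r h) \<subseteq> ball x R" using R_pos by (intro subset_ball) auto
      with x show ?thesis by (auto simp: Dbp_eq)
    qed
    have "indicator (out x y) (p, h) = (indicator (Db - ball x (?r h)) p * indicator {0..} h :: ennreal)" for p
      using R_pos by (auto simp: indicator_def cyl_def mem_ball_Pair_iff simp del: mem_ball)
    hence "(\<integral>\<^sup>+p. indicator (out x y) (p, h) * f h \<partial>lborel)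
        = (\<integral>\<^sup>+p. indicator (Db - ball x (?r h)) p * (indicator {0..} h * f h) \<partial>lborel)"
      by (simp add: mult.assoc)
    also have "\<dots> = emeasure lborel (Db - ball x (?r h)) * (indicator {0..} h * f h)"
      by (subst nn_integral_multc) (auto intro!: borel_measurable_indicator)
    also have "emeasure lborel (Db - ball x (?r h)) = emeasure lborel Db - emeasure lborel (ball x (?r h))"
      using sub by (intro emeasure_Diff) (use emeasure_lborel_ball_finite[of x "?r h"] in auto)
    also have "emeasure lborel (ball x (?r h)) = emeasure lborel (ball (0::'a) (?r h))"
      by (cases "?r h > 0") (simp_all add: emeasure_ball ball_empty)
    finally show "(\<integral>\<^sup>+p. indicator (out x y) (p, h) * f h \<partial>lborel) =
       (emeasure lborel Db - emeasure lborel (ball (0::'a) (?r h))) * indicator {0..} h * f h"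
      by (simp add: mult.assoc)
  qed
  finally show ?thesis .
qed

end

section \<open>The velocity kernel\<close>

lemma ennreal_power_pos: "0 < c \<Longrightarrow> 0 < c ^ k" for c :: ennreal
  by (induction k) (auto simp: ennreal_zero_less_mult_iff)

interpretation lborel_prod: product_sigma_finite "\<lambda>_::nat. lborel :: ('a::euclidean_space) measure"
  by standard

text \<open>The normalising volume must be positive and finite. The unit ball is caught between two
  boxes, whose volumes are products: unit balls outside, and inside balls of radius
  \<open>1 / (n + 1)\<close>, small enough for \<open>n + 1\<close> squared norms to add up to at
  most 1.\<close>

lemma prob_space_unit_ball_PiM:
  "prob_space (uniform_measure (conf_space n :: (nat \<Rightarrow> 'a::euclidean_space \<times> real) measure)
     {w \<in> space (conf_space n). (\<Sum>i\<le>n. (norm (w i))\<^sup>2) \<le> 1})"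
proof -
  let ?C = "conf_space n :: (nat \<Rightarrow> 'a::euclidean_space \<times> real) measure"
  let ?S = "{w \<in> space ?C. (\<Sum>i\<le>n. (norm (w i))\<^sup>2) \<le> 1}"
  have S[measurable]: "?S \<in> sets ?C" by measurable
  have sub: "?S \<subseteq> PiE {..n} (\<lambda>_. cball 0 1)"
  proof (intro subsetI PiE_I)
    fix w i assume w: "w \<in> ?S" and i: "i \<in> {..n}"
    have "(norm (w i))\<^sup>2 \<le> (\<Sum>i\<le>n. (norm (w i))\<^sup>2)"
      using i by (intro member_le_sum) auto
    also have "\<dots> \<le> 1" using w by simp
    finally show "w i \<in> cball 0 1" by (simp add: power2_le_iff_abs_le abs_square_le_1)
  qed (auto simp: space_PiM PiE_def extensional_def)
  have sup: "PiE {..n} (\<lambda>_. ball 0 (1 / (real n + 1))) \<subseteq> ?S"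
  proof (intro subsetI CollectI conjI)
    fix w :: "nat \<Rightarrow> 'a \<times> real" assume w: "w \<in> PiE {..n} (\<lambda>_. ball 0 (1 / (real n + 1)))"
    show "w \<in> space ?C" using w by (auto simp: space_PiM PiE_def)
    have "(\<Sum>i\<le>n. (norm (w i))\<^sup>2) \<le> (\<Sum>i\<le>n. 1 / (real n + 1))"
    proof (rule sum_mono)
      fix i assume "i \<in> {..n}"
      with w have "norm (w i) < 1 / (real n + 1)" by (auto simp: PiE_def Pi_def)
      hence "(norm (w i))\<^sup>2 \<le> (1 / (real n + 1))\<^sup>2" by (intro power_mono) auto
      also have "\<dots> \<le> 1 / (real n + 1)" by (simp add: power2_eq_square divide_simps)
      finally show "(norm (w i))\<^sup>2 \<le> 1 / (real n + 1)" .
    qed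
    thus "(\<Sum>i\<le>n. (norm (w i))\<^sup>2) \<le> 1" by (simp add: add.commute)
  qed
  have "emeasure ?C ?S \<le> emeasure ?C (PiE {..n} (\<lambda>_. cball 0 1))"
    using sub by (intro emeasure_mono sets_PiM_I_finite) auto
  also have "\<dots> = (\<Prod>i\<le>n. emeasure lborel (cball (0::'a \<times> real) 1))"
    by (intro lborel_prod.emeasure_PiM) auto
  also have "\<dots> < \<infinity>"
    using emeasure_lborel_cball_finite[of "0::'a \<times> real" 1] by (simp add: power_less_top_ennreal ennreal_mult_less_top)
  finally have fin: "emeasure ?C ?S \<noteq> \<infinity>" by (rule less_imp_neq)
  have "emeasure lborel (ball (0::'a \<times> real) (1 / (real n + 1))) > 0"
    by (rule emeasure_lborel_open_pos) simp_all
  hence "0 < (\<Prod>i\<le>n. emeasure lborel (ball (0::'a \<times> real) (1 / (real n + 1))))"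
    by (simp only: prod_constant ennreal_power_pos)
  also have "\<dots> = emeasure ?C (PiE {..n} (\<lambda>_. ball 0 (1 / (real n + 1))))"
    by (intro lborel_prod.emeasure_PiM[symmetric]) auto
  also have "\<dots> \<le> emeasure ?C ?S"
    using sup by (intro emeasure_mono) auto
  finally have pos: "emeasure ?C ?S \<noteq> 0" by (rule less_imp_neq[symmetric])
  show ?thesis by (rule prob_space_uniform_measure[OF pos fin])
qed

lemma potential_measurable [measurable]:
  "potential m M g n \<in> borel_measurable (conf_space n :: (nat \<Rightarrow> 'a::euclidean_space \<times> real) measure)"
  unfolding potential_def by measurable

text \<open>Two successive pushforwards merge into one pushforward of a fixed measure, so that
  \<open>p\<close> enters through the map alone. In this form measurability in \<open>p\<close> is
  accessible.\<close>

lemma vel_kernel_eq: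
  assumes p: "p \<in> space (conf_space n)"
  shows "vel_kernel m M g E n p =
     distr (uniform_measure (conf_space n) {w \<in> space (conf_space n). (\<Sum>i\<le>n. (norm (w i))\<^sup>2) \<le> 1})
       (conf_space n \<Otimes>\<^sub>M conf_space n)
       (\<lambda>w :: nat \<Rightarrow> 'a::euclidean_space \<times> real. (p, \<lambda>i\<in>{..n}. (1 / sqrt (mass m M n i)) *\<^sub>R
           ((sqrt (2 * E - 2 * potential m M g n p) / sqrt (\<Sum>j\<le>n. (norm (w j))\<^sup>2)) *\<^sub>R w i)))"
  unfolding vel_kernel_def sphere_unif_def
  apply (subst distr_distr)
    apply (use p in measurable)
   apply (use p in measurable)
  apply (rule distr_cong)
    apply (auto simp: fun_eq_iff)
  done

lemma vel_kernel_measurable [measurable]: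
  "vel_kernel m M g E n \<in> (conf_space n :: (nat \<Rightarrow> 'a::euclidean_space \<times> real) measure)
     \<rightarrow>\<^sub>M prob_algebra (conf_space n \<Otimes>\<^sub>M conf_space n)"
proof -
  let ?C = "conf_space n :: (nat \<Rightarrow> 'a::euclidean_space \<times> real) measure"
  let ?U = "uniform_measure ?C {w \<in> space ?C. (\<Sum>i\<le>n. (norm (w i))\<^sup>2) \<le> 1}"
  interpret U: prob_space ?U by (rule prob_space_unit_ball_PiM)
  let ?k = "\<lambda>p. distr ?U (?C \<Otimes>\<^sub>M ?C)
       (\<lambda>w :: nat \<Rightarrow> 'a::euclidean_space \<times> real. (p, \<lambda>i\<in>{..n}. (1 / sqrt (mass m M n i)) *\<^sub>R
           ((sqrt (2 * E - 2 * potential m M g n p) / sqrt (\<Sum>j\<le>n. (norm (w j))\<^sup>2)) *\<^sub>R w i)))"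
  have "?k \<in> ?C \<rightarrow>\<^sub>M subprob_algebra (?C \<Otimes>\<^sub>M ?C)"
  proof (rule measurable_distr2)
    show "(\<lambda>p. ?U) \<in> ?C \<rightarrow>\<^sub>M subprob_algebra ?C"
      by (rule measurable_const) (simp add: space_subprob_algebra U.subprob_space_axioms)
  qed measurable
  hence "?k \<in> ?C \<rightarrow>\<^sub>M prob_algebra (?C \<Otimes>\<^sub>M ?C)"
    by (rule measurable_prob_algebraI[rotated]) (rule U.prob_space_distr, measurable)
  thus ?thesis
    by (subst measurable_cong[OF vel_kernel_eq]) auto
qed

lemma emeasure_vel_kernel:
  assumes p: "p \<in> space (conf_space n)"
    and A [measurable]: "A \<in> sets (conf_space n :: (nat \<Rightarrow> 'a::euclidean_space \<times> real) measure)"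
  shows "emeasure (vel_kernel m M g E n p) (A \<times> space (conf_space n)) = indicator A p"
proof -
  let ?C = "conf_space n :: (nat \<Rightarrow> 'a::euclidean_space \<times> real) measure"
  let ?U = "uniform_measure ?C {w \<in> space ?C. (\<Sum>i\<le>n. (norm (w i))\<^sup>2) \<le> 1}"
  interpret U: prob_space ?U by (rule prob_space_unit_ball_PiM)
  define F where "F = (\<lambda>w :: nat \<Rightarrow> 'a \<times> real. \<lambda>i\<in>{..n}. (1 / sqrt (mass m M n i)) *\<^sub>R
           ((sqrt (2 * E - 2 * potential m M g n p) / sqrt (\<Sum>j\<le>n. (norm (w j))\<^sup>2)) *\<^sub>R w i))"
  have F [measurable]: "F \<in> ?C \<rightarrow>\<^sub>M ?C" unfolding F_def by measurable
  have eq: "vel_kernel m M g E n p = distr ?U (?C \<Otimes>\<^sub>M ?C) (\<lambda>w. (p, F w))"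
    unfolding F_def by (rule vel_kernel_eq[OF p])
  have [measurable]: "(\<lambda>w. (p, F w)) \<in> ?U \<rightarrow>\<^sub>M ?C \<Otimes>\<^sub>M ?C" using p by measurable
  have "emeasure (vel_kernel m M g E n p) (A \<times> space ?C) = emeasure ?U ((\<lambda>w. (p, F w)) -` (A \<times> space ?C) \<inter> space ?U)"
    unfolding eq by (rule emeasure_distr) auto
  also have "(\<lambda>w. (p, F w)) -` (A \<times> space ?C) \<inter> space ?U = (if p \<in> A then space ?U else {})"
    using measurable_space[OF F] by auto
  finally show ?thesis by (simp add: U.emeasure_space_1 del: space_uniform_measure)
qed

text \<open>Velocities carry total mass 1 and leave the position untouched, so they integrate out of
  every event on positions. All limit statements concern such events.\<close>

lemma emeasure_bind_vel_kernel:
  assumes N: "sets N = sets (conf_space n)"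
    and A [measurable]: "A \<in> sets (conf_space n :: (nat \<Rightarrow> 'a::euclidean_space \<times> real) measure)"
  shows "emeasure (N \<bind> vel_kernel m M g E n) (A \<times> space (conf_space n)) = emeasure N A"
proof -
  let ?C = "conf_space n :: (nat \<Rightarrow> 'a::euclidean_space \<times> real) measure"
  have sp: "space N = space ?C" using N by (rule sets_eq_imp_space_eq)
  have ne: "space N \<noteq> {}" by (simp add: sp space_PiM PiE_eq_empty_iff)
  have k: "vel_kernel m M g E n \<in> N \<rightarrow>\<^sub>M subprob_algebra (?C \<Otimes>\<^sub>M ?C)"
    using measurable_prob_algebraD[OF vel_kernel_measurable] by (simp cong: measurable_cong_sets add: N)
  have "emeasure (N \<bind> vel_kernel m M g E n) (A \<times> space ?C)
     = (\<integral>\<^sup>+p. emeasure (vel_kernel m M g E n p) (A \<times> space ?C) \<partial>N)"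
    by (rule emeasure_bind[OF ne k]) auto
  also have "\<dots> = (\<integral>\<^sup>+p. indicator A p \<partial>N)"
    by (intro nn_integral_cong emeasure_vel_kernel) (auto simp: sp)
  also have "\<dots> = emeasure N A" using N by simp
  finally show ?thesis .
qed

section \<open>Disintegration along the horizontal piston coordinate\<close>

text \<open>Slabs of bounded height have finite mass. This lets the vertical line above
  \<open>x\<close> serve as one factor of a sigma-finite product.\<close>

lemma sigma_finite_line:
  "sigma_finite_measure (distr lborel borel (\<lambda>y::real. (x::'a::euclidean_space, y)))"
proof
  let ?A = "range (\<lambda>k::nat. (UNIV::'a set) \<times> {- real k..real k})"
  have "\<exists>k. - real k \<le> y \<and> y \<le> real k" for y :: real
    using real_arch_simple[of "\<bar>y\<bar>"] by (auto simp: abs_le_iff) (metis minus_le_iff)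
  hence "\<Union>?A = UNIV" by auto
  moreover have "emeasure (distr lborel borel (\<lambda>y::real. (x, y))) (UNIV \<times> {- real k..real k}) \<noteq> \<infinity>" for k
    by (subst emeasure_distr) (auto simp: borel_Times)
  moreover have "?A \<subseteq> sets borel" by (auto intro!: borel_Times)
  ultimately show "\<exists>A. countable A \<and> A \<subseteq> sets (distr lborel borel (\<lambda>y::real. (x, y))) \<and>
      \<Union>A = space (distr lborel borel (\<lambda>y::real. (x, y))) \<and>
      (\<forall>a\<in>A. emeasure (distr lborel borel (\<lambda>y::real. (x, y))) a \<noteq> \<infinity>)"
    by (intro exI[of _ ?A]) auto
qed

abbreviation cond_space :: "nat \<Rightarrow> 'a::euclidean_space \<Rightarrow> (nat \<Rightarrow> 'a \<times> real) measure" where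
  "cond_space n x \<equiv> PiM {..n} (\<lambda>i. if i < n then lborel else distr lborel borel (\<lambda>y::real. (x, y)))"

lemma sets_cond_space [measurable_cong, simp]: "sets (cond_space n x) = sets (conf_space n)"
  by (intro sets_PiM_cong) auto

lemma space_cond_space [simp]: "space (cond_space n x) = space (conf_space n)"
  by (rule sets_eq_imp_space_eq) simp

lemma update_measurable [measurable]:
  "(\<lambda>(q, z). z(n := q)) \<in> borel \<Otimes>\<^sub>M PiM {..<n} (\<lambda>_. lborel) \<rightarrow>\<^sub>M
     (conf_space n :: (nat \<Rightarrow> 'a::euclidean_space \<times> real) measure)"
  unfolding case_prod_beta
  by (rule measurable_fun_upd[where J="{..<n}"]) auto

lemma nn_integral_cond_space:
  fixes F :: "(nat \<Rightarrow> 'a::euclidean_space \<times> real) \<Rightarrow> ennreal"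
  assumes F [measurable]: "F \<in> borel_measurable (conf_space n)"
  shows "(\<integral>\<^sup>+p. F p \<partial>cond_space n x)
    = (\<integral>\<^sup>+y. \<integral>\<^sup>+z. F (z(n := (x, y))) \<partial>PiM {..<n} (\<lambda>_. lborel) \<partial>lborel)"
proof -
  let ?K = "\<lambda>i. if i < n then lborel else distr lborel borel (\<lambda>y::real. (x, y))"
  interpret K: product_sigma_finite ?K
    by (auto simp: product_sigma_finite_def sigma_finite_line lborel.sigma_finite_measure_axioms)
  have ins: "{..n} = insert n {..<n}" by auto
  have low: "PiM {..<n} ?K = PiM {..<n} (\<lambda>_. lborel)" by (rule PiM_cong) auto
  have F': "F \<in> borel_measurable (PiM (insert n {..<n}) ?K)"
    unfolding ins[symmetric] by measurable
  have "(\<integral>\<^sup>+p. F p \<partial>cond_space n x) = (\<integral>\<^sup>+p. F p \<partial>PiM (insert n {..<n}) ?K)"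
    by (simp add: ins)
  also have "\<dots> = (\<integral>\<^sup>+q. \<integral>\<^sup>+z. F (z(n := q)) \<partial>PiM {..<n} ?K \<partial>?K n)"
    by (rule K.product_nn_integral_insert_rev[OF _ _ F']) auto
  also have "\<dots> = (\<integral>\<^sup>+q. \<integral>\<^sup>+z. F (z(n := q)) \<partial>PiM {..<n} (\<lambda>_. lborel) \<partial>distr lborel borel (\<lambda>y::real. (x, y)))"
    unfolding low by simp
  finally have *: "(\<integral>\<^sup>+p. F p \<partial>cond_space n x) = \<dots>" .
  interpret sigma_finite_measure "PiM {..<n} (\<lambda>_. lborel :: ('a \<times> real) measure)"
    by (rule lborel_prod.sigma_finite) simp
  have "(\<lambda>q. \<integral>\<^sup>+z. F (z(n := q)) \<partial>PiM {..<n} (\<lambda>_. lborel)) \<in> borel_measurable borel"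
    by measurable
  hence G: "(\<lambda>q. \<integral>\<^sup>+z. F (z(n := q)) \<partial>PiM {..<n} (\<lambda>_. lborel)) \<in> borel_measurable (distr lborel borel (\<lambda>y::real. (x, y)))"
    by simp
  have line: "(\<lambda>y::real. (x, y)) \<in> lborel \<rightarrow>\<^sub>M borel"
    by measurable
  show ?thesis unfolding * by (rule nn_integral_distr[OF line G])
qed

lemma nn_integral_cond_space_measurable [measurable]:
  fixes F :: "(nat \<Rightarrow> 'a::euclidean_space \<times> real) \<Rightarrow> ennreal"
  assumes F [measurable]: "F \<in> borel_measurable (conf_space n)"
  shows "(\<lambda>x. \<integral>\<^sup>+p. F p \<partial>cond_space n x) \<in> borel_measurable borel"
proof -
  interpret sigma_finite_measure "PiM {..<n} (\<lambda>_. lborel :: ('a \<times> real) measure)"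
    by (rule lborel_prod.sigma_finite) simp
  show ?thesis unfolding nn_integral_cond_space[OF F] by measurable
qed

lemma nn_integral_conf_space:
  fixes F :: "(nat \<Rightarrow> 'a::euclidean_space \<times> real) \<Rightarrow> ennreal"
  assumes F [measurable]: "F \<in> borel_measurable (conf_space n)"
  shows "(\<integral>\<^sup>+p. F p \<partial>conf_space n) = (\<integral>\<^sup>+x. \<integral>\<^sup>+p. F p \<partial>cond_space n x \<partial>lborel)"
proof -
  interpret sigma_finite_measure "PiM {..<n} (\<lambda>_. lborel :: ('a \<times> real) measure)"
    by (rule lborel_prod.sigma_finite) simp
  have ins: "{..n} = insert n {..<n}" by auto
  have "(\<integral>\<^sup>+p. F p \<partial>conf_space n) = (\<integral>\<^sup>+q. \<integral>\<^sup>+z. F (z(n := q)) \<partial>PiM {..<n} (\<lambda>_. lborel) \<partial>lborel)"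
    unfolding ins by (rule lborel_prod.product_nn_integral_insert_rev) (auto simp flip: ins)
  also have "\<dots> = (\<integral>\<^sup>+q. \<integral>\<^sup>+z. F (z(n := q)) \<partial>PiM {..<n} (\<lambda>_. lborel) \<partial>(lborel \<Otimes>\<^sub>M lborel))"
    by (simp only: lborel_prod)
  also have "\<dots> = (\<integral>\<^sup>+x. \<integral>\<^sup>+y. \<integral>\<^sup>+z. F (z(n := (x, y))) \<partial>PiM {..<n} (\<lambda>_. lborel) \<partial>lborel \<partial>lborel)"
    by (rule lborel.nn_integral_fst[symmetric]) (simp only: lborel_prod, measurable)
  finally show ?thesis by (simp add: nn_integral_cond_space)
qed

section \<open>Normalised densities\<close>

lemma emeasure_ndens:
  assumes [measurable]: "f \<in> borel_measurable N" "A \<in> sets N"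
  shows "emeasure (ndens N f) A
    = (\<integral>\<^sup>+p. ennreal (f p) * indicator A p \<partial>N) / (\<integral>\<^sup>+p. ennreal (f p) \<partial>N)"
proof -
  have "emeasure (ndens N f) A = (\<integral>\<^sup>+p. (ennreal (f p) * indicator A p) / (\<integral>\<^sup>+ w. ennreal (f w) \<partial>N) \<partial>N)"
    unfolding ndens_def
    by (subst emeasure_density) (auto intro!: nn_integral_cong simp: divide_ennreal_def mult_ac)
  also have "\<dots> = (\<integral>\<^sup>+p. ennreal (f p) * indicator A p \<partial>N) / (\<integral>\<^sup>+p. ennreal (f p) \<partial>N)"
    by (rule nn_integral_divide) measurable
  finally show ?thesis .
qed

lemma sets_ndens [simp, measurable_cong]: "sets (ndens N f) = sets N"
  by (simp add: ndens_def)

lemma space_ndens [simp]: "space (ndens N f) = space N"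
  by (simp add: ndens_def)

lemma prob_space_ndens:
  assumes [measurable]: "f \<in> borel_measurable N"
    and "(\<integral>\<^sup>+p. ennreal (f p) \<partial>N) \<noteq> 0" "(\<integral>\<^sup>+p. ennreal (f p) \<partial>N) \<noteq> \<infinity>"
  shows "prob_space (ndens N f)"
proof
  have "(\<integral>\<^sup>+p. ennreal (f p) * indicator (space N) p \<partial>N) = (\<integral>\<^sup>+p. ennreal (f p) \<partial>N)"
    by (intro nn_integral_cong) auto
  with assms show "emeasure (ndens N f) (space (ndens N f)) = 1"
    by (simp add: emeasure_ndens ennreal_divide_self less_top)
qed

section \<open>The position density and the mass of its slices\<close>

context piston
begin

definition kappa :: "nat \<Rightarrow> real" where
  "kappa n = (real ((n + 1) * (DIM('a) + 1)) - 2) / 2"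

text \<open>The potential sees the gas only through its total height \<open>s\<close>, so the
  density splits into an indicator of admissible places and this function of two reals. The case
  distinction is essential: \<open>powr\<close> does not vanish at negative bases.\<close>

definition energy_fac :: "nat \<Rightarrow> real \<Rightarrow> real \<Rightarrow> real" where
  "energy_fac n y s = (if m * g / real n * s + M * g * y \<le> E
     then (E - (m * g / real n * s + M * g * y)) powr kappa n else 0)"

lemma energy_fac_measurable [measurable]:
  "(\<lambda>(y, s). energy_fac n y s) \<in> borel_measurable (borel \<Otimes>\<^sub>M borel)"
  unfolding energy_fac_def by measurable

text \<open>For \<open>n = 0\<close> and \<open>d = 2\<close> the exponent is 0; one gas particle is
  enough to make it positive.\<close>

lemma kappa_pos: "n \<ge> 1 \<Longrightarrow> kappa n > 0"
proof -
  assume "n \<ge> 1"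
  hence "2 * 2 \<le> (n + 1) * (DIM('a) + 1)"
    using DIM_positive[where 'a='a] by (intro mult_le_mono) auto
  hence "real (2 * 2) \<le> real ((n + 1) * (DIM('a) + 1))" by (simp only: of_nat_le_iff)
  thus ?thesis unfolding kappa_def by simp
qed

lemma pos_dens_eq:
  "pos_dens Db R m M g E n (z(n := (x, y)))
    = indicator (Dbp Db R) x * indicator {R..} y * (\<Prod>i<n. indicator (out x y) (z i)) * energy_fac n y (\<Sum>i<n. snd (z i))"
proof -
  have pot: "potential m M g n (z(n := (x, y))) = m * g / real n * (\<Sum>i<n. snd (z i)) + M * g * y"
  proof -
    have "{..n} = insert n {..<n}" by auto
    thus ?thesis by (simp add: potential_def mass_def sum_distrib_left mult_ac)
  qed
  have pr: "(\<Prod>i<n. indicator (out x y) (z i)) = (if \<forall>i<n. z i \<in> out x y then 1 else 0 :: real)"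
    by (auto simp: indicator_def prod_zero_iff)
  have adm: "z(n := (x, y)) \<in> admissible Db R m M g E n \<longleftrightarrow> (\<forall>i<n. z i \<in> out x y) \<and> x \<in> Dbp Db R \<and> R \<le> y
      \<and> m * g / real n * (\<Sum>i<n. snd (z i)) + M * g * y \<le> E"
    by (auto simp: admissible_def pot)
  show ?thesis
    unfolding pos_dens_def pot pr energy_fac_def kappa_def[symmetric]
    by (auto simp: indicator_def adm)
qed

lemma pos_dens_measurable [measurable]:
  "pos_dens Db R m M g E n \<in> borel_measurable (conf_space n)"
proof -
  have "pos_dens Db R m M g E n = (\<lambda>p. if (\<forall>i\<in>{..<n}. p i \<in> cyl Db \<and> \<not> dist (p n) (p i) < R) \<and> fst (p n) \<in> Dbp Db R
     \<and> snd (p n) \<ge> R \<and> potential m M g n p \<le> E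
     then (E - potential m M g n p) powr kappa n else 0)"
    by (auto simp: fun_eq_iff pos_dens_def admissible_def kappa_def indicator_def)
  also have "\<dots> \<in> borel_measurable (conf_space n)"
    by measurable
  finally show ?thesis .
qed

text \<open>Induction peels off one particle at a time and treats it by
  \<open>nn_integral_out\<close>. Its height moves into the argument of \<open>f\<close>, which is
  why \<open>f\<close> has to be arbitrary.\<close>

lemma nn_integral_out_indep:
  assumes x: "x \<in> Dbp Db R" "x' \<in> Dbp Db R" and "f \<in> borel_measurable borel"
  shows "(\<integral>\<^sup>+z. (\<Prod>i<n. indicator (out x y) (z i)) * f (\<Sum>i<n. snd (z i)) \<partial>PiM {..<n} (\<lambda>_::nat. lborel))
       = (\<integral>\<^sup>+z. (\<Prod>i<n. indicator (out x' y) (z i)) * f (\<Sum>i<n. snd (z i)) \<partial>PiM {..<n} (\<lambda>_::nat. lborel))"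
  using assms(3)
proof (induction n arbitrary: f)
  case 0 show ?case by simp
next
  case (Suc n)
  note f [measurable] = Suc.prems
  interpret sigma_finite_measure "PiM {..<n} (\<lambda>_. lborel :: ('a \<times> real) measure)"
    by (rule lborel_prod.sigma_finite) simp
  define G where "G x h = (\<integral>\<^sup>+z. (\<Prod>i<n. indicator (out x y) (z i)) * f (h + (\<Sum>i<n. snd (z i)))
      \<partial>PiM {..<n} (\<lambda>_. lborel))" for x h
  have G [measurable]: "G x \<in> borel_measurable borel" for x unfolding G_def by measurable
  have step: "(\<integral>\<^sup>+z. (\<Prod>i<Suc n. indicator (out x y) (z i)) * f (\<Sum>i<Suc n. snd (z i)) \<partial>PiM {..<Suc n} (\<lambda>_. lborel))
     = (\<integral>\<^sup>+q. indicator (out x y) q * G x (snd q) \<partial>lborel)" for x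
  proof -
    have "(\<integral>\<^sup>+z. (\<Prod>i<Suc n. indicator (out x y) (z i)) * f (\<Sum>i<Suc n. snd (z i)) \<partial>PiM {..<Suc n} (\<lambda>_. lborel))
      = (\<integral>\<^sup>+q. \<integral>\<^sup>+z. (\<Prod>i<Suc n. indicator (out x y) ((z(n := q)) i)) * f (\<Sum>i<Suc n. snd ((z(n := q)) i))
           \<partial>PiM {..<n} (\<lambda>_. lborel) \<partial>lborel)"
      unfolding lessThan_Suc by (rule lborel_prod.product_nn_integral_insert_rev) (auto simp flip: lessThan_Suc)
    also have "\<dots> = (\<integral>\<^sup>+q. \<integral>\<^sup>+z. indicator (out x y) q * ((\<Prod>i<n. indicator (out x y) (z i)) * f (snd q + (\<Sum>i<n. snd (z i))))
           \<partial>PiM {..<n} (\<lambda>_. lborel) \<partial>lborel)"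
      by (intro nn_integral_cong) (simp add: lessThan_Suc mult_ac)
    also have "\<dots> = (\<integral>\<^sup>+q. indicator (out x y) q * G x (snd q) \<partial>lborel)"
      unfolding G_def by (intro nn_integral_cong nn_integral_cmult) measurable
    finally show ?thesis .
  qed
  have "G x h = G x' h" for h
    unfolding G_def by (rule Suc.IH[of "\<lambda>t. f (h + t)"]) measurable
  hence eq: "G x = G x'" by (rule ext)
  have "(\<integral>\<^sup>+q. indicator (out x y) q * G x (snd q) \<partial>lborel) = (\<integral>\<^sup>+q. indicator (out x' y) q * G x' (snd q) \<partial>lborel)"
    using nn_integral_out[OF x(1) G[of x], of y] nn_integral_out[OF x(2) G[of x'], of y] eq by simp
  thus ?case by (rule trans[OF step[of x] trans[OF _ step[of x', symmetric]]])
qed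

end

lemma nn_integral_PiM_indicator_prod:
  fixes B :: "'a::euclidean_space set"
  assumes [measurable]: "B \<in> sets borel"
  shows "(\<integral>\<^sup>+z. (\<Prod>i<n. indicator B (z i)) \<partial>PiM {..<n} (\<lambda>_::nat. lborel)) = emeasure lborel B ^ n"
  by (subst lborel_prod.product_nn_integral_prod) auto

lemma emeasure_lborel_Times:
  fixes A :: "'a::euclidean_space set" and B :: "'b::euclidean_space set"
  assumes "A \<in> sets borel" "B \<in> sets borel"
  shows "emeasure lborel (A \<times> B) = emeasure lborel A * emeasure lborel B"
  using assms by (simp flip: lborel_prod add: lborel.emeasure_pair_measure_Times)

context piston
begin

text \<open>Up to a constant, the marginal density of the horizontal piston position. Its constancy
  on \<open>Dbp\<close> is the reason for the uniform distribution.\<close>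

definition cond_mass :: "nat \<Rightarrow> 'a \<Rightarrow> ennreal" where
  "cond_mass n x = (\<integral>\<^sup>+p. ennreal (pos_dens Db R m M g E n p) \<partial>cond_space n x)"

lemma energy_fac_nonneg: "energy_fac n y s \<ge> 0"
  by (simp add: energy_fac_def)

lemma ennreal_pos_dens_eq:
  assumes "x \<in> Dbp Db R"
  shows "ennreal (pos_dens Db R m M g E n (z(n := (x, y)))) = indicator {R..} y *
     ((\<Prod>i<n. indicator (out x y) (z i)) * ennreal (energy_fac n y (\<Sum>i<n. snd (z i))))"
proof -
  have "(\<Prod>i<n. indicator (out x y) (z i) :: ennreal) = ennreal (\<Prod>i<n. indicator (out x y) (z i))"
    by (subst prod_ennreal[symmetric]) (auto simp: ennreal_indicator)
  thus ?thesis
    using assms unfolding pos_dens_eq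
    by (simp add: ennreal_mult energy_fac_nonneg prod_nonneg mult.assoc flip: ennreal_indicator)
qed

lemma cond_mass_indep:
  assumes "x \<in> Dbp Db R" "x' \<in> Dbp Db R"
  shows "cond_mass n x = cond_mass n x'"
proof -
  have "(\<integral>\<^sup>+z. indicator {R..} y * ((\<Prod>i<n. indicator (out x y) (z i)) *
          ennreal (energy_fac n y (\<Sum>i<n. snd (z i)))) \<partial>PiM {..<n} (\<lambda>_. lborel))
      = (\<integral>\<^sup>+z. indicator {R..} y * ((\<Prod>i<n. indicator (out x' y) (z i)) *
          ennreal (energy_fac n y (\<Sum>i<n. snd (z i)))) \<partial>PiM {..<n} (\<lambda>_. lborel))" for y
    by (simp add: nn_integral_cmult nn_integral_out_indep[OF assms, of "\<lambda>s. ennreal (energy_fac n y s)"])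
  thus ?thesis
    unfolding cond_mass_def by (simp add: nn_integral_cond_space ennreal_pos_dens_eq assms)
qed

lemma nn_integral_pos_dens_outside:
  assumes "x \<notin> Dbp Db R" and [measurable]: "F \<in> borel_measurable (conf_space n)"
  shows "(\<integral>\<^sup>+p. ennreal (pos_dens Db R m M g E n p) * F p \<partial>cond_space n x) = 0"
  using assms(1) by (simp add: nn_integral_cond_space pos_dens_eq)

lemma cond_mass_outside: "x \<notin> Dbp Db R \<Longrightarrow> cond_mass n x = 0"
  using nn_integral_pos_dens_outside[of x "\<lambda>_. 1" n] by (simp add: cond_mass_def)

lemma cond_mass_pos:
  assumes x: "x \<in> Dbp Db R" and n: "n \<ge> 1"
  shows "cond_mass n x > 0"
proof -
  \<comment> \<open>Half of the energy excess is reserved for the velocities. The other half is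
    shared equally between the piston, which may rise by \<open>d1\<close>, and the gas particles,
    which may rise by \<open>d2\<close>.\<close>
  define d where "d = (E - M * g * R) / 2"
  define d1 where "d1 = d / (2 * (M * g))"
  define d2 where "d2 = d / (2 * (m * g))"
  have d: "d > 0" "d1 > 0" "d2 > 0"
    using E_gt M_pos m_pos g_pos by (auto simp: d_def d1_def d2_def)
  define B where "B = (Db - ball x R) \<times> {0..d2}"
  have B [measurable]: "B \<in> sets borel" unfolding B_def by (auto intro!: borel_Times)
  have Bpos: "emeasure lborel B > 0"
    unfolding B_def using Db_minus_ball_pos[of x] d
    by (subst emeasure_lborel_Times) (auto simp: ennreal_zero_less_mult_iff)
  have low: "indicator {R<..<R+d1} y * (ennreal (d powr kappa n) * (\<Prod>i<n. indicator B (z i)))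
      \<le> ennreal (pos_dens Db R m M g E n (z(n := (x, y))))" for y and z :: "nat \<Rightarrow> 'a \<times> real"
  proof (cases "y \<in> {R<..<R+d1} \<and> (\<forall>i<n. z i \<in> B)")
    case True
    hence y: "R < y" "y < R + d1" and z: "\<And>i. i < n \<Longrightarrow> z i \<in> B" by auto
    have out: "z i \<in> out x y" if "i < n" for i
      using z[OF that] dist_fst_le[of "(x, y)" "z i"] by (auto simp: B_def cyl_def)
    have "(\<Sum>i<n. snd (z i)) \<le> (\<Sum>i<n. d2)"
      using z by (intro sum_mono) (auto simp: B_def mem_Times_iff)
    hence "m * g / real n * (\<Sum>i<n. snd (z i)) \<le> m * g / real n * (real n * d2)"
      using m_pos g_pos by (intro mult_left_mono) auto
    also have "\<dots> = d / 2" using n m_pos g_pos by (simp add: d2_def)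
    finally have 1: "m * g / real n * (\<Sum>i<n. snd (z i)) \<le> d / 2" .
    have "M * g * y \<le> M * g * (R + d1)"
      using y M_pos g_pos by (intro mult_left_mono) auto
    also have "\<dots> = M * g * R + d / 2" using M_pos g_pos by (simp add: d1_def field_simps)
    finally have 2: "M * g * y \<le> M * g * R + d / 2" .
    have "d \<le> E - (m * g / real n * (\<Sum>i<n. snd (z i)) + M * g * y)"
    proof -
      have "E = 2 * d + M * g * R" by (simp add: d_def field_simps)
      with 1 2 show ?thesis by linarith
    qed
    hence "d powr kappa n \<le> energy_fac n y (\<Sum>i<n. snd (z i))"
      using d kappa_pos[OF n] unfolding energy_fac_def by (auto intro!: powr_mono2)
    thus ?thesis
      using True y out by (simp add: ennreal_pos_dens_eq[OF x] ennreal_leI)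
  next
    case False
    hence "indicator {R<..<R+d1} y * (\<Prod>i<n. indicator B (z i)) = (0 :: ennreal)"
      by (auto simp: indicator_def prod_zero_iff)
    hence "indicator {R<..<R+d1} y * (c * (\<Prod>i<n. indicator B (z i))) = (0 :: ennreal)" for c
      by (metis mult.left_commute mult_zero_right)
    thus ?thesis by (simp only: zero_le)
  qed
  have "0 < ennreal d1 * (ennreal (d powr kappa n) * emeasure lborel B ^ n)"
    using d Bpos by (simp add: ennreal_zero_less_mult_iff ennreal_power_pos)
  also have "\<dots> = (\<integral>\<^sup>+y. \<integral>\<^sup>+z. indicator {R<..<R+d1} y * (ennreal (d powr kappa n) * (\<Prod>i<n. indicator B (z i)))
      \<partial>PiM {..<n} (\<lambda>_. lborel) \<partial>lborel)"
    using d by (simp add: nn_integral_cmult nn_integral_multc nn_integral_PiM_indicator_prod)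
  also have "\<dots> \<le> (\<integral>\<^sup>+y. \<integral>\<^sup>+z. ennreal (pos_dens Db R m M g E n (z(n := (x, y))))
      \<partial>PiM {..<n} (\<lambda>_. lborel) \<partial>lborel)"
    by (intro nn_integral_mono low)
  also have "\<dots> = cond_mass n x" by (simp add: cond_mass_def nn_integral_cond_space)
  finally show ?thesis .
qed

lemma cond_mass_finite:
  assumes n: "n \<ge> 1"
  shows "cond_mass n x < \<infinity>"
proof (cases "x \<in> Dbp Db R")
  case x: True
  \<comment> \<open>Heights are nonnegative, so the energy bound caps each gas particle at
    \<open>n * E / (m * g)\<close> and the piston at \<open>E / (M * g)\<close>; the density is at
    most \<open>E powr kappa n\<close> there.\<close>
  define B where "B = Db \<times> {0..real n * E / (m * g)}"
  have E: "E > 0" using E_gt M_pos g_pos R_pos by (smt (verit) mult_pos_pos)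
  have B [measurable]: "B \<in> sets borel" unfolding B_def by (auto intro!: borel_Times)
  have Bfin: "emeasure lborel B < \<infinity>"
    unfolding B_def by (rule emeasure_bounded_finite) (auto intro!: bounded_Times Db_bdd)
  have up: "ennreal (pos_dens Db R m M g E n (z(n := (x, y))))
     \<le> indicator {R..E / (M * g)} y * (ennreal (E powr kappa n) * (\<Prod>i<n. indicator B (z i)))"
     for y and z :: "nat \<Rightarrow> 'a \<times> real"
  proof (cases "y \<ge> R \<and> (\<forall>i<n. z i \<in> out x y) \<and> m * g / real n * (\<Sum>i<n. snd (z i)) + M * g * y \<le> E")
    case True
    hence y: "R \<le> y" and z: "\<And>i. i < n \<Longrightarrow> z i \<in> out x y"
      and le: "m * g / real n * (\<Sum>i<n. snd (z i)) + M * g * y \<le> E" by auto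
    have z0: "snd (z i) \<ge> 0" if "i < n" for i using z[OF that] by (auto simp: cyl_def)
    hence s0: "(\<Sum>i<n. snd (z i)) \<ge> 0" by (intro sum_nonneg) auto
    hence s1: "m * g / real n * (\<Sum>i<n. snd (z i)) \<ge> 0"
      using m_pos g_pos by (intro mult_nonneg_nonneg) auto
    have y1: "M * g * y > 0" using y R_pos M_pos g_pos by auto
    have yE: "y \<le> E / (M * g)" using s1 le M_pos g_pos by (simp add: field_simps)
    have "m * g / real n * (\<Sum>i<n. snd (z i)) \<le> E" using le y1 by simp
    hence sE: "(\<Sum>i<n. snd (z i)) \<le> real n * E / (m * g)"
      using n m_pos g_pos by (simp add: field_simps)
    have "z i \<in> B" if i: "i < n" for i
    proof -
      have "snd (z i) \<le> (\<Sum>i<n. snd (z i))"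
        using z0 i by (intro member_le_sum) auto
      with sE z[OF i] show ?thesis by (auto simp: B_def cyl_def)
    qed
    moreover have "energy_fac n y (\<Sum>i<n. snd (z i)) \<le> E powr kappa n"
      using le s1 y1 kappa_pos[OF n] unfolding energy_fac_def by (auto intro!: powr_mono2)
    ultimately show ?thesis
      using y yE z by (simp add: ennreal_pos_dens_eq[OF x] ennreal_leI)
  next
    case False
    hence "ennreal (pos_dens Db R m M g E n (z(n := (x, y)))) = 0"
      unfolding ennreal_pos_dens_eq[OF x]
      by (auto simp: indicator_def prod_zero_iff energy_fac_def)
    thus ?thesis by simp
  qed
  have "cond_mass n x = (\<integral>\<^sup>+y. \<integral>\<^sup>+z. ennreal (pos_dens Db R m M g E n (z(n := (x, y))))
      \<partial>PiM {..<n} (\<lambda>_. lborel) \<partial>lborel)" by (simp add: cond_mass_def nn_integral_cond_space)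
  also have "\<dots> \<le> (\<integral>\<^sup>+y. \<integral>\<^sup>+z. indicator {R..E / (M * g)} y * (ennreal (E powr kappa n) * (\<Prod>i<n. indicator B (z i)))
      \<partial>PiM {..<n} (\<lambda>_. lborel) \<partial>lborel)"
    by (intro nn_integral_mono up)
  also have "\<dots> = emeasure lborel {R..E / (M * g)} * (ennreal (E powr kappa n) * emeasure lborel B ^ n)"
    by (simp add: nn_integral_cmult nn_integral_multc nn_integral_PiM_indicator_prod)
  also have "\<dots> < \<infinity>"
    using Bfin emeasure_bounded_finite[OF bounded_closed_interval[of R "E / (M * g)"]] by (auto simp: ennreal_mult_less_top power_less_top_ennreal)
  finally show ?thesis .
qed (simp add: cond_mass_outside)

section \<open>Conditional position laws and the uniform marginal\<close>

abbreviation "pos_cond n x \<equiv> ndens (cond_space n x) (pos_dens Db R m M g E n)"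

lemma emeasure_pos_cond:
  assumes [measurable]: "A \<in> sets (conf_space n)"
  shows "emeasure (pos_cond n x) A
    = (\<integral>\<^sup>+p. ennreal (pos_dens Db R m M g E n p) * indicator A p \<partial>cond_space n x) / cond_mass n x"
  unfolding cond_mass_def by (rule emeasure_ndens) measurable

lemma prob_space_pos_cond:
  assumes "x \<in> Dbp Db R" "n \<ge> 1"
  shows "prob_space (pos_cond n x)"
  by (rule prob_space_ndens) (use cond_mass_pos[OF assms] cond_mass_finite[OF assms(2), of x] in \<open>auto simp: cond_mass_def\<close>)

lemma pos_cond_measurable:
  assumes n: "n \<ge> 1"
  shows "pos_cond n \<in> borel \<rightarrow>\<^sub>M subprob_algebra (conf_space n)"
proof (rule measurable_subprob_algebra)
  fix x :: 'a
  show "subprob_space (pos_cond n x)"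
  proof (cases "x \<in> Dbp Db R")
    case True thus ?thesis using prob_space_pos_cond[OF _ n] prob_space_imp_subprob_space by blast
  next
    case False
    \<comment> \<open>Off \<open>Dbp\<close> the density vanishes almost everywhere on the slice, so
      this is the null measure: a kernel on the whole space is only sub-probabilistic.\<close>
    show ?thesis
    proof
      show "emeasure (pos_cond n x) (space (pos_cond n x)) \<le> 1"
        using False by (simp add: emeasure_pos_cond nn_integral_pos_dens_outside)
      show "space (pos_cond n x) \<noteq> {}" by (simp add: space_PiM PiE_eq_empty_iff)
    qed
  qed
  show "sets (pos_cond n x) = sets (conf_space n)" by simp
next
  fix A :: "(nat \<Rightarrow> 'a \<times> real) set"
  assume [measurable]: "A \<in> sets (conf_space n)"
  show "(\<lambda>x. emeasure (pos_cond n x) A) \<in> borel_measurable borel"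
    unfolding emeasure_pos_cond[OF \<open>A \<in> sets (conf_space n)\<close>] cond_mass_def by measurable
qed

lemma nn_integral_pos_dens_conf_space:
  assumes [measurable]: "A \<in> sets (conf_space n)"
  shows "(\<integral>\<^sup>+p. ennreal (pos_dens Db R m M g E n p) * indicator A p \<partial>conf_space n)
    = (\<integral>\<^sup>+x. indicator (Dbp Db R) x *
         (\<integral>\<^sup>+p. ennreal (pos_dens Db R m M g E n p) * indicator A p \<partial>cond_space n x) \<partial>lborel)"
  by (subst nn_integral_conf_space, measurable, intro nn_integral_cong)
     (auto simp: indicator_def[of "Dbp Db R"] nn_integral_pos_dens_outside)

lemma nn_integral_pos_dens_total:
  assumes x0: "x0 \<in> Dbp Db R"
  shows "(\<integral>\<^sup>+p. ennreal (pos_dens Db R m M g E n p) \<partial>conf_space n) = cond_mass n x0 * emeasure lborel (Dbp Db R)"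
proof -
  have "(\<integral>\<^sup>+p. ennreal (pos_dens Db R m M g E n p) \<partial>conf_space n) = (\<integral>\<^sup>+x. cond_mass n x \<partial>lborel)"
    unfolding cond_mass_def by (rule nn_integral_conf_space) measurable
  also have "\<dots> = (\<integral>\<^sup>+x. cond_mass n x0 * indicator (Dbp Db R) x \<partial>lborel)"
    by (intro nn_integral_cong) (auto simp: indicator_def cond_mass_outside intro: cond_mass_indep x0)
  also have "\<dots> = cond_mass n x0 * emeasure lborel (Dbp Db R)"
    by (simp add: nn_integral_cmult)
  finally show ?thesis .
qed

text \<open>All slices over \<open>Dbp\<close> have the same mass, so normalising each slice by
  itself and mixing uniformly amounts to normalising globally.\<close>

lemma ndens_conf_space_eq_bind:
  assumes x0: "x0 \<in> Dbp Db R" and n: "n \<ge> 1"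
  shows "ndens (conf_space n) (pos_dens Db R m M g E n) = uniform_measure lborel (Dbp Db R) \<bind> pos_cond n"
proof -
  let ?U = "uniform_measure lborel (Dbp Db R)"
  have k: "pos_cond n \<in> ?U \<rightarrow>\<^sub>M subprob_algebra (conf_space n)"
    using pos_cond_measurable[OF n] by (simp cong: measurable_cong_sets)
  show ?thesis
  proof (rule measure_eqI)
    show "sets (ndens (conf_space n) (pos_dens Db R m M g E n)) = sets (?U \<bind> pos_cond n)"
      by (subst sets_bind[where N="conf_space n"]) auto
    fix A assume "A \<in> sets (ndens (conf_space n) (pos_dens Db R m M g E n))"
    hence A [measurable]: "A \<in> sets (conf_space n)" by simp
    have "emeasure (?U \<bind> pos_cond n) A = (\<integral>\<^sup>+x. emeasure (pos_cond n x) A \<partial>?U)"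
      by (rule emeasure_bind[OF _ k A]) simp
    also have "\<dots> = (\<integral>\<^sup>+x. emeasure (pos_cond n x) A * indicator (Dbp Db R) x \<partial>lborel) / emeasure lborel (Dbp Db R)"
    proof (rule nn_integral_uniform_measure)
      show "(\<lambda>x. emeasure (pos_cond n x) A) \<in> borel_measurable lborel"
        using measurable_emeasure_kernel[OF pos_cond_measurable[OF n] A] by simp
    qed measurable
    also have "(\<integral>\<^sup>+x. emeasure (pos_cond n x) A * indicator (Dbp Db R) x \<partial>lborel)
       = (\<integral>\<^sup>+x. (indicator (Dbp Db R) x *
         (\<integral>\<^sup>+p. ennreal (pos_dens Db R m M g E n p) * indicator A p \<partial>cond_space n x)) / cond_mass n x0 \<partial>lborel)"
      by (intro nn_integral_cong) (auto simp: emeasure_pos_cond indicator_def[of "Dbp Db R"] cond_mass_indep[OF x0])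
    also have "\<dots> = (\<integral>\<^sup>+p. ennreal (pos_dens Db R m M g E n p) * indicator A p \<partial>conf_space n) / cond_mass n x0"
      by (subst nn_integral_divide) (auto simp: nn_integral_pos_dens_conf_space)
    also have "\<dots> / emeasure lborel (Dbp Db R) = emeasure (ndens (conf_space n) (pos_dens Db R m M g E n)) A"
    proof -
      have "a / z / v = a / (z * v)" if "z \<noteq> 0" "v \<noteq> 0" "z \<noteq> \<infinity>" "v \<noteq> \<infinity>" for a z v :: ennreal
        using that by (simp add: divide_ennreal_def ennreal_inverse_mult mult.assoc less_top)
      from this[of "cond_mass n x0" "emeasure lborel (Dbp Db R)"] show ?thesis
        using cond_mass_pos[OF x0 n] cond_mass_finite[OF n, of x0] Dbp_pos Dbp_finite
        by (subst emeasure_ndens) (auto simp: nn_integral_pos_dens_total[OF x0])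
    qed
    finally show "emeasure (ndens (conf_space n) (pos_dens Db R m M g E n)) A = emeasure (?U \<bind> pos_cond n) A" ..
  qed
qed

text \<open>Associativity of \<open>bind\<close> carries the mixture through the velocity kernel.
  Together with the uniform marginal it identifies \<open>Pn_cond\<close> as the conditional law
  given the horizontal piston position.\<close>

lemma Pn_eq_bind:
  assumes x0: "x0 \<in> Dbp Db R" and n: "n \<ge> 1"
  shows "Pn Db R m M g E n = uniform_measure lborel (Dbp Db R) \<bind> Pn_cond Db R m M g E n"
proof -
  have "pos_cond n \<in> uniform_measure lborel (Dbp Db R) \<rightarrow>\<^sub>M subprob_algebra (conf_space n)"
    using pos_cond_measurable[OF n] by (simp cong: measurable_cong_sets)
  from bind_assoc[OF this measurable_prob_algebraD[OF vel_kernel_measurable]]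
  show ?thesis
    unfolding Pn_def Pn_cond_def ndens_conf_space_eq_bind[OF assms] .
qed

lemma emeasure_Pn:
  "A \<in> sets (conf_space n) \<Longrightarrow> emeasure (Pn Db R m M g E n) (A \<times> space (conf_space n))
    = emeasure (ndens (conf_space n) (pos_dens Db R m M g E n)) A"
  unfolding Pn_def by (rule emeasure_bind_vel_kernel) auto

lemma emeasure_Pn_cond:
  "A \<in> sets (conf_space n) \<Longrightarrow> emeasure (Pn_cond Db R m M g E n x) (A \<times> space (conf_space n))
    = emeasure (pos_cond n x) A"
  unfolding Pn_cond_def by (rule emeasure_bind_vel_kernel) auto

lemma sets_Pn [simp]: "sets (Pn Db R m M g E n) = sets (conf_space n \<Otimes>\<^sub>M conf_space n)"
  unfolding Pn_def
  by (subst sets_bind[where N="conf_space n \<Otimes>\<^sub>M conf_space n"]) (auto simp: vel_kernel_def space_PiM PiE_eq_empty_iff)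

lemma sets_Pn_cond [simp]: "sets (Pn_cond Db R m M g E n x) = sets (conf_space n \<Otimes>\<^sub>M conf_space n)"
  unfolding Pn_cond_def
  by (subst sets_bind[where N="conf_space n \<Otimes>\<^sub>M conf_space n"]) (auto simp: vel_kernel_def space_PiM PiE_eq_empty_iff)

text \<open>Within the slice at \<open>x\<close> an event on the horizontal piston position is sure
  or impossible, and slice masses are constant on \<open>Dbp\<close> and zero elsewhere.\<close>

lemma distr_Pn:
  assumes x0: "x0 \<in> Dbp Db R" and n: "n \<ge> 1"
  shows "distr (Pn Db R m M g E n) borel (\<lambda>\<omega>. fst (fst \<omega> n)) = uniform_measure lborel (Dbp Db R)"
proof (rule measure_eqI)
  let ?C = "conf_space n :: (nat \<Rightarrow> 'a \<times> real) measure"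
  have sp: "space (Pn Db R m M g E n) = space ?C \<times> space ?C"
    using sets_eq_imp_space_eq[OF sets_Pn] by (simp add: space_pair_measure)
  have meas: "(\<lambda>\<omega>. fst (fst \<omega> n)) \<in> Pn Db R m M g E n \<rightarrow>\<^sub>M borel"
  proof -
    have "(\<lambda>\<omega>. fst (fst \<omega> n)) \<in> ?C \<Otimes>\<^sub>M ?C \<rightarrow>\<^sub>M borel" by measurable
    thus ?thesis by (simp cong: measurable_cong_sets)
  qed
  fix A :: "'a set" assume "A \<in> sets (distr (Pn Db R m M g E n) borel (\<lambda>\<omega>. fst (fst \<omega> n)))"
  hence A [measurable]: "A \<in> sets borel" by simp
  let ?A = "{p \<in> space ?C. fst (p n) \<in> A}"
  have A' [measurable]: "?A \<in> sets ?C" by measurable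
  have "emeasure (distr (Pn Db R m M g E n) borel (\<lambda>\<omega>. fst (fst \<omega> n))) A
      = emeasure (Pn Db R m M g E n) (?A \<times> space ?C)"
    by (subst emeasure_distr[OF meas A]) (auto simp: sp intro!: arg_cong2[where f=emeasure])
  also have "\<dots> = emeasure (ndens ?C (pos_dens Db R m M g E n)) ?A"
    by (rule emeasure_Pn) measurable
  also have "\<dots> = (\<integral>\<^sup>+p. ennreal (pos_dens Db R m M g E n p) * indicator ?A p \<partial>?C)
      / (cond_mass n x0 * emeasure lborel (Dbp Db R))"
    by (subst emeasure_ndens) (auto simp: nn_integral_pos_dens_total[OF x0])
  also have "(\<integral>\<^sup>+p. ennreal (pos_dens Db R m M g E n p) * indicator ?A p \<partial>?C)
     = (\<integral>\<^sup>+x. cond_mass n x0 * indicator (Dbp Db R \<inter> A) x \<partial>lborel)"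
    unfolding nn_integral_pos_dens_conf_space[OF A']
  proof (rule nn_integral_cong)
    fix x :: 'a
    have "(\<integral>\<^sup>+p. ennreal (pos_dens Db R m M g E n p) * indicator ?A p \<partial>cond_space n x) = indicator A x * cond_mass n x"
    proof -
      have "(\<integral>\<^sup>+p. ennreal (pos_dens Db R m M g E n p) * indicator ?A p \<partial>cond_space n x)
         = (\<integral>\<^sup>+y. \<integral>\<^sup>+z. ennreal (pos_dens Db R m M g E n (z(n := (x, y)))) * indicator ?A (z(n := (x, y)))
             \<partial>PiM {..<n} (\<lambda>_. lborel) \<partial>lborel)"
        by (rule nn_integral_cond_space) measurable
      also have "\<dots> = (\<integral>\<^sup>+y. \<integral>\<^sup>+z. ennreal (pos_dens Db R m M g E n (z(n := (x, y)))) * indicator A x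
             \<partial>PiM {..<n} (\<lambda>_. lborel) \<partial>lborel)"
        by (intro nn_integral_cong) (auto simp: indicator_def space_PiM PiE_def extensional_def)
      also have "\<dots> = (\<integral>\<^sup>+p. ennreal (pos_dens Db R m M g E n p) * indicator A x \<partial>cond_space n x)"
        by (rule nn_integral_cond_space[symmetric]) measurable
      also have "\<dots> = cond_mass n x * indicator A x"
        unfolding cond_mass_def by (rule nn_integral_multc) measurable
      finally show ?thesis by (simp only: mult.commute)
    qed
    thus "indicator (Dbp Db R) x * (\<integral>\<^sup>+p. ennreal (pos_dens Db R m M g E n p) * indicator ?A p \<partial>cond_space n x)
       = cond_mass n x0 * indicator (Dbp Db R \<inter> A) x"
      using cond_mass_indep[OF x0, of x n] by (auto simp: indicator_def)
  qed
  also have "\<dots> = cond_mass n x0 * emeasure lborel (Dbp Db R \<inter> A)"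
    by (simp add: nn_integral_cmult)
  also have "\<dots> / (cond_mass n x0 * emeasure lborel (Dbp Db R)) = emeasure (uniform_measure lborel (Dbp Db R)) A"
    using cond_mass_pos[OF x0 n] cond_mass_finite[OF n, of x0]
      divide_mult_eq[of "cond_mass n x0" "emeasure lborel (Dbp Db R \<inter> A)" "emeasure lborel (Dbp Db R)"]
    by (simp add: mult.commute)
  finally show "emeasure (distr (Pn Db R m M g E n) borel (\<lambda>\<omega>. fst (fst \<omega> n))) A
     = emeasure (uniform_measure lborel (Dbp Db R)) A" .
qed simp

end

section \<open>Exponential tilting\<close>

text \<open>A vertical shift multiplies the exponential profile by a constant. This special feature
  later yields \<open>I_ratio\<close> in closed form.\<close>

lemma I_ball_translate:
  fixes x x' :: "'a::euclidean_space"
  shows "I_ball R x y lam = exp (- lam * (y - y')) * I_ball R x' y' lam"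
proof -
  let ?f = "\<lambda>z. indicator (ball (x, y) R) z *\<^sub>R (lam * exp (- lam * snd z))"
  let ?v = "(x - x', y - y')"
  have "I_ball R x y lam = (\<integral>z. ?f z \<partial>(distr lborel borel ((+) ?v)))"
    unfolding I_ball_def set_lebesgue_integral_def by (simp add: lborel_distr_plus)
  also have "\<dots> = (\<integral>z. ?f (?v + z) \<partial>lborel)"
  proof (rule integral_distr)
    show "(+) ?v \<in> lborel \<rightarrow>\<^sub>M (borel :: ('a \<times> real) measure)"
      by (simp add: borel_measurable_continuous_onI continuous_intros)
    have [measurable]: "ball (x, y) R \<in> sets borel" by simp
    show "?f \<in> borel_measurable borel"
      by (intro borel_measurable_scaleR borel_measurable_indicator) measurable
  qed
  also have "\<dots> = (\<integral>z. exp (- lam * (y - y')) * (indicator (ball (x', y') R) z *\<^sub>R (lam * exp (- lam * snd z))) \<partial>lborel)"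
  proof (rule Bochner_Integration.integral_cong[OF refl])
    fix z :: "'a \<times> real"
    have "dist (x, y) (?v + z) = dist (x', y') z"
    proof -
      have "(x, y) - (?v + z) = (x', y') - z" by (cases z) auto
      thus ?thesis unfolding dist_norm by (rule arg_cong)
    qed
    hence "indicator (ball (x, y) R) (?v + z) = (indicator (ball (x', y') R) z :: real)"
      by (simp add: indicator_def)
    moreover have "exp (- lam * snd (?v + z)) = exp (- lam * (y - y')) * exp (- lam * snd z)"
      by (simp add: algebra_simps flip: exp_add)
    ultimately show "?f (?v + z)
      = exp (- lam * (y - y')) * (indicator (ball (x', y') R) z *\<^sub>R (lam * exp (- lam * snd z)))"
      by simp
  qed
  also have "\<dots> = exp (- lam * (y - y')) * I_ball R x' y' lam"
    unfolding I_ball_def set_lebesgue_integral_def by (rule integral_mult_right_zero)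
  finally show ?thesis .
qed

context piston
begin

lemma integrable_cyl_exp:
  assumes "l > 0"
  shows "integrable lborel (\<lambda>z. indicator (cyl Db) z * exp (- l * snd z))"
proof (rule integrableI_nonneg)
  show m: "(\<lambda>z. indicator (cyl Db) z * exp (- l * snd z)) \<in> borel_measurable lborel" by measurable
  have eq: "ennreal (indicator (cyl Db) z * exp (- l * snd z))
      = indicator Db (fst z) * (indicator {0..} (snd z) * ennreal (exp (- l * snd z)))" for z
    by (cases z) (auto simp: indicator_def cyl_def)
  have mm: "(\<lambda>z::'a \<times> real. indicator Db (fst z) * (indicator {0..} (snd z) * ennreal (exp (- l * snd z))))
      \<in> borel_measurable (borel \<Otimes>\<^sub>M borel)"
    by measurable
  have "(\<integral>\<^sup>+z. ennreal (indicator (cyl Db) z * exp (- l * snd z)) \<partial>lborel)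
     = (\<integral>\<^sup>+z. indicator Db (fst z) * (indicator {0..} (snd z) * ennreal (exp (- l * snd z))) \<partial>(lborel \<Otimes>\<^sub>M lborel))"
    unfolding eq lborel_prod ..
  also have "\<dots> = (\<integral>\<^sup>+h. \<integral>\<^sup>+p. indicator Db p * (indicator {0..} h * ennreal (exp (- l * h))) \<partial>lborel \<partial>lborel)"
    by (subst lborel_pair.nn_integral_snd[symmetric]) (use mm in auto)
  also have "\<dots> = (\<integral>\<^sup>+h. emeasure lborel Db * (indicator {0..} h * ennreal (exp (- l * h))) \<partial>lborel)"
    by (intro nn_integral_cong) (subst nn_integral_multc, auto)
  also have "\<dots> = emeasure lborel Db * ennreal (1 / l)"
    unfolding nn_integral_exp_minus[OF assms, symmetric] by (rule nn_integral_cmult) measurable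
  also have "\<dots> < \<infinity>"
    using emeasure_Db_finite ennreal_less_top[of "1 / l"]
    unfolding infinity_ennreal_def ennreal_mult_less_top by blast
  finally show "(\<integral>\<^sup>+z. ennreal (indicator (cyl Db) z * exp (- l * snd z)) \<partial>lborel) < \<infinity>" .
qed (rule AE_I2, simp)

lemma I_out_indep:
  assumes "x \<in> Dbp Db R" "x' \<in> Dbp Db R" "lam > 0"
  shows "I_out Db R x y lam = I_out Db R x' y lam" and "I_out1 Db R x y lam = I_out1 Db R x' y lam"
proof -
  \<comment> \<open>Nonnegativity is asked only above the floor, because the integrand of
    \<open>I_out1\<close> is negative below it.\<close>
  have *: "(LINT z:out x y|lborel. f (snd z)) = (LINT z:out x' y|lborel. f (snd z))"
    if [measurable]: "f \<in> borel_measurable borel" and f: "\<And>h. h \<ge> 0 \<Longrightarrow> f h \<ge> 0" for f :: "real \<Rightarrow> real"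
  proof -
    have eq: "(LINT z:out x y|lborel. f (snd z)) = enn2real (\<integral>\<^sup>+z. indicator (out x y) z * ennreal (f (snd z)) \<partial>lborel)" for x
    proof -
      have "(LINT z:out x y|lborel. f (snd z)) = enn2real (\<integral>\<^sup>+z. ennreal (indicator (out x y) z *\<^sub>R f (snd z)) \<partial>lborel)"
        unfolding set_lebesgue_integral_def
      proof (rule integral_eq_nn_integral)
        show "(\<lambda>z. indicator (out x y) z *\<^sub>R f (snd z)) \<in> borel_measurable lborel" by measurable
        show "AE z in lborel. 0 \<le> indicator (out x y) z *\<^sub>R f (snd z)"
        proof (rule AE_I2)
          fix z :: "'a \<times> real"
          have "z \<in> out x y \<Longrightarrow> 0 \<le> f (snd z)" by (rule f) (auto simp: cyl_def)
          thus "0 \<le> indicator (out x y) z *\<^sub>R f (snd z)" by (cases "z \<in> out x y") simp_all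
        qed
      qed
      also have "(\<integral>\<^sup>+z. ennreal (indicator (out x y) z *\<^sub>R f (snd z)) \<partial>lborel)
         = (\<integral>\<^sup>+z. indicator (out x y) z * ennreal (f (snd z)) \<partial>lborel)"
        by (intro nn_integral_cong) (auto simp: indicator_def)
      finally show ?thesis .
    qed
    have m: "(\<lambda>h. ennreal (f h)) \<in> borel_measurable borel" by measurable
    show ?thesis
      unfolding eq
      by (rule arg_cong[where f=enn2real],
          rule trans[OF nn_integral_out[OF assms(1) m] nn_integral_out[OF assms(2) m, symmetric]])
  qed
  show "I_out Db R x y lam = I_out Db R x' y lam"
    unfolding I_out_def by (rule *[of "\<lambda>h. lam * exp (- lam * h)"]) (use assms in auto)
  show "I_out1 Db R x y lam = I_out1 Db R x' y lam"
    unfolding I_out1_def by (rule *[of "\<lambda>h. h * lam * exp (- lam * h)"]) (use assms in auto)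
qed

end

section \<open>The gas law at a frozen horizontal piston position\<close>

locale tilt = piston +
  fixes x :: "'a" and lam yA :: real
  assumes x_in: "x \<in> Dbp Db R" and lam_pos: "lam > 0" and yA_ge: "yA \<ge> R"
    and balance: "balance_eq Db R x m M yA lam"
    and energy: "energy_eq Db R x m M g E yA lam"
begin

abbreviation "q \<equiv> M / m"
abbreviation "gas_law y \<equiv> nu Db R x y lam"
abbreviation "I y \<equiv> I_out Db R x y lam"

definition gas_weight :: "real \<Rightarrow> 'a \<times> real \<Rightarrow> real" where
  "gas_weight y z = indicator (out x y) z * lam * exp (- lam * snd z)"

text \<open>Growth at half the decay rate of the gas law: the other half keeps products with the
  weight integrable. The class contains bounded functions, the height and its square.\<close>

definition exp_dominated :: "('a \<times> real \<Rightarrow> real) \<Rightarrow> bool" where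
  "exp_dominated F \<longleftrightarrow> F \<in> borel_measurable borel \<and> (\<exists>C. \<forall>z\<in>cyl Db. \<bar>F z\<bar> \<le> C * exp (lam / 2 * snd z))"

lemma gas_weight_measurable [measurable]: "gas_weight y \<in> borel_measurable borel"
  unfolding gas_weight_def by measurable

lemma gas_weight_nonneg: "gas_weight y z \<ge> 0"
  using lam_pos by (simp add: gas_weight_def)

lemma q_pos: "q > 0" using M_pos m_pos by simp

lemma exp_dominated_bounded:
  assumes [measurable]: "F \<in> borel_measurable borel" and "\<And>z. z \<in> cyl Db \<Longrightarrow> \<bar>F z\<bar> \<le> C"
  shows "exp_dominated F"
proof -
  have "\<bar>F z\<bar> \<le> \<bar>C\<bar> * exp (lam / 2 * snd z)" if "z \<in> cyl Db" for z
  proof -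
    have "\<bar>F z\<bar> \<le> \<bar>C\<bar> * 1" using assms(2)[OF that] by simp
    also have "\<dots> \<le> \<bar>C\<bar> * exp (lam / 2 * snd z)"
      using that lam_pos by (intro mult_left_mono) (auto simp: cyl_def)
    finally show ?thesis .
  qed
  thus ?thesis unfolding exp_dominated_def using assms(1) by blast
qed

lemma exp_dominated_1: "exp_dominated (\<lambda>_. 1)"
  by (rule exp_dominated_bounded[of _ 1]) auto

lemma exp_dominated_snd2: "exp_dominated (\<lambda>z. (snd z)\<^sup>2)"
proof -
  have "\<bar>(snd z)\<^sup>2\<bar> \<le> (4 / lam)\<^sup>2 * exp (lam / 2 * snd z)" if "z \<in> cyl Db" for z
  proof -
    have h: "snd z \<ge> 0" using that by (auto simp: cyl_def)
    \<comment> \<open>A quarter of the rate, because squaring doubles it to the permitted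
      \<open>lam / 2\<close>.\<close>
    have "lam / 4 * snd z \<le> exp (lam / 4 * snd z)"
      using exp_ge_add_one_self[of "lam / 4 * snd z"] by linarith
    hence "(lam / 4 * snd z)\<^sup>2 \<le> (exp (lam / 4 * snd z))\<^sup>2"
      using h lam_pos by (intro power_mono) auto
    also have "\<dots> = exp (lam / 2 * snd z)" by (simp add: power2_eq_square flip: exp_add)
    finally have "(4 / lam)\<^sup>2 * (lam / 4 * snd z)\<^sup>2 \<le> (4 / lam)\<^sup>2 * exp (lam / 2 * snd z)"
      by (intro mult_left_mono) auto
    thus ?thesis using lam_pos by (simp add: power_mult_distrib power_divide)
  qed
  moreover have "(\<lambda>z::'a \<times> real. (snd z)\<^sup>2) \<in> borel_measurable borel" by measurable
  ultimately show ?thesis unfolding exp_dominated_def by blast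
qed

lemma exp_dominated_snd: "exp_dominated snd"
proof -
  have "\<bar>snd z\<bar> \<le> 2 / lam * exp (lam / 2 * snd z)" if "z \<in> cyl Db" for z
  proof -
    have h: "snd z \<ge> 0" using that by (auto simp: cyl_def)
    have "lam / 2 * snd z \<le> exp (lam / 2 * snd z)"
      using exp_ge_add_one_self[of "lam / 2 * snd z"] by linarith
    thus ?thesis using lam_pos h by (simp add: field_simps)
  qed
  thus ?thesis unfolding exp_dominated_def using snd_borel by blast
qed

text \<open>The majorant does not depend on the piston height \<open>y\<close>. It therefore serves
  both dominated convergence in \<open>y\<close> and moment bounds uniform in
  \<open>y\<close>.\<close>

lemma exp_dominated_dominated:
  assumes "exp_dominated F"
  obtains C where "integrable lborel (\<lambda>z. C * (indicator (cyl Db) z * exp (- (lam / 2) * snd z)))"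
    and "\<And>y z. norm (gas_weight y z * F z) \<le> C * (indicator (cyl Db) z * exp (- (lam / 2) * snd z))"
proof -
  obtain C where C: "\<And>z. z \<in> cyl Db \<Longrightarrow> \<bar>F z\<bar> \<le> C * exp (lam / 2 * snd z)"
    using assms unfolding exp_dominated_def by auto
  show ?thesis
  proof (rule that[of "lam * C"])
    show "integrable lborel (\<lambda>z. lam * C * (indicator (cyl Db) z * exp (- (lam / 2) * snd z)))"
      using integrable_cyl_exp[of "lam / 2"] lam_pos by (intro integrable_mult_right) auto
    fix y z
    show "norm (gas_weight y z * F z) \<le> lam * C * (indicator (cyl Db) z * exp (- (lam / 2) * snd z))"
    proof (cases "z \<in> out x y")
      case True
      have "norm (gas_weight y z * F z) = lam * exp (- lam * snd z) * \<bar>F z\<bar>"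
        using True lam_pos by (simp add: gas_weight_def abs_mult)
      also have "\<dots> \<le> lam * exp (- lam * snd z) * (C * exp (lam / 2 * snd z))"
        using True lam_pos C by (intro mult_left_mono) auto
      also have "\<dots> = lam * C * (exp (- lam * snd z) * exp (lam / 2 * snd z))" by simp
      also have "exp (- lam * snd z) * exp (lam / 2 * snd z) = exp (- (lam / 2) * snd z)"
        by (simp add: field_simps flip: exp_add)
      finally show ?thesis using True by simp
    next
      case False
      \<comment> \<open>The sign of \<open>C\<close> is not given; at a point of the container it
        follows from the bound on \<open>F\<close>, elsewhere the indicator is 0.\<close>
      have "lam * C * (indicator (cyl Db) z * exp (- (lam / 2) * snd z)) \<ge> 0"
        using C[of z] lam_pos
        by (cases "z \<in> cyl Db") (auto simp: zero_le_mult_iff dest: order_trans[OF abs_ge_zero])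
      with False show ?thesis by (simp add: gas_weight_def)
    qed
  qed
qed

lemma integrable_gas_weight:
  assumes F: "exp_dominated F"
  shows "integrable lborel (\<lambda>z. gas_weight y z * F z)"
proof -
  obtain C where *: "integrable lborel (\<lambda>z. C * (indicator (cyl Db) z * exp (- (lam / 2) * snd z)))"
     "\<And>y z. norm (gas_weight y z * F z) \<le> C * (indicator (cyl Db) z * exp (- (lam / 2) * snd z))"
    using exp_dominated_dominated[OF F] by blast
  have [measurable]: "F \<in> borel_measurable borel" using F by (simp add: exp_dominated_def)
  show ?thesis
  proof (rule Bochner_Integration.integrable_bound[OF *(1)])
    show "AE z in lborel. norm (gas_weight y z * F z) \<le> norm (C * (indicator (cyl Db) z * exp (- (lam / 2) * snd z)))"
      by (intro AE_I2 order_trans[OF *(2)]) (simp only: real_norm_def abs_ge_self)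
  qed measurable
qed

lemma sphere_null: "AE z in lborel. dist (x, y) z \<noteq> R"
proof -
  have "negligible (sphere (x, y) R)" by (rule negligible_sphere)
  hence "sphere (x, y) R \<in> null_sets lebesgue" by (simp add: negligible_iff_null_sets)
  hence "sphere (x, y) R \<in> null_sets lborel" by (simp add: null_sets_completion_iff)
  thus ?thesis by (rule AE_I') auto
qed

text \<open>A point off the null sphere is eventually either inside all the moving balls or outside
  all of them, so the weights are eventually constant there and dominated convergence
  applies.\<close>

lemma tendsto_integral_gas_weight:
  assumes F: "exp_dominated F" and X: "X \<longlonglongrightarrow> y"
  shows "(\<lambda>k. \<integral>z. gas_weight (X k) z * F z \<partial>lborel) \<longlonglongrightarrow> (\<integral>z. gas_weight y z * F z \<partial>lborel)"
proof -
  obtain C where *: "integrable lborel (\<lambda>z. C * (indicator (cyl Db) z * exp (- (lam / 2) * snd z)))"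
     "\<And>y z. norm (gas_weight y z * F z) \<le> C * (indicator (cyl Db) z * exp (- (lam / 2) * snd z))"
    using exp_dominated_dominated[OF F] by blast
  have [measurable]: "F \<in> borel_measurable borel" using F by (simp add: exp_dominated_def)
  show ?thesis
  proof (rule integral_dominated_convergence[OF _ _ *(1)])
    show "AE z in lborel. (\<lambda>k. gas_weight (X k) z * F z) \<longlonglongrightarrow> gas_weight y z * F z"
      using sphere_null[of y]
    proof eventually_elim
      fix z assume z: "dist (x, y) z \<noteq> R"
      have lim: "(\<lambda>k. dist (x, X k) z) \<longlonglongrightarrow> dist (x, y) z"
        by (intro tendsto_intros X)
      have "eventually (\<lambda>k. (dist (x, X k) z < R) = (dist (x, y) z < R)) sequentially"
      proof (cases "dist (x, y) z < R")
        case True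
        from order_tendstoD(2)[OF lim True] show ?thesis
          by eventually_elim (use True in auto)
      next
        case False
        hence "R < dist (x, y) z" using z by simp
        from order_tendstoD(1)[OF lim this] show ?thesis
          by eventually_elim (use False in auto)
      qed
      hence "eventually (\<lambda>k. gas_weight (X k) z * F z = gas_weight y z * F z) sequentially"
        by eventually_elim (auto simp: gas_weight_def indicator_def)
      thus "(\<lambda>k. gas_weight (X k) z * F z) \<longlonglongrightarrow> gas_weight y z * F z"
        by (rule tendsto_eventually)
    qed
    show "\<And>k. AE z in lborel. norm (gas_weight (X k) z * F z) \<le> C * (indicator (cyl Db) z * exp (- (lam / 2) * snd z))"
      using *(2) by simp
  qed measurable
qed

lemma I_eq: "I y = (\<integral>z. gas_weight y z \<partial>lborel)"
  unfolding I_out_def set_lebesgue_integral_def gas_weight_def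
  by (intro Bochner_Integration.integral_cong) auto

lemma I_pos: "I y > 0"
proof -
  have int: "integrable lborel (gas_weight y)" using integrable_gas_weight[OF exp_dominated_1, of y] by simp
  have "I y \<ge> 0" unfolding I_eq by (intro integral_nonneg_AE) (simp add: gas_weight_nonneg)
  moreover have "I y \<noteq> 0"
  proof
    assume "I y = 0"
    hence "AE z in lborel. gas_weight y z = 0"
      unfolding I_eq using integral_nonneg_eq_0_iff_AE[OF int] by (simp add: gas_weight_nonneg)
    \<comment> \<open>The part of the container above the top of the ball is open and carries
      positive weight.\<close>
    moreover have "gas_weight y z \<noteq> 0" if "z \<in> Db \<times> {max 0 (y + R)<..}" for z
    proof -
      have "z \<in> out x y"
        using that dist_snd_le[of "(x, y)" z] by (auto simp: cyl_def dist_real_def)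
      thus ?thesis using lam_pos by (simp add: gas_weight_def)
    qed
    ultimately have "AE z in lborel. z \<notin> Db \<times> {max 0 (y + R)<..}" by (auto elim!: eventually_mono)
    moreover have op: "open (Db \<times> {max 0 (y + R)<..})" using Db_open by (intro open_Times) auto
    ultimately have "emeasure lborel (Db \<times> {max 0 (y + R)<..}) = 0"
      by (subst (asm) AE_iff_measurable[OF _ refl]) auto
    moreover have "x \<in> Db" using x_in by (simp add: Dbp_def)
    hence "Db \<times> {max 0 (y + R)<..} \<noteq> {}" by auto
    ultimately show False using emeasure_lborel_open_pos[OF op] by simp
  qed
  ultimately show ?thesis by simp
qed

lemma gas_law_eq: "gas_law y = density lborel (\<lambda>z. ennreal (gas_weight y z / I y))"
proof -
  have "(\<integral>\<^sup>+z. ennreal (gas_weight y z) \<partial>lborel) = ennreal (I y)"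
    unfolding I_eq using integrable_gas_weight[OF exp_dominated_1, of y] by (intro nn_integral_eq_integral) (auto simp: gas_weight_nonneg)
  thus ?thesis
    unfolding nu_def ndens_def gas_weight_def[symmetric] using I_pos[of y] by (simp add: divide_ennreal gas_weight_nonneg)
qed

lemma prob_space_gas_law: "prob_space (gas_law y)"
proof -
  have "(\<integral>\<^sup>+z. ennreal (gas_weight y z) \<partial>lborel) = ennreal (I y)"
    unfolding I_eq using integrable_gas_weight[OF exp_dominated_1, of y] by (intro nn_integral_eq_integral) (auto simp: gas_weight_nonneg)
  thus ?thesis
    unfolding nu_def gas_weight_def[symmetric] using I_pos[of y] by (intro prob_space_ndens) auto
qed

lemma sets_gas_law [simp, measurable_cong]: "sets (gas_law y) = sets borel"
  by (simp add: gas_law_eq)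

lemma space_gas_law [simp]: "space (gas_law y) = UNIV"
  by (simp add: gas_law_eq)

lemma AE_gas_law: "AE z in gas_law y. z \<in> out x y"
  unfolding gas_law_eq by (subst AE_density) (auto simp: gas_weight_def indicator_def)

lemma integral_gas_law:
  assumes [measurable]: "F \<in> borel_measurable borel"
  shows "(\<integral>z. F z \<partial>gas_law y) = (\<integral>z. gas_weight y z * F z \<partial>lborel) / I y"
proof -
  have "(\<integral>z. F z \<partial>gas_law y) = (\<integral>z. (gas_weight y z / I y) *\<^sub>R F z \<partial>lborel)"
    unfolding gas_law_eq using I_pos[of y] by (intro integral_density) (auto simp: gas_weight_nonneg)
  thus ?thesis by simp
qed

lemma integrable_gas_law:
  assumes F: "exp_dominated F"
  shows "integrable (gas_law y) F"
proof -
  have [measurable]: "F \<in> borel_measurable borel" using F by (simp add: exp_dominated_def)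
  have "integrable lborel (\<lambda>z. (gas_weight y z / I y) *\<^sub>R F z)"
    using integrable_gas_weight[OF F, of y] by simp
  thus ?thesis
    unfolding gas_law_eq using I_pos[of y] by (subst integrable_density) (auto simp: gas_weight_nonneg)
qed

lemma gas_law_continuous:
  assumes F: "exp_dominated F" and e: "e > 0"
  obtains d where "d > 0" "\<And>y. \<bar>y - yA\<bar> \<le> d \<Longrightarrow> \<bar>(\<integral>z. F z \<partial>gas_law y) - (\<integral>z. F z \<partial>gas_law yA)\<bar> \<le> e"
proof -
  have Fm: "F \<in> borel_measurable borel" using F by (simp add: exp_dominated_def)
  have "((\<lambda>y. \<integral>z. F z \<partial>gas_law y) \<longlongrightarrow> (\<integral>z. F z \<partial>gas_law yA)) (at yA)"
    unfolding tendsto_at_iff_sequentially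
  proof (intro allI impI)
    fix X :: "nat \<Rightarrow> real" assume X: "X \<longlonglongrightarrow> yA"
    have "(\<lambda>k. I (X k)) \<longlonglongrightarrow> I yA"
      unfolding I_eq using tendsto_integral_gas_weight[OF exp_dominated_1 X] by simp
    thus "((\<lambda>y. \<integral>z. F z \<partial>gas_law y) \<circ> X) \<longlonglongrightarrow> (\<integral>z. F z \<partial>gas_law yA)"
      unfolding integral_gas_law[OF Fm] comp_def
      using tendsto_integral_gas_weight[OF F X] I_pos[of yA] by (intro tendsto_divide) auto
  qed
  hence "eventually (\<lambda>y. dist (\<integral>z. F z \<partial>gas_law y) (\<integral>z. F z \<partial>gas_law yA) < e) (at yA)"
    using e by (rule tendstoD)
  then obtain d where d: "d > 0" "\<And>y. y \<noteq> yA \<Longrightarrow> dist y yA < d \<Longrightarrow> dist (\<integral>z. F z \<partial>gas_law y) (\<integral>z. F z \<partial>gas_law yA) < e"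
    unfolding eventually_at by auto
  show ?thesis
  proof (rule that[of "d / 2"])
    show "d / 2 > 0" using d by simp
    fix y assume "\<bar>y - yA\<bar> \<le> d / 2"
    with d e show "\<bar>(\<integral>z. F z \<partial>gas_law y) - (\<integral>z. F z \<partial>gas_law yA)\<bar> \<le> e"
      by (cases "y = yA") (force simp: dist_real_def)+
  qed
qed

text \<open>Ball and complement fill the container, so the sum does not depend on \<open>y\<close>;
  \<open>y \<ge> R\<close> keeps the ball inside.\<close>

lemma I_plus_I_ball:
  assumes "y \<ge> R"
  shows "I y + I_ball R x y lam = (\<integral>z. indicator (cyl Db) z * (lam * exp (- lam * snd z)) \<partial>lborel)"
proof -
  have sub: "ball (x, y) R \<subseteq> cyl Db" by (rule ball_subset_cyl[OF x_in assms])
  have cyl: "integrable lborel (\<lambda>z. indicator (cyl Db) z * (lam * exp (- lam * snd z)))"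
    using integrable_mult_right[OF integrable_cyl_exp[OF lam_pos], of lam] by (simp add: mult_ac)
  have ballI: "integrable lborel (\<lambda>z. indicator (ball (x, y) R) z * (lam * exp (- lam * snd z)))"
  proof (rule Bochner_Integration.integrable_bound[OF cyl])
    have [measurable]: "ball (x, y) R \<in> sets borel" by simp
    have "(\<lambda>z. indicator (ball (x, y) R) z * (lam * exp (- lam * snd z))) \<in> borel_measurable borel"
      by (intro borel_measurable_times borel_measurable_indicator) measurable
    thus "(\<lambda>z. indicator (ball (x, y) R) z * (lam * exp (- lam * snd z))) \<in> borel_measurable lborel"
      by simp
    show "AE z in lborel. norm (indicator (ball (x, y) R) z * (lam * exp (- lam * snd z)))
        \<le> norm (indicator (cyl Db) z * (lam * exp (- lam * snd z)))"
    proof (rule AE_I2)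
      fix z
      have "z \<in> ball (x, y) R \<Longrightarrow> z \<in> cyl Db" using sub by blast
      thus "norm (indicator (ball (x, y) R) z * (lam * exp (- lam * snd z)))
        \<le> norm (indicator (cyl Db) z * (lam * exp (- lam * snd z)))"
        by (simp add: indicator_def del: mem_ball)
    qed
  qed
  have outI: "integrable lborel (gas_weight y)" using integrable_gas_weight[OF exp_dominated_1, of y] by simp
  have "I y + I_ball R x y lam = (\<integral>z. gas_weight y z \<partial>lborel) + (\<integral>z. indicator (ball (x, y) R) z * (lam * exp (- lam * snd z)) \<partial>lborel)"
    by (simp only: I_eq I_ball_def set_lebesgue_integral_def real_scaleR_def)
  also have "\<dots> = (\<integral>z. gas_weight y z + indicator (ball (x, y) R) z * (lam * exp (- lam * snd z)) \<partial>lborel)"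
    by (rule Bochner_Integration.integral_add[symmetric, OF outI ballI])
  also have "\<dots> = (\<integral>z. indicator (cyl Db) z * (lam * exp (- lam * snd z)) \<partial>lborel)"
    using sub by (intro Bochner_Integration.integral_cong[OF refl]) (auto simp: gas_weight_def indicator_def)
  finally show ?thesis .
qed

text \<open>The sum of both integrals is constant in \<open>y\<close>, the ball part scales by
  \<open>exp (- lam * (y - yA))\<close>, and the balance equation fixes it as
  \<open>q * I yA\<close> at \<open>yA\<close>. Eliminating it leaves an explicit ratio.\<close>

lemma I_ratio:
  assumes "y \<ge> R"
  shows "I y = I yA * (1 + q * (1 - exp (- lam * (y - yA))))"
proof -
  have "I_ball R x yA lam = q * I yA"
    using balance I_pos[of yA] m_pos unfolding balance_eq_def by (simp add: field_simps)
  thus ?thesis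
    using I_plus_I_ball[OF assms] I_plus_I_ball[OF yA_ge] I_ball_translate[of R x y lam yA x]
    by (simp add: algebra_simps)
qed

text \<open>The \<open>n\<close>-th root of the weight of \<open>y\<close> relative to \<open>yA\<close> after the gas has been integrated out.\<close>

definition piston_weight :: "real \<Rightarrow> real" where
  "piston_weight y = exp (- q * (lam * (y - yA))) * (1 + q * (1 - exp (- (lam * (y - yA)))))"

lemma I_ratio': "y \<ge> R \<Longrightarrow> I y * exp (- q * (lam * (y - yA))) = I yA * piston_weight y"
  using I_ratio[of y] by (simp add: piston_weight_def)

lemma piston_weight_nonneg:
  assumes "y \<ge> R"
  shows "piston_weight y \<ge> 0"
proof -
  have "0 \<le> I y * exp (- q * (lam * (y - yA)))" using I_pos[of y] by simp
  hence "0 \<le> I yA * piston_weight y" by (simp only: I_ratio'[OF assms])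
  thus ?thesis using I_pos[of yA] by (simp add: zero_le_mult_iff)
qed

text \<open>The second factor is bounded through \<open>1 + a \<le> exp a\<close>. In the resulting
  exponent the first-order terms cancel at \<open>yA\<close>, which is the effect of the balance
  equation.\<close>

lemma piston_weight_upper: "piston_weight y \<le> exp (- q * (lam * (y - yA) - 1 + exp (- (lam * (y - yA)))))"
proof -
  let ?s = "lam * (y - yA)"
  have "piston_weight y \<le> exp (- q * ?s) * exp (q * (1 - exp (- ?s)))"
    unfolding piston_weight_def by (intro mult_left_mono exp_ge_add_one_self) auto
  also have "\<dots> = exp (- q * (?s - 1 + exp (- ?s)))"
    by (simp add: algebra_simps flip: exp_add)
  finally show ?thesis .
qed

text \<open>Above \<open>yA\<close> the second factor is at least 1. This side is the one needed, as
  heights below \<open>yA\<close> may violate \<open>y \<ge> R\<close>.\<close>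

lemma piston_weight_lower: "y \<ge> yA \<Longrightarrow> piston_weight y \<ge> exp (- q * (lam * (y - yA)))"
proof -
  assume "y \<ge> yA"
  hence "exp (- (lam * (y - yA))) \<le> 1" using lam_pos by simp
  hence "0 \<le> q * (1 - exp (- (lam * (y - yA))))" using q_pos by (intro mult_nonneg_nonneg) auto
  hence "exp (- q * (lam * (y - yA))) * 1 \<le> piston_weight y"
    unfolding piston_weight_def by (intro mult_left_mono) auto
  thus ?thesis by simp
qed

lemma I_mono:
  assumes "y \<ge> yA"
  shows "I yA \<le> I y"
proof -
  have "exp (- lam * (y - yA)) \<le> 1" using assms lam_pos by simp
  hence "0 \<le> q * (1 - exp (- lam * (y - yA)))" using q_pos by (intro mult_nonneg_nonneg) auto
  hence "I yA * 1 \<le> I yA * (1 + q * (1 - exp (- lam * (y - yA))))"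
    using I_pos[of yA] by (intro mult_left_mono) auto
  thus ?thesis using I_ratio[of y] assms yA_ge by simp
qed

lemma energy_mean:
  "E = real (DIM('a) + 1) * m * g / (2 * lam) + m * g * (\<integral>z. snd z \<partial>gas_law yA) + M * g * yA"
proof -
  have "I_out1 Db R x yA lam = (\<integral>z. gas_weight yA z * snd z \<partial>lborel)"
    unfolding I_out1_def set_lebesgue_integral_def gas_weight_def
    by (intro Bochner_Integration.integral_cong) auto
  thus ?thesis
    using energy unfolding energy_eq_def by (simp add: integral_gas_law)
qed

end

section \<open>The correction factor and the tilted position density\<close>

lemma mult_exp_one_minus_le_1: "t * exp (1 - t) \<le> (1 :: real)"
proof -
  have "t \<le> exp (t - 1)" using exp_ge_add_one_self[of "t - 1"] by simp
  hence "t * exp (1 - t) \<le> exp (t - 1) * exp (1 - t)" by (intro mult_right_mono) auto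
  thus ?thesis by (simp flip: exp_add)
qed

lemma mult_exp_one_minus_near_1:
  assumes "e > 0"
  obtains d :: real where "d > 0" "\<And>t. \<bar>t - 1\<bar> < d \<Longrightarrow> t * exp (1 - t) \<ge> exp (- e)"
proof -
  have "((\<lambda>t::real. t * exp (1 - t)) \<longlongrightarrow> 1 * exp (1 - 1)) (nhds 1)"
    by (intro tendsto_intros filterlim_ident)
  hence "eventually (\<lambda>t::real. exp (- e) < t * exp (1 - t)) (nhds 1)"
    by (rule order_tendstoD(1)) (use assms in simp)
  then obtain d where "d > 0" "\<And>t::real. dist t 1 < d \<Longrightarrow> exp (- e) < t * exp (1 - t)"
    unfolding eventually_nhds_metric by auto
  thus ?thesis using that[of d] by (auto simp: dist_real_def intro: less_imp_le)
qed

context tilt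
begin

text \<open>The quotient \<open>\<beta> u / \<kappa>\<close>, where \<open>u\<close> is the energy left for the velocities.\<close>

definition energy_ratio :: "nat \<Rightarrow> real \<Rightarrow> real \<Rightarrow> real" where
  "energy_ratio n y s = real n * lam / (m * g * kappa n) * (E - (m * g / real n * s + M * g * y))"

text \<open>This is \<open>\<psi>(t)^\<kappa>\<close> at \<open>t = energy_ratio n y s\<close>; the
  zero branch is the energy constraint.\<close>

definition phi :: "nat \<Rightarrow> real \<Rightarrow> real \<Rightarrow> real" where
  "phi n y s = (if energy_ratio n y s \<ge> 0 then (energy_ratio n y s * exp (1 - energy_ratio n y s)) powr kappa n else 0)"

text \<open>In terms of \<open>\<beta> = n * lam / (m * g)\<close> this is
  \<open>(\<kappa> / (e \<beta>))^\<kappa> e^(\<beta> E)\<close>.\<close>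

definition tilt_factor :: "nat \<Rightarrow> real" where
  "tilt_factor n = (kappa n * m * g / (real n * lam)) powr kappa n * exp (- kappa n) * exp (real n * lam * E / (m * g))"

text \<open>The \<open>n\<close>-th power takes out the height weight at \<open>yA\<close>, so that
  \<open>piston_weight yA\<close> is 1. Division by \<open>lam\<close> compensates the factor
  \<open>lam\<close> inside \<open>I_out\<close>, which the position density does not have.\<close>

definition tilt_const :: "nat \<Rightarrow> real" where
  "tilt_const n = tilt_factor n * (exp (- lam * q * yA) * I yA / lam) ^ n"

lemma phi_nonneg: "phi n y s \<ge> 0"
  by (simp add: phi_def)

lemma phi_le_1: "n \<ge> 1 \<Longrightarrow> phi n y s \<le> 1"
  using mult_exp_one_minus_le_1[of "energy_ratio n y s"] kappa_pos[of n]
  by (auto simp: phi_def intro!: powr_le1)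

lemma phi_measurable [measurable]: "(\<lambda>(y, s). phi n y s) \<in> borel_measurable (borel \<Otimes>\<^sub>M borel)"
  unfolding phi_def energy_ratio_def by measurable

lemma tilt_const_pos: "n \<ge> 1 \<Longrightarrow> tilt_const n > 0"
proof -
  assume n: "n \<ge> 1"
  have "kappa n * m * g / (real n * lam) > 0"
    using kappa_pos[OF n] n lam_pos m_pos g_pos by simp
  hence "(kappa n * m * g / (real n * lam)) powr kappa n > 0"
    unfolding powr_gt_zero by (rule less_imp_neq[symmetric])
  hence "tilt_factor n > 0" unfolding tilt_factor_def by (intro mult_pos_pos) auto
  thus ?thesis unfolding tilt_const_def using I_pos[of yA] lam_pos by (intro mult_pos_pos) auto
qed

lemma energy_fac_tilt:
  assumes n: "n \<ge> 1"
  shows "energy_fac n y s = tilt_factor n * (exp (- lam * s) * exp (- lam * q * y) ^ n) * phi n y s"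
proof -
  define u where "u = E - (m * g / real n * s + M * g * y)"
  define c where "c = kappa n * m * g / (real n * lam)"
  define t where "t = energy_ratio n y s"
  have k: "kappa n > 0" by (rule kappa_pos[OF n])
  have c: "c > 0" using k n lam_pos m_pos g_pos by (simp add: c_def)
  have ut: "u = c * t"
    using k n lam_pos m_pos g_pos by (simp add: u_def c_def t_def energy_ratio_def)
  show ?thesis
  proof (cases "t \<ge> 0")
    case False
    hence "u < 0" using c ut by (simp add: mult_pos_neg)
    thus ?thesis using False by (simp add: energy_fac_def phi_def u_def t_def)
  next
    case True
    hence u0: "u \<ge> 0" using c ut by simp
    have "energy_fac n y s = (c * t) powr kappa n"
      using u0 unfolding ut[symmetric] by (simp add: energy_fac_def u_def)
    also have "\<dots> = c powr kappa n * t powr kappa n"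
      using c True by (simp add: powr_mult)
    finally have 1: "energy_fac n y s = c powr kappa n * t powr kappa n" .
    have 2: "phi n y s = t powr kappa n * exp ((1 - t) * kappa n)"
      using True by (simp add: phi_def t_def[symmetric] powr_mult exp_powr_real)
    \<comment> \<open>This is \<open>\<beta> u\<close> written out. The choice of
      \<open>\<beta>\<close> makes the gas contribute exactly \<open>lam * s\<close>, and all
      exponentials below cancel.\<close>
    have kt: "kappa n * t = real n * lam * E / (m * g) - lam * s - real n * (lam * q * y)"
      using k n lam_pos m_pos g_pos by (simp add: t_def energy_ratio_def field_simps)
    have "exp (- kappa n) * exp (real n * lam * E / (m * g)) * (exp (- lam * s) * exp (- lam * q * y) ^ n)
        * exp ((1 - t) * kappa n) = exp (- kappa n + real n * lam * E / (m * g) + (- lam * s + real n * (- lam * q * y)) + (1 - t) * kappa n)"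
      by (simp only: exp_add exp_of_nat_mult)
    also have "- kappa n + real n * lam * E / (m * g) + (- lam * s + real n * (- lam * q * y)) + (1 - t) * kappa n = 0"
      using kt by (simp add: algebra_simps)
    finally have 3: "exp (- kappa n) * exp (real n * lam * E / (m * g)) * (exp (- lam * s) * exp (- lam * q * y) ^ n)
        * exp ((1 - t) * kappa n) = 1" by simp
    have "tilt_factor n * (exp (- lam * s) * exp (- lam * q * y) ^ n) * phi n y s
      = c powr kappa n * t powr kappa n * (exp (- kappa n) * exp (real n * lam * E / (m * g)) * (exp (- lam * s) * exp (- lam * q * y) ^ n)
        * exp ((1 - t) * kappa n))"
      unfolding tilt_factor_def 2 c_def[symmetric] by (simp only: mult_ac)
    thus ?thesis unfolding 3 1 by simp
  qed
qed

text \<open>Four factors result: a constant, the height weight, the correction \<open>phi\<close>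
  between 0 and 1, and the density of independent particles with law \<open>gas_law y\<close>. Only
  \<open>phi\<close> still couples the particles.\<close>

lemma pos_dens_tilt:
  assumes n: "n \<ge> 1" and y: "y \<ge> R"
  shows "pos_dens Db R m M g E n (z(n := (x, y)))
    = tilt_const n * piston_weight y ^ n * phi n y (\<Sum>i<n. snd (z i)) * (\<Prod>i<n. gas_weight y (z i) / I y)"
proof -
  define S where "S = (\<Sum>i<n. snd (z i))"
  define P where "P = (\<Prod>i<n. indicator (out x y) (z i) :: real)"
  have Iy: "I y > 0" "I yA > 0" by (rule I_pos)+
  have "exp (- lam * q * yA) * I yA * piston_weight y = exp (- lam * q * yA) * exp (- q * (lam * (y - yA))) * I y"
    using I_ratio'[OF y] by (simp add: mult_ac)
  also have "exp (- lam * q * yA) * exp (- q * (lam * (y - yA))) = exp (- lam * q * y)"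
    by (simp add: right_diff_distrib mult_ac flip: exp_add)
  finally have base: "exp (- lam * q * yA) * I yA / lam * piston_weight y * (lam / I y) = exp (- lam * q * y)"
    using Iy lam_pos by (simp add: field_simps)
  have "(\<Prod>i<n. gas_weight y (z i) / I y) = (\<Prod>i<n. indicator (out x y) (z i) * (lam / I y) * exp (- lam * snd (z i)))"
    by (intro prod.cong) (auto simp: gas_weight_def)
  also have "\<dots> = P * (lam / I y) ^ n * exp (- lam * S)"
  proof -
    have "exp (- lam * S) = (\<Prod>i<n. exp (- lam * snd (z i)))"
      by (simp add: S_def sum_distrib_left exp_sum)
    thus ?thesis by (simp only: prod.distrib prod_constant card_lessThan P_def)
  qed
  finally have pw: "(\<Prod>i<n. gas_weight y (z i) / I y) = P * (lam / I y) ^ n * exp (- lam * S)" .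
  have "tilt_const n * piston_weight y ^ n * phi n y S * (P * (lam / I y) ^ n * exp (- lam * S))
     = tilt_factor n * (exp (- lam * q * yA) * I yA / lam * piston_weight y * (lam / I y)) ^ n * phi n y S * P * exp (- lam * S)"
    by (simp only: tilt_const_def power_mult_distrib mult_ac)
  also have "\<dots> = P * (tilt_factor n * (exp (- lam * S) * exp (- lam * q * y) ^ n) * phi n y S)"
    unfolding base by (simp only: mult_ac)
  also have "\<dots> = P * energy_fac n y S" by (simp only: energy_fac_tilt[OF n])
  finally have "tilt_const n * piston_weight y ^ n * phi n y S * (P * (lam / I y) ^ n * exp (- lam * S)) = P * energy_fac n y S" .
  moreover have "pos_dens Db R m M g E n (z(n := (x, y))) = P * energy_fac n y S"
    using x_in y by (simp add: pos_dens_eq P_def S_def)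
  ultimately show ?thesis unfolding S_def[symmetric] pw by (rule trans[OF _ sym, rotated])
qed

abbreviation "T (n::nat) y \<equiv> PiM {..<n} (\<lambda>_. gas_law y)"

lemma prob_space_T: "prob_space (T n y)"
  by (rule prob_space_PiM) (rule prob_space_gas_law)

lemma T_eq: "T n y = density (PiM {..<n} (\<lambda>_. lborel)) (\<lambda>z. \<Prod>i<n. ennreal (gas_weight y (z i) / I y))"
  unfolding gas_law_eq
  by (rule PiM_density) (use prob_space_gas_law[of y] lborel.sigma_finite_measure_axioms in \<open>simp_all add: gas_law_eq\<close>)

text \<open>Unnormalised expectation of \<open>G\<close> with \<open>tilt_const\<close> removed.
  That constant cancels in conditional probabilities, which become quotients of two such
  values.\<close>

definition tilted :: "nat \<Rightarrow> ((nat \<Rightarrow> 'a \<times> real) \<Rightarrow> ennreal) \<Rightarrow> ennreal" where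
  "tilted n G = (\<integral>\<^sup>+y. indicator {R..} y * (ennreal (piston_weight y ^ n) *
     (\<integral>\<^sup>+z. ennreal (phi n y (\<Sum>i<n. snd (z i))) * G (z(n := (x, y))) \<partial>T n y)) \<partial>lborel)"

lemma update_measurable':
  "(\<lambda>z. z(n := p0)) \<in> PiM {..<n} (\<lambda>_. lborel) \<rightarrow>\<^sub>M (conf_space n :: (nat \<Rightarrow> 'a \<times> real) measure)"
  by (rule measurable_fun_upd[where J="{..<n}"]) auto

lemma nn_integral_pos_dens_tilt:
  assumes n: "n \<ge> 1" and G [measurable]: "G \<in> borel_measurable (conf_space n)"
  shows "(\<integral>\<^sup>+p. ennreal (pos_dens Db R m M g E n p) * G p \<partial>cond_space n x) = ennreal (tilt_const n) * tilted n G"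
proof -
  let ?L = "PiM {..<n} (\<lambda>_. lborel :: ('a \<times> real) measure)"
  define X where "X y = (\<integral>\<^sup>+z. ennreal (pos_dens Db R m M g E n (z(n := (x, y)))) * G (z(n := (x, y))) \<partial>?L)" for y
  define Y where "Y y = indicator {R..} y * (ennreal (piston_weight y ^ n) *
     (\<integral>\<^sup>+z. ennreal (phi n y (\<Sum>i<n. snd (z i))) * G (z(n := (x, y))) \<partial>T n y))" for y
  interpret sigma_finite_measure ?L by (rule lborel_prod.sigma_finite) simp
  have Xm [measurable]: "X \<in> borel_measurable borel"
    unfolding X_def by measurable
  note update_measurable' [measurable]
  have XY: "X y = ennreal (tilt_const n) * Y y" for y
  proof (cases "y \<ge> R")
    case False
    hence "X y = 0" by (simp add: X_def pos_dens_eq)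
    thus ?thesis using False by (simp add: Y_def)
  next
    case y: True
    have nn: "tilt_const n * piston_weight y ^ n \<ge> 0" using tilt_const_pos[OF n] piston_weight_nonneg[OF y] by simp
    have Gm: "(\<lambda>z. ennreal (phi n y (\<Sum>i<n. snd (z i))) * G (z(n := (x, y)))) \<in> borel_measurable ?L"
      by measurable
    have wm: "(\<lambda>z. \<Prod>i<n. ennreal (gas_weight y (z i) / I y)) \<in> borel_measurable ?L" by measurable
    have "X y = (\<integral>\<^sup>+z. ennreal (tilt_const n * piston_weight y ^ n) * ((\<Prod>i<n. ennreal (gas_weight y (z i) / I y)) *
        (ennreal (phi n y (\<Sum>i<n. snd (z i))) * G (z(n := (x, y))))) \<partial>?L)"
      unfolding X_def
    proof (rule nn_integral_cong)
      fix z :: "nat \<Rightarrow> 'a \<times> real"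
      have wI: "0 \<le> gas_weight y (z i) / I y" for i using gas_weight_nonneg[of y "z i"] I_pos[of y] by simp
      have "ennreal (pos_dens Db R m M g E n (z(n := (x, y))))
         = ennreal (tilt_const n * piston_weight y ^ n) * ennreal (phi n y (\<Sum>i<n. snd (z i))) * ennreal (\<Prod>i<n. gas_weight y (z i) / I y)"
        unfolding pos_dens_tilt[OF n y] using nn phi_nonneg wI
        by (subst ennreal_mult, simp, simp add: prod_nonneg, subst ennreal_mult) auto
      also have "ennreal (\<Prod>i<n. gas_weight y (z i) / I y) = (\<Prod>i<n. ennreal (gas_weight y (z i) / I y))"
        by (rule prod_ennreal[symmetric]) (rule wI)
      finally show "ennreal (pos_dens Db R m M g E n (z(n := (x, y)))) * G (z(n := (x, y)))
        = ennreal (tilt_const n * piston_weight y ^ n) * ((\<Prod>i<n. ennreal (gas_weight y (z i) / I y)) *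
        (ennreal (phi n y (\<Sum>i<n. snd (z i))) * G (z(n := (x, y)))))"
        by (simp only: mult_ac)
    qed
    also have "\<dots> = ennreal (tilt_const n * piston_weight y ^ n) * (\<integral>\<^sup>+z. (\<Prod>i<n. ennreal (gas_weight y (z i) / I y)) *
        (ennreal (phi n y (\<Sum>i<n. snd (z i))) * G (z(n := (x, y)))) \<partial>?L)"
      by (rule nn_integral_cmult) measurable
    also have "(\<integral>\<^sup>+z. (\<Prod>i<n. ennreal (gas_weight y (z i) / I y)) *
        (ennreal (phi n y (\<Sum>i<n. snd (z i))) * G (z(n := (x, y)))) \<partial>?L)
      = (\<integral>\<^sup>+z. ennreal (phi n y (\<Sum>i<n. snd (z i))) * G (z(n := (x, y))) \<partial>T n y)"
      unfolding T_eq by (rule nn_integral_density[symmetric, OF wm Gm])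
    finally show ?thesis
      using y tilt_const_pos[OF n] piston_weight_nonneg[OF y] by (simp add: Y_def ennreal_mult mult.assoc)
  qed
  \<comment> \<open>Pulling the constant out of the integral of \<open>Y\<close> would ask for
    measurability in \<open>y\<close>, although the measure \<open>T n y\<close> itself varies with
    \<open>y\<close>. Dividing instead moves the question to \<open>X\<close>, which is measurable
    as an integral against a fixed measure.\<close>
  have K: "ennreal (1 / tilt_const n) * ennreal (tilt_const n) = 1"
    using tilt_const_pos[OF n] by (subst ennreal_mult[symmetric]) auto
  hence "Y y = ennreal (1 / tilt_const n) * X y" for y
    unfolding XY by (simp only: mult.assoc[symmetric] mult_1)
  hence "tilted n G = (\<integral>\<^sup>+y. ennreal (1 / tilt_const n) * X y \<partial>lborel)"
    unfolding tilted_def Y_def[symmetric] by simp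
  also have "\<dots> = ennreal (1 / tilt_const n) * (\<integral>\<^sup>+y. X y \<partial>lborel)"
    by (rule nn_integral_cmult) simp
  finally have "ennreal (tilt_const n) * tilted n G = (ennreal (1 / tilt_const n) * ennreal (tilt_const n)) * (\<integral>\<^sup>+y. X y \<partial>lborel)"
    by (simp only: mult_ac)
  also have "\<dots> = (\<integral>\<^sup>+y. X y \<partial>lborel)" unfolding K by simp
  also have "\<dots> = (\<integral>\<^sup>+p. ennreal (pos_dens Db R m M g E n p) * G p \<partial>cond_space n x)"
    unfolding X_def by (rule nn_integral_cond_space[symmetric]) measurable
  finally show ?thesis ..
qed

lemma emeasure_pos_cond_tilt:
  assumes n: "n \<ge> 1" and A [measurable]: "A \<in> sets (conf_space n)"
  shows "emeasure (pos_cond n x) A = tilted n (indicator A) / tilted n (\<lambda>_. 1)"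
proof -
  have "cond_mass n x = ennreal (tilt_const n) * tilted n (\<lambda>_. 1)"
    using nn_integral_pos_dens_tilt[OF n, of "\<lambda>_. 1"] by (simp add: cond_mass_def)
  moreover have "(\<integral>\<^sup>+p. ennreal (pos_dens Db R m M g E n p) * indicator A p \<partial>cond_space n x) = ennreal (tilt_const n) * tilted n (indicator A)"
    by (rule nn_integral_pos_dens_tilt[OF n]) measurable
  ultimately show ?thesis
    using divide_mult_eq[of "ennreal (tilt_const n)" "tilted n (indicator A)" "tilted n (\<lambda>_. 1)"] tilt_const_pos[OF n]
    by (simp add: emeasure_pos_cond[OF A] mult.commute)
qed

section \<open>Exponential tails of the height weight and uniform moments\<close>

lemma piston_weight_tail:
  assumes e: "e > 0"
  obtains C c where "c > 0" "\<And>n. n \<ge> 1 \<Longrightarrow>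
    (\<integral>\<^sup>+y. indicator ({R..} \<inter> {y. \<bar>y - yA\<bar> > e}) y * ennreal (piston_weight y ^ n) \<partial>lborel) \<le> ennreal (C * exp (- c * real n))"
proof -
  obtain k where k: "k > 0" "\<And>s. \<bar>s\<bar> \<ge> lam * e \<Longrightarrow> k * \<bar>s\<bar> \<le> s - 1 + exp (- s)"
    using exp_minus_superlinear[of "lam * e"] e lam_pos by (metis mult_pos_pos)
  define a where "a = q * k * lam"
  have a: "a > 0" unfolding a_def by (intro mult_pos_pos q_pos k lam_pos)
  have bound: "piston_weight y ^ n \<le> exp (a * yA + a * e) * exp (- (a * e) * real n) * exp (- a * y)"
    if y: "y \<ge> R" "\<bar>y - yA\<bar> > e" and n: "n \<ge> 1" for y n
  proof -
    let ?s = "lam * (y - yA)"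
    have abs: "\<bar>?s\<bar> = lam * \<bar>y - yA\<bar>" using lam_pos by (simp add: abs_mult)
    have "k * \<bar>?s\<bar> \<le> ?s - 1 + exp (- ?s)"
      by (rule k(2)) (use abs y lam_pos in auto)
    hence "q * (k * \<bar>?s\<bar>) \<le> q * (?s - 1 + exp (- ?s))" using q_pos by (intro mult_left_mono) auto
    hence le: "a * \<bar>y - yA\<bar> \<le> q * (?s - 1 + exp (- ?s))" by (simp add: abs a_def mult_ac)
    have "piston_weight y \<le> exp (- q * (?s - 1 + exp (- ?s)))" by (rule piston_weight_upper)
    also have "\<dots> \<le> exp (- a * \<bar>y - yA\<bar>)" using le by simp
    finally have "piston_weight y ^ n \<le> exp (- a * \<bar>y - yA\<bar>) ^ n" using piston_weight_nonneg[OF y(1)] by (rule power_mono)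
    also have "\<dots> = exp (real n * (- a * \<bar>y - yA\<bar>))" by (rule exp_of_nat_mult[symmetric])
    also have "\<dots> \<le> exp ((a * yA + a * e) + (- (a * e) * real n) + (- a * y))"
    proof -
      \<comment> \<open>Of the \<open>n\<close> copies of the distance, \<open>n - 1\<close> are
        spent on the rate in \<open>n\<close>; the last one is kept for integrability in
        \<open>y\<close>.\<close>
      have "(real n - 1) * e \<le> (real n - 1) * \<bar>y - yA\<bar>" using n y by (intro mult_left_mono) auto
      hence "real n * e - e + (y - yA) \<le> real n * \<bar>y - yA\<bar>" by (simp add: algebra_simps)
      hence "a * (real n * e - e + (y - yA)) \<le> a * (real n * \<bar>y - yA\<bar>)" using a by (intro mult_left_mono) auto
      thus ?thesis by (simp add: algebra_simps)
    qed
    finally show ?thesis by (simp only: exp_add)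
  qed
  show ?thesis
  proof (rule that[of "a * e" "exp (a * yA + a * e) * (1 / a)"])
    show "a * e > 0" using a e by simp
    fix n :: nat assume n: "n \<ge> 1"
    let ?c = "exp (a * yA + a * e) * exp (- (a * e) * real n)"
    have "(\<integral>\<^sup>+y. indicator ({R..} \<inter> {y. \<bar>y - yA\<bar> > e}) y * ennreal (piston_weight y ^ n) \<partial>lborel)
       \<le> (\<integral>\<^sup>+y. ennreal ?c * (indicator {0..} y * ennreal (exp (- a * y))) \<partial>lborel)"
    proof (rule nn_integral_mono)
      fix y :: real
      show "indicator ({R..} \<inter> {y. \<bar>y - yA\<bar> > e}) y * ennreal (piston_weight y ^ n) \<le> ennreal ?c * (indicator {0..} y * ennreal (exp (- a * y)))"
      proof (cases "y \<ge> R \<and> \<bar>y - yA\<bar> > e")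
        case True
        have "ennreal (piston_weight y ^ n) \<le> ennreal (?c * exp (- a * y))"
          using bound[of y n] True n by (intro ennreal_leI) auto
        thus ?thesis using True R_pos by (simp add: ennreal_mult)
      next
        case False
        hence "y \<notin> {R..} \<inter> {y. \<bar>y - yA\<bar> > e}" by auto
        thus ?thesis by simp
      qed
    qed
    also have "\<dots> = ennreal ?c * ennreal (1 / a)"
      unfolding nn_integral_exp_minus[OF a, symmetric] by (rule nn_integral_cmult) measurable
    also have "\<dots> = ennreal (exp (a * yA + a * e) * (1 / a) * exp (- (a * e) * real n))"
      using a by (subst ennreal_mult[symmetric]) (auto simp: mult_ac)
    finally show "(\<integral>\<^sup>+y. indicator ({R..} \<inter> {y. \<bar>y - yA\<bar> > e}) y * ennreal (piston_weight y ^ n) \<partial>lborel)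
       \<le> ennreal (exp (a * yA + a * e) * (1 / a) * exp (- (a * e) * real n))" .
  qed
qed

text \<open>The numerators share one majorant, and by \<open>I_mono\<close> the denominators are at
  least \<open>I yA\<close>. Uniformity in \<open>y\<close> makes a single threshold for Chebyshev's
  inequality possible.\<close>

lemma gas_law_snd2_bounded:
  obtains V where "V \<ge> 0" "\<And>y. y \<ge> yA \<Longrightarrow> (\<integral>z. (snd z)\<^sup>2 \<partial>gas_law y) \<le> V"
proof -
  obtain C where *: "integrable lborel (\<lambda>z. C * (indicator (cyl Db) z * exp (- (lam / 2) * snd z)))"
     "\<And>y z. norm (gas_weight y z * (snd z)\<^sup>2) \<le> C * (indicator (cyl Db) z * exp (- (lam / 2) * snd z))"
    using exp_dominated_dominated[OF exp_dominated_snd2] by blast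
  define V0 where "V0 = (\<integral>z. C * (indicator (cyl Db) z * exp (- (lam / 2) * snd z)) \<partial>lborel)"
  have le: "(\<integral>z. gas_weight y z * (snd z)\<^sup>2 \<partial>lborel) \<le> V0" for y
    unfolding V0_def by (rule integral_mono[OF integrable_gas_weight[OF exp_dominated_snd2] *(1)])
      (rule order_trans[OF _ *(2)[of y]], simp)
  have ge: "0 \<le> (\<integral>z. gas_weight y z * (snd z)\<^sup>2 \<partial>lborel)" for y
    by (rule integral_nonneg_AE) (simp add: gas_weight_nonneg)
  show ?thesis
  proof (rule that[of "V0 / I yA"])
    show "V0 / I yA \<ge> 0" using le[of yA] ge[of yA] I_pos[of yA] by simp
    fix y assume y: "y \<ge> yA"
    have "(\<integral>z. (snd z)\<^sup>2 \<partial>gas_law y) = (\<integral>z. gas_weight y z * (snd z)\<^sup>2 \<partial>lborel) / I y"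
      by (rule integral_gas_law) measurable
    also have "\<dots> \<le> V0 / I yA"
      by (rule frac_le) (use le[of y] ge[of y] I_mono[OF y] I_pos[of yA] in auto)
    finally show "(\<integral>z. (snd z)\<^sup>2 \<partial>gas_law y) \<le> V0 / I yA" .
  qed
qed

end

section \<open>Concentration\<close>

lemma ennreal_inverse_antimono: "a \<le> b \<Longrightarrow> inverse b \<le> inverse (a :: ennreal)"
proof (cases a rule: ennreal_cases; cases b rule: ennreal_cases)
  fix r s assume "a \<le> b" "0 \<le> r" "a = ennreal r" "0 \<le> s" "b = ennreal s"
  thus "inverse b \<le> inverse a"
    by (cases "r = 0") (auto simp: inverse_ennreal intro!: ennreal_leI le_imp_inverse_le)
qed (auto simp: top_unique)

context tilt
begin

text \<open>By \<open>energy_mean\<close>, a small deviation from the energy balance keeps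
  \<open>energy_ratio\<close> near 1, the maximum of \<open>t * exp (1 - t)\<close>. Raising to the
  power \<open>kappa n\<close> then costs an arbitrarily small exponential rate only.\<close>

lemma phi_lower:
  assumes e: "e > 0"
  obtains d N where "d > 0" "\<And>n y s. n \<ge> N \<Longrightarrow> n \<ge> 1 \<Longrightarrow>
     \<bar>m * g * (s / real n - (\<integral>z. snd z \<partial>gas_law yA)) + M * g * (y - yA)\<bar> \<le> d \<Longrightarrow> exp (- e * real n) \<le> phi n y s"
proof -
  define D where "D = real (DIM('a) + 1)"
  have D: "D \<ge> 2" unfolding D_def using DIM_positive[where 'a='a] by simp
  define us where "us = D * m * g / (2 * lam)"
  have us: "us > 0" unfolding us_def using D lam_pos m_pos g_pos by simp
  \<comment> \<open>Since \<open>kappa n\<close> is at most \<open>n * D\<close>, a loss of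
    \<open>e / D\<close> in the base costs at most \<open>e\<close> per particle.\<close>
  obtain \<rho> where \<rho>: "\<rho> > 0" "\<And>t::real. \<bar>t - 1\<bar> < \<rho> \<Longrightarrow> t * exp (1 - t) \<ge> exp (- (e / D))"
    using mult_exp_one_minus_near_1[of "e / D"] e D by auto
  obtain N :: nat where N: "2 / \<rho> < real N" using reals_Archimedean2 by blast
  show ?thesis
  proof (rule that[of "\<rho> / 4 * us" N])
    show "\<rho> / 4 * us > 0" using \<rho> us by simp
    fix n :: nat and y s
    assume nN: "n \<ge> N" and n: "n \<ge> 1"
      and dev: "\<bar>m * g * (s / real n - (\<integral>z. snd z \<partial>gas_law yA)) + M * g * (y - yA)\<bar> \<le> \<rho> / 4 * us"
    define t where "t = energy_ratio n y s"
    \<comment> \<open>\<open>energy_ratio\<close> factors as \<open>a * (1 - b)\<close>: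
      \<open>a\<close> measures the mismatch between \<open>kappa n\<close> and
      \<open>n * D / 2\<close>, and \<open>b\<close> is the deviation relative to the limiting
      kinetic energy \<open>us\<close>. As \<open>1 - a \<le> 1 / n\<close>, the threshold
      \<open>N\<close> keeps \<open>1 - a\<close> below \<open>\<rho> / 2\<close>, while
      \<open>b\<close> is at most \<open>\<rho> / 4\<close> in absolute value.\<close>
    define a where "a = real n * D / (2 * kappa n)"
    have k: "kappa n > 0" by (rule kappa_pos[OF n])
    have k2: "2 * kappa n = real n * D + (D - 2)"
      by (simp add: kappa_def D_def field_simps)
    have "D - 2 \<ge> 0" using D by simp
    moreover have "1 * D \<le> real n * D" using n D by (intro mult_right_mono) auto
    ultimately have k3: "real n * D \<le> 2 * kappa n" "2 * kappa n \<le> 2 * (real n * D)"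
      using k2 by linarith+
    have a01: "0 \<le> a" "a \<le> 1" using k3 k D by (auto simp: a_def)
    have "1 - a = (D - 2) / (2 * kappa n)" using k k2 by (simp add: a_def field_simps)
    also have "\<dots> \<le> D / (real n * D)"
      using k3 n D by (intro frac_le) auto
    also have "\<dots> = 1 / real n" using D by simp
    also have "\<dots> < \<rho> / 2"
    proof -
      have "2 / \<rho> < real n" using N nN by linarith
      thus ?thesis using \<rho> n by (simp add: field_simps)
    qed
    finally have a1: "1 - a < \<rho> / 2" .
    have tn: "t = a * (1 - (m * g * (s / real n - (\<integral>z. snd z \<partial>gas_law yA)) + M * g * (y - yA)) / us)"
    proof -
      have "E - (m * g / real n * s + M * g * y)
         = us - (m * g * (s / real n - (\<integral>z. snd z \<partial>gas_law yA)) + M * g * (y - yA))"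
        using energy_mean unfolding us_def D_def by (simp add: algebra_simps)
      moreover have "real n * lam / (m * g * kappa n) = a / us"
        unfolding a_def us_def using k D lam_pos m_pos g_pos by (simp add: field_simps)
      ultimately have "t = a / us * (us - (m * g * (s / real n - (\<integral>z. snd z \<partial>gas_law yA)) + M * g * (y - yA)))"
        by (simp add: t_def energy_ratio_def)
      thus ?thesis using us by (simp add: field_simps)
    qed
    define b where "b = (m * g * (s / real n - (\<integral>z. snd z \<partial>gas_law yA)) + M * g * (y - yA)) / us"
    have b: "\<bar>b\<bar> \<le> \<rho> / 4" using dev us by (simp add: b_def field_simps)
    have "\<bar>t - 1\<bar> = \<bar>(1 - a) + a * b\<bar>" unfolding tn b_def[symmetric] by (simp add: algebra_simps abs_minus_commute)
    also have "\<dots> \<le> \<bar>1 - a\<bar> + \<bar>a * b\<bar>" by (rule abs_triangle_ineq)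
    also have "\<dots> = (1 - a) + a * \<bar>b\<bar>" using a01 by (simp add: abs_mult)
    also have "a * \<bar>b\<bar> \<le> 1 * \<bar>b\<bar>" using a01 by (intro mult_right_mono) auto
    finally have "\<bar>t - 1\<bar> < \<rho>" using a1 b \<rho> by linarith
    from \<rho>(2)[OF this] have psi: "exp (- (e / D)) \<le> t * exp (1 - t)" .
    moreover have "exp (- (e / D)) > 0" by simp
    ultimately have "t * exp (1 - t) > 0" by linarith
    hence t0: "t > 0" by (simp add: zero_less_mult_iff)
    have "exp (- e * real n) \<le> exp (- (e / D) * kappa n)"
    proof -
      have "e / D * kappa n \<le> e / D * (real n * D)" using k3 e D by (intro mult_left_mono) auto
      thus ?thesis using D by (simp add: field_simps)
    qed
    also have "\<dots> = exp (- (e / D)) powr kappa n" by (simp add: exp_powr_real)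
    also have "\<dots> \<le> (t * exp (1 - t)) powr kappa n"
      using psi k by (intro powr_mono2) auto
    also have "\<dots> = phi n y s" using t0 by (simp add: phi_def t_def[symmetric])
    finally show "exp (- e * real n) \<le> phi n y s" .
  qed
qed

text \<open>The rate \<open>e\<close> is split in halves: one pays for the height weight on a short
  interval above \<open>yA\<close>, the other for \<open>phi\<close> on an event of probability at
  least 1/2.\<close>

lemma tilted_1_lower:
  assumes e: "e > 0"
  obtains c where "c > 0" "eventually (\<lambda>n. ennreal (c * exp (- e * real n)) \<le> tilted n (\<lambda>_. 1)) sequentially"
proof -
  define hb where "hb y = (\<integral>z. snd z \<partial>gas_law y)" for y
  obtain d N where d: "d > 0" and phi: "\<And>n y s. n \<ge> N \<Longrightarrow> n \<ge> 1 \<Longrightarrow>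
     \<bar>m * g * (s / real n - hb yA) + M * g * (y - yA)\<bar> \<le> d \<Longrightarrow> exp (- (e / 2) * real n) \<le> phi n y s"
    using phi_lower[of "e / 2"] e unfolding hb_def by auto
  \<comment> \<open>The sample mean may miss the mean at \<open>y\<close>, and that mean the one at
    \<open>yA\<close>, by \<open>d2\<close> each. Together this uses half of \<open>d\<close>; the
    other half is left for the shift of the piston.\<close>
  define d2 where "d2 = d / (4 * (m * g))"
  have mg: "m * g > 0" and Mg: "M * g > 0" using m_pos g_pos M_pos by auto
  have d2: "d2 > 0" using d mg by (simp add: d2_def)
  obtain d1 where d1: "d1 > 0" "\<And>y. \<bar>y - yA\<bar> \<le> d1 \<Longrightarrow> \<bar>hb y - hb yA\<bar> \<le> d2"
    using gas_law_continuous[OF exp_dominated_snd d2] unfolding hb_def by blast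
  \<comment> \<open>Three demands on the interval length: the mean height moves by at most
    \<open>d2\<close>, the potential of the piston by at most \<open>d / 2\<close>, and the height
    weight loses at most \<open>e / 2\<close> per particle.\<close>
  define dl where "dl = min d1 (min (d / (2 * (M * g))) (e / (2 * (q * lam))))"
  have ql: "q * lam > 0" by (intro mult_pos_pos q_pos lam_pos)
  have "e / (2 * (q * lam)) > 0" "d / (2 * (M * g)) > 0"
    by (intro divide_pos_pos e d mult_pos_pos q_pos lam_pos M_pos g_pos zero_less_numeral)+
  hence dl: "dl > 0" using d1 unfolding dl_def by simp
  obtain V where V: "V \<ge> 0" "\<And>y. y \<ge> yA \<Longrightarrow> (\<integral>z. (snd z)\<^sup>2 \<partial>gas_law y) \<le> V"
    using gas_law_snd2_bounded by blast
  \<comment> \<open>From here on the failure probability in Chebyshev's inequality is at most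
    1/2.\<close>
  obtain N2 :: nat where N2: "2 * V / d2\<^sup>2 < real N2" using reals_Archimedean2 by blast
  have inner: "ennreal (exp (- (e / 2) * real n) / 2) \<le> (\<integral>\<^sup>+z. ennreal (phi n y (\<Sum>i<n. snd (z i))) \<partial>T n y)"
    if n: "n \<ge> N" "n \<ge> N2" "n \<ge> 1" and y: "yA \<le> y" "y \<le> yA + dl" for n y
  proof -
    interpret nu: prob_space "gas_law y" by (rule prob_space_gas_law)
    interpret T: prob_space "T n y" by (rule prob_space_T)
    let ?B = "{z \<in> space (T n y). \<bar>(\<Sum>i<n. snd (z i)) / n - (\<integral>w. snd w \<partial>gas_law y)\<bar> \<ge> d2}"
    have sm: "snd \<in> borel_measurable (gas_law y)" by (simp cong: measurable_cong_sets)
    note [measurable] = sm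
    have B [measurable]: "?B \<in> sets (T n y)" by measurable
    have "T.prob ?B \<le> (\<integral>w. (snd w)\<^sup>2 \<partial>gas_law y) / (n * d2\<^sup>2)"
      by (rule nu.Chebyshev_PiM[OF sm integrable_gas_law[OF exp_dominated_snd2] d2 n(3)])
    also have "\<dots> \<le> V / (n * d2\<^sup>2)" using V(2)[OF y(1)] by (intro divide_right_mono) auto
    also have "\<dots> \<le> 1 / 2"
    proof -
      have "2 * V / d2\<^sup>2 \<le> real n" using N2 n(2) by linarith
      hence "2 * V \<le> real n * d2\<^sup>2" using d2 by (simp add: field_simps)
      thus ?thesis using n(3) d2 by (simp add: field_simps)
    qed
    finally have half: "T.prob (space (T n y) - ?B) \<ge> 1 / 2" by (subst T.prob_compl) auto
    have "ennreal (exp (- (e / 2) * real n) / 2) = ennreal (exp (- (e / 2) * real n)) * ennreal (1 / 2)"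
      by (subst ennreal_mult[symmetric]) auto
    also have "\<dots> \<le> ennreal (exp (- (e / 2) * real n)) * emeasure (T n y) (space (T n y) - ?B)"
      unfolding T.emeasure_eq_measure by (intro mult_left_mono ennreal_leI half) auto
    also have "\<dots> = (\<integral>\<^sup>+z. ennreal (exp (- (e / 2) * real n)) * indicator (space (T n y) - ?B) z \<partial>T n y)"
      by (rule nn_integral_cmult_indicator[symmetric]) measurable
    also have "\<dots> \<le> (\<integral>\<^sup>+z. ennreal (phi n y (\<Sum>i<n. snd (z i))) \<partial>T n y)"
    proof (rule nn_integral_mono)
      fix z assume z: "z \<in> space (T n y)"
      show "ennreal (exp (- (e / 2) * real n)) * indicator (space (T n y) - ?B) z \<le> ennreal (phi n y (\<Sum>i<n. snd (z i)))"
      proof (cases "z \<in> ?B")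
        case False
        hence 1: "\<bar>(\<Sum>i<n. snd (z i)) / n - hb y\<bar> \<le> d2" using z by (simp add: hb_def)
        have 2: "\<bar>hb y - hb yA\<bar> \<le> d2" by (rule d1(2)) (use y in \<open>auto simp: dl_def\<close>)
        have "\<bar>m * g * ((\<Sum>i<n. snd (z i)) / n - hb yA) + M * g * (y - yA)\<bar>
          \<le> m * g * \<bar>(\<Sum>i<n. snd (z i)) / n - hb yA\<bar> + M * g * \<bar>y - yA\<bar>"
          using m_pos M_pos g_pos by (intro order_trans[OF abs_triangle_ineq]) (simp add: abs_mult)
        also have "\<dots> \<le> m * g * (2 * d2) + M * g * (d / (2 * (M * g)))"
          using 1 2 y mg Mg by (intro add_mono mult_left_mono) (auto simp: dl_def)
        also have "\<dots> = d" using m_pos M_pos g_pos unfolding d2_def by (simp add: field_simps)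
        finally have "exp (- (e / 2) * real n) \<le> phi n y (\<Sum>i<n. snd (z i))"
          by (rule phi[OF n(1,3)])
        thus ?thesis using z False by (simp add: ennreal_leI)
      qed simp
    qed
    finally show ?thesis .
  qed
  show ?thesis
  proof (rule that[of "dl / 2"])
    show "dl / 2 > 0" using dl by simp
    show "eventually (\<lambda>n. ennreal (dl / 2 * exp (- e * real n)) \<le> tilted n (\<lambda>_. 1)) sequentially"
    proof (rule eventually_sequentiallyI[of "max 1 (max N N2)"])
      fix n assume "max 1 (max N N2) \<le> n"
      hence n: "n \<ge> N" "n \<ge> N2" "n \<ge> 1" by auto
      let ?c = "exp (- (e / 2) * real n)"
      have cc: "?c * (?c / 2) = exp (- e * real n) / 2" by (simp flip: exp_add)
      have "ennreal (dl / 2 * exp (- e * real n)) = ennreal (?c * (?c / 2)) * ennreal dl"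
        unfolding cc using dl by (subst ennreal_mult[symmetric]) (auto simp: mult_ac)
      also have "\<dots> = ennreal (?c * (?c / 2)) * emeasure lborel {yA..yA + dl}" using dl by simp
      also have "\<dots> = (\<integral>\<^sup>+y. ennreal (?c * (?c / 2)) * indicator {yA..yA + dl} y \<partial>lborel)"
        by (rule nn_integral_cmult_indicator[symmetric]) simp
      also have "\<dots> \<le> tilted n (\<lambda>_. 1)"
        unfolding tilted_def
      proof (rule nn_integral_mono)
        fix y :: real
        show "ennreal (?c * (?c / 2)) * indicator {yA..yA + dl} y \<le> indicator {R..} y * (ennreal (piston_weight y ^ n) *
           (\<integral>\<^sup>+z. ennreal (phi n y (\<Sum>i<n. snd (z i))) * 1 \<partial>T n y))"
        proof (cases "y \<in> {yA..yA + dl}")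
          case True
          hence y: "yA \<le> y" "y \<le> yA + dl" by auto
          have "?c = exp (- (e / 2)) ^ n" by (simp add: exp_of_nat_mult[symmetric] mult.commute)
          also have "\<dots> \<le> piston_weight y ^ n"
          proof (rule power_mono)
            have "y - yA \<le> e / (2 * (q * lam))" using y by (simp add: dl_def)
            hence "q * lam * (y - yA) \<le> q * lam * (e / (2 * (q * lam)))" using ql by (intro mult_left_mono) auto
            also have "\<dots> = e / 2" using M_pos m_pos lam_pos by simp
            finally have "exp (- (e / 2)) \<le> exp (- q * (lam * (y - yA)))" by (simp add: mult_ac)
            also have "\<dots> \<le> piston_weight y" by (rule piston_weight_lower[OF y(1)])
            finally show "exp (- (e / 2)) \<le> piston_weight y" .
          qed simp
          finally have rn: "?c \<le> piston_weight y ^ n" .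
          have "ennreal (?c * (?c / 2)) = ennreal ?c * ennreal (?c / 2)" by (rule ennreal_mult) auto
          also have "\<dots> \<le> ennreal (piston_weight y ^ n) * (\<integral>\<^sup>+z. ennreal (phi n y (\<Sum>i<n. snd (z i))) \<partial>T n y)"
            by (rule mult_mono[OF ennreal_leI[OF rn] inner[OF n y]]) auto
          finally show ?thesis using True yA_ge by simp
        qed simp
      qed
      finally show "ennreal (dl / 2 * exp (- e * real n)) \<le> tilted n (\<lambda>_. 1)" .
    qed
  qed
qed

text \<open>The numerator decays at rate \<open>c\<close>, and \<open>tilted_1_lower\<close> with
  \<open>c / 2\<close> keeps the normalisation from decaying faster than half that rate. The
  quotient still decays exponentially.\<close>

lemma pos_cond_tendsto_0:
  assumes B: "\<And>n. n \<ge> 1 \<Longrightarrow> B n \<in> sets (conf_space n)" and c: "c > 0"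
    and le: "\<And>n. n \<ge> 1 \<Longrightarrow> tilted n (indicator (B n)) \<le> ennreal (C * exp (- c * real n))"
  shows "(\<lambda>n. measure (pos_cond n x) (B n)) \<longlonglongrightarrow> 0"
proof -
  obtain c' where c': "c' > 0" "eventually (\<lambda>n. ennreal (c' * exp (- (c / 2) * real n)) \<le> tilted n (\<lambda>_. 1)) sequentially"
    using tilted_1_lower[of "c / 2"] c by auto
  define C' where "C' = max C 0"
  have ev: "eventually (\<lambda>n. measure (pos_cond n x) (B n) \<le> C' / c' * exp (- (c / 2)) ^ n) sequentially"
    using c'(2) eventually_ge_at_top[of 1]
  proof eventually_elim
    fix n :: nat assume low: "ennreal (c' * exp (- (c / 2) * real n)) \<le> tilted n (\<lambda>_. 1)" and n: "1 \<le> n"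
    have "tilted n (indicator (B n)) \<le> ennreal (C' * exp (- c * real n))"
      using le[OF n] by (rule order_trans) (auto intro!: ennreal_leI mult_right_mono simp: C'_def)
    hence "emeasure (pos_cond n x) (B n) \<le> ennreal (C' * exp (- c * real n)) / ennreal (c' * exp (- (c / 2) * real n))"
      unfolding emeasure_pos_cond_tilt[OF n B[OF n]] divide_ennreal_def using low
      by (intro mult_mono) (simp_all add: ennreal_inverse_antimono)
    also have "\<dots> = ennreal (C' * exp (- c * real n) / (c' * exp (- (c / 2) * real n)))"
      by (rule divide_ennreal) (use c' in \<open>auto simp: C'_def\<close>)
    also have "C' * exp (- c * real n) / (c' * exp (- (c / 2) * real n)) = C' / c' * exp (- c * real n - - (c / 2) * real n)"
      by (simp only: exp_diff times_divide_times_eq)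
    also have "- c * real n - - (c / 2) * real n = real n * (- (c / 2))" by (simp add: field_simps)
    also have "exp (real n * (- (c / 2))) = exp (- (c / 2)) ^ n" by (rule exp_of_nat_mult)
    finally have "emeasure (pos_cond n x) (B n) \<le> ennreal (C' / c' * exp (- (c / 2)) ^ n)" .
    thus "measure (pos_cond n x) (B n) \<le> C' / c' * exp (- (c / 2)) ^ n"
      unfolding measure_def using c' by (intro enn2real_leI) (auto simp: C'_def)
  qed
  have "(\<lambda>n. exp (- (c / 2)) ^ n) \<longlonglongrightarrow> 0"
    by (rule LIMSEQ_realpow_zero) (use c in simp_all)
  from tendsto_mult_right_zero[OF this, of "C' / c'"]
  have lim: "(\<lambda>n. C' / c' * exp (- (c / 2)) ^ n) \<longlonglongrightarrow> 0" .
  have "eventually (\<lambda>n. 0 \<le> measure (pos_cond n x) (B n)) sequentially"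
    by (rule always_eventually) simp
  thus ?thesis by (rule tendsto_sandwich[OF _ ev tendsto_const lim])
qed

text \<open>Bounding \<open>phi\<close> by 1 turns the inner integral into at most a total mass, so
  the gas drops out of the estimate.\<close>

lemma tilted_far:
  assumes n: "n \<ge> 1"
  shows "tilted n (indicator {p \<in> space (conf_space n). \<bar>snd (p n) - yA\<bar> > e})
    \<le> (\<integral>\<^sup>+y. indicator ({R..} \<inter> {y. \<bar>y - yA\<bar> > e}) y * ennreal (piston_weight y ^ n) \<partial>lborel)"
  unfolding tilted_def
proof (rule nn_integral_mono)
  fix y :: real
  interpret T: prob_space "T n y" by (rule prob_space_T)
  have "(\<integral>\<^sup>+z. ennreal (phi n y (\<Sum>i<n. snd (z i))) *
       indicator {p \<in> space (conf_space n). \<bar>snd (p n) - yA\<bar> > e} (z(n := (x, y))) \<partial>T n y)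
    \<le> (\<integral>\<^sup>+z. indicator {y. \<bar>y - yA\<bar> > e} y \<partial>T n y)"
    using phi_le_1[OF n] by (intro nn_integral_mono) (auto simp: indicator_def)
  also have "\<dots> = indicator {y. \<bar>y - yA\<bar> > e} y" by (simp add: T.emeasure_space_1)
  finally have "indicator {R..} y * (ennreal (piston_weight y ^ n) * (\<integral>\<^sup>+z. ennreal (phi n y (\<Sum>i<n. snd (z i))) *
       indicator {p \<in> space (conf_space n). \<bar>snd (p n) - yA\<bar> > e} (z(n := (x, y))) \<partial>T n y))
    \<le> indicator {R..} y * (ennreal (piston_weight y ^ n) * indicator {y. \<bar>y - yA\<bar> > e} y)"
    by (intro mult_left_mono) auto
  also have "\<dots> = indicator ({R..} \<inter> {y. \<bar>y - yA\<bar> > e}) y * ennreal (piston_weight y ^ n)"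
    by (simp add: indicator_inter_arith mult_ac)
  finally show "indicator {R..} y * (ennreal (piston_weight y ^ n) * (\<integral>\<^sup>+z. ennreal (phi n y (\<Sum>i<n. snd (z i))) *
       indicator {p \<in> space (conf_space n). \<bar>snd (p n) - yA\<bar> > e} (z(n := (x, y))) \<partial>T n y))
    \<le> indicator ({R..} \<inter> {y. \<bar>y - yA\<bar> > e}) y * ennreal (piston_weight y ^ n)" .
qed

lemma far_sets: "{p \<in> space (conf_space n). \<bar>snd (p n) - yA\<bar> > e} \<in> sets (conf_space n :: (nat \<Rightarrow> 'a \<times> real) measure)"
  by measurable

lemma pos_cond_height_tendsto:
  assumes e: "e > 0"
  shows "(\<lambda>n. measure (pos_cond n x) {p \<in> space (conf_space n). \<bar>snd (p n) - yA\<bar> > e}) \<longlonglongrightarrow> 0"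
proof -
  obtain C c where c: "c > 0" "\<And>n. n \<ge> 1 \<Longrightarrow>
    (\<integral>\<^sup>+y. indicator ({R..} \<inter> {y. \<bar>y - yA\<bar> > e}) y * ennreal (piston_weight y ^ n) \<partial>lborel) \<le> ennreal (C * exp (- c * real n))"
    using piston_weight_tail[OF e] by blast
  show ?thesis
    by (rule pos_cond_tendsto_0[OF far_sets c(1)]) (rule order_trans[OF tilted_far c(2)])
qed

text \<open>Heights farther than \<open>d\<close> from \<open>yA\<close> are left to
  \<open>piston_weight_tail\<close>. Nearer ones move the mean of \<open>f\<close> by at most
  \<open>e / 2\<close>, and Hoeffding's inequality handles the remaining
  \<open>e / 2\<close>.\<close>

lemma pos_cond_mean_tendsto:
  assumes [measurable]: "f \<in> borel_measurable borel" and f: "\<And>z. z \<in> cyl Db \<Longrightarrow> \<bar>f z\<bar> \<le> B"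
    and e: "e > 0"
  shows "(\<lambda>n. measure (pos_cond n x) {p \<in> space (conf_space n). \<bar>(\<Sum>i<n. f (p i)) / n - (\<integral>z. f z \<partial>gas_law yA)\<bar> > e}) \<longlonglongrightarrow> 0"
proof -
  define A where "A n = {p \<in> space (conf_space n). \<bar>(\<Sum>i<n. f (p i)) / n - (\<integral>z. f z \<partial>gas_law yA)\<bar> > e}" for n
  have A [measurable]: "A n \<in> sets (conf_space n)" for n unfolding A_def by measurable
  define B' where "B' = \<bar>B\<bar> + 1"
  have B': "B' > 0" "\<And>z. z \<in> cyl Db \<Longrightarrow> \<bar>f z\<bar> \<le> B'" using f by (force simp: B'_def)+
  have gf: "exp_dominated f" by (rule exp_dominated_bounded[OF _ B'(2)]) measurable
  obtain d where d: "d > 0" "\<And>y. \<bar>y - yA\<bar> \<le> d \<Longrightarrow> \<bar>(\<integral>z. f z \<partial>gas_law y) - (\<integral>z. f z \<partial>gas_law yA)\<bar> \<le> e / 2"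
    using gas_law_continuous[OF gf, of "e / 2"] e by auto
  obtain C c where c: "c > 0" "\<And>n. n \<ge> 1 \<Longrightarrow>
    (\<integral>\<^sup>+y. indicator ({R..} \<inter> {y. \<bar>y - yA\<bar> > d}) y * ennreal (piston_weight y ^ n) \<partial>lborel) \<le> ennreal (C * exp (- c * real n))"
    using piston_weight_tail[OF d(1)] by blast
  define c2 where "c2 = (e / 2)\<^sup>2 / (2 * B'\<^sup>2)"
  have c2: "c2 > 0" using e B' by (simp add: c2_def)
  have near: "(\<integral>\<^sup>+z. ennreal (phi n y (\<Sum>i<n. snd (z i))) * indicator (A n) (z(n := (x, y))) \<partial>T n y)
      \<le> ennreal (2 * exp (- c2 * real n))" if n: "n \<ge> 1" and y: "\<bar>y - yA\<bar> \<le> d" for n y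
  proof -
    interpret nu: prob_space "gas_law y" by (rule prob_space_gas_law)
    interpret T: prob_space "T n y" by (rule prob_space_T)
    let ?B = "{z \<in> space (T n y). \<bar>(\<Sum>i<n. f (z i)) / n - (\<integral>w. f w \<partial>gas_law y)\<bar> \<ge> e / 2}"
    have fm: "f \<in> borel_measurable (gas_law y)" by (simp cong: measurable_cong_sets)
    note [measurable] = fm
    have B [measurable]: "?B \<in> sets (T n y)" by measurable
    have AEf: "AE w in gas_law y. \<bar>f w\<bar> \<le> B'" using AE_gas_law[of y] by eventually_elim (use B' in auto)
    have "(\<integral>\<^sup>+z. ennreal (phi n y (\<Sum>i<n. snd (z i))) * indicator (A n) (z(n := (x, y))) \<partial>T n y)
       \<le> (\<integral>\<^sup>+z. indicator ?B z \<partial>T n y)"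
    proof (rule nn_integral_mono)
      fix z assume z: "z \<in> space (T n y)"
      show "ennreal (phi n y (\<Sum>i<n. snd (z i))) * indicator (A n) (z(n := (x, y))) \<le> indicator ?B z"
      proof (cases "z(n := (x, y)) \<in> A n")
        case True
        hence "\<bar>(\<Sum>i<n. f (z i)) / n - (\<integral>z. f z \<partial>gas_law yA)\<bar> > e" by (simp add: A_def)
        moreover have "e / 2 \<le> \<bar>u - v\<bar>" if "\<bar>u - w\<bar> > e" "\<bar>v - w\<bar> \<le> e / 2" for u v w :: real
          using that by (simp add: abs_if split: if_splits)
        ultimately have "z \<in> ?B" using d(2)[OF y] z by blast
        thus ?thesis using phi_le_1[OF n] by (simp add: indicator_def)
      qed simp
    qed
    also have "\<dots> = ennreal (T.prob ?B)" using B by (simp only: nn_integral_indicator T.emeasure_eq_measure)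
    also have "\<dots> \<le> ennreal (2 * exp (- (real n * (e / 2)\<^sup>2 / (2 * B'\<^sup>2))))"
      by (intro ennreal_leI nu.Hoeffding_PiM[OF fm AEf B'(1) _ n]) (use e in simp)
    also have "real n * (e / 2)\<^sup>2 / (2 * B'\<^sup>2) = c2 * real n" by (simp add: c2_def)
    finally show ?thesis by (simp only: mult_minus_left)
  qed
  define c3 where "c3 = min c c2"
  have "(\<lambda>n. measure (pos_cond n x) (A n)) \<longlonglongrightarrow> 0"
  \<comment> \<open>Here \<open>2 * d\<close> is the length of the interval of near heights and the
    other 2 comes from Hoeffding's bound; \<open>c3\<close> is the slower of the two rates.\<close>
  proof (rule pos_cond_tendsto_0[OF A, of c3 "\<bar>C\<bar> + 2 * (2 * d)"])
    show "c3 > 0" using c c2 by (simp add: c3_def)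
    fix n :: nat assume n: "n \<ge> 1"
    have "tilted n (indicator (A n)) \<le> (\<integral>\<^sup>+y. indicator ({R..} \<inter> {y. \<bar>y - yA\<bar> > d}) y * ennreal (piston_weight y ^ n)
        + ennreal (2 * exp (- c2 * real n)) * indicator {yA - d..yA + d} y \<partial>lborel)"
      unfolding tilted_def
    proof (rule nn_integral_mono)
      fix y :: real
      interpret T: prob_space "T n y" by (rule prob_space_T)
      let ?N = "\<integral>\<^sup>+z. ennreal (phi n y (\<Sum>i<n. snd (z i))) * indicator (A n) (z(n := (x, y))) \<partial>T n y"
      have N1: "?N \<le> 1"
      proof -
        have "?N \<le> (\<integral>\<^sup>+z. 1 \<partial>T n y)"
          using phi_le_1[OF n] by (intro nn_integral_mono) (auto simp: indicator_def)
        thus ?thesis by (simp add: T.emeasure_space_1)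
      qed
      consider "y < R" | "y \<ge> R" "\<bar>y - yA\<bar> > d" | "y \<ge> R" "\<bar>y - yA\<bar> \<le> d" by linarith
      thus "indicator {R..} y * (ennreal (piston_weight y ^ n) * ?N) \<le> indicator ({R..} \<inter> {y. \<bar>y - yA\<bar> > d}) y * ennreal (piston_weight y ^ n)
        + ennreal (2 * exp (- c2 * real n)) * indicator {yA - d..yA + d} y"
      proof cases
        case 2
        have "ennreal (piston_weight y ^ n) * ?N \<le> ennreal (piston_weight y ^ n) * 1" using N1 by (rule mult_left_mono) simp
        also have "\<dots> \<le> ennreal (piston_weight y ^ n) + ennreal (2 * exp (- c2 * real n)) * indicator {yA - d..yA + d} y" by simp
        finally show ?thesis using 2 by simp
      next
        case 3
        have "q * (lam * (y - yA) - 1 + exp (- (lam * (y - yA)))) \<ge> 0"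
          using q_pos exp_ge_add_one_self[of "- (lam * (y - yA))"] by (intro mult_nonneg_nonneg) linarith+
        hence "exp (- q * (lam * (y - yA) - 1 + exp (- (lam * (y - yA))))) \<le> 1" by simp
        hence "piston_weight y \<le> 1" using piston_weight_upper[of y] by linarith
        hence "piston_weight y ^ n \<le> 1" using piston_weight_nonneg[OF 3(1)] by (rule power_le_one[rotated])
        hence "ennreal (piston_weight y ^ n) * ?N \<le> 1 * ennreal (2 * exp (- c2 * real n))"
          using near[OF n 3(2)] by (intro mult_mono) auto
        moreover have "y \<in> {yA - d..yA + d}" using 3 by auto
        ultimately show ?thesis using 3 by simp
      qed simp
    qed
    also have "\<dots> = (\<integral>\<^sup>+y. indicator ({R..} \<inter> {y. \<bar>y - yA\<bar> > d}) y * ennreal (piston_weight y ^ n) \<partial>lborel)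
        + ennreal (2 * exp (- c2 * real n)) * emeasure lborel {yA - d..yA + d}"
    proof -
      have "(\<lambda>y. indicator ({R..} \<inter> {y. \<bar>y - yA\<bar> > d}) y * ennreal (piston_weight y ^ n)) \<in> borel_measurable lborel"
        unfolding piston_weight_def by measurable
      moreover have "(\<lambda>y. ennreal (2 * exp (- c2 * real n)) * indicator {yA - d..yA + d} y) \<in> borel_measurable lborel"
        by measurable
      ultimately show ?thesis by (simp only: nn_integral_add nn_integral_cmult_indicator sets_lborel borel_closed closed_real_atLeastAtMost)
    qed
    also have "\<dots> \<le> ennreal (C * exp (- c * real n)) + ennreal (2 * exp (- c2 * real n)) * ennreal (2 * d)"
      using d(1) by (intro add_mono c(2)[OF n] mult_left_mono) auto
    also have "\<dots> \<le> ennreal (\<bar>C\<bar> * exp (- c3 * real n)) + ennreal (2 * exp (- c3 * real n)) * ennreal (2 * d)"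
    proof (intro add_mono mult_right_mono ennreal_leI)
      show "C * exp (- c * real n) \<le> \<bar>C\<bar> * exp (- c3 * real n)"
        by (rule mult_mono) (auto simp: c3_def mult_right_mono)
    qed (auto simp: c3_def mult_right_mono)
    also have "\<dots> = ennreal ((\<bar>C\<bar> + 2 * (2 * d)) * exp (- c3 * real n))"
      using d(1) by (simp add: ennreal_mult[symmetric] ennreal_plus[symmetric] algebra_simps del: ennreal_plus)
    finally show "tilted n (indicator (A n)) \<le> ennreal ((\<bar>C\<bar> + 2 * (2 * d)) * exp (- c3 * real n))" .
  qed
  thus ?thesis unfolding A_def .
qed

end

lemma integral_empirical:
  fixes f :: "'a::euclidean_space \<times> real \<Rightarrow> real"
  assumes f: "f \<in> borel_measurable borel" and n: "n \<ge> 1"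
  shows "(\<integral>z. f z \<partial>empirical n p) = (\<Sum>i<n. f (p i)) / real n"
proof -
  have "(\<integral>z. f z \<partial>empirical n p) = (\<integral>i. f (p i) \<partial>uniform_count_measure {..<n})"
    unfolding empirical_def
    by (rule integral_distr[OF _ f]) (simp add: measurable_def space_uniform_count_measure sets_uniform_count_measure)
  also have "\<dots> = (\<Sum>i<n. f (p i)) / real n"
    by (subst integral_uniform_count_measure) auto
  finally show ?thesis .
qed

section \<open>From frozen positions to the full model\<close>

context piston
begin

lemma space_Pn: "space (Pn Db R m M g E n) = space (conf_space n) \<times> space (conf_space n)"
  using sets_eq_imp_space_eq[OF sets_Pn] by (simp add: space_pair_measure)

lemma space_Pn_cond: "space (Pn_cond Db R m M g E n x) = space (conf_space n) \<times> space (conf_space n)"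
  using sets_eq_imp_space_eq[OF sets_Pn_cond] by (simp add: space_pair_measure)

lemma measure_Pn_eq_integral:
  assumes x0: "x0 \<in> Dbp Db R" and n: "n \<ge> 1" and A: "A \<in> sets (conf_space n)"
  shows "measure (Pn Db R m M g E n) (A \<times> space (conf_space n))
    = (\<integral>x. measure (pos_cond n x) A \<partial>uniform_measure lborel (Dbp Db R))"
proof -
  let ?U = "uniform_measure lborel (Dbp Db R)"
  interpret U: prob_space ?U
    by (rule prob_space_uniform_measure) (use Dbp_pos Dbp_finite in auto)
  have k: "pos_cond n \<in> ?U \<rightarrow>\<^sub>M subprob_algebra (conf_space n)"
    using pos_cond_measurable[OF n] by (simp cong: measurable_cong_sets)
  have "measure (Pn Db R m M g E n) (A \<times> space (conf_space n))
      = measure (ndens (conf_space n) (pos_dens Db R m M g E n)) A"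
    unfolding measure_def emeasure_Pn[OF A] ..
  also have "\<dots> = measure (?U \<bind> pos_cond n) A"
    unfolding ndens_conf_space_eq_bind[OF x0 n] ..
  also have "\<dots> = (\<integral>x. measure (pos_cond n x) A \<partial>?U)"
    by (rule U.measure_bind[OF k A])
  finally show ?thesis .
qed

text \<open>The conditional probabilities are averaged over the horizontal position and dominated by
  1. The index is shifted to \<open>Suc n\<close> because the kernels are under control only for
  positive particle numbers.\<close>

lemma Pn_tendsto_0:
  assumes x0: "x0 \<in> Dbp Db R" and A: "\<And>n. A n \<in> sets (conf_space n)"
    and lim: "\<And>x. x \<in> Dbp Db R \<Longrightarrow> (\<lambda>n. measure (pos_cond n x) (A n)) \<longlonglongrightarrow> 0"
  shows "(\<lambda>n. measure (Pn Db R m M g E n) (A n \<times> space (conf_space n))) \<longlonglongrightarrow> 0"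
proof -
  let ?U = "uniform_measure lborel (Dbp Db R)"
  interpret U: prob_space ?U
    by (rule prob_space_uniform_measure) (use Dbp_pos Dbp_finite in auto)
  have meas: "(\<lambda>x. measure (pos_cond (Suc n) x) (A (Suc n))) \<in> borel_measurable ?U" for n
  proof -
    have "pos_cond (Suc n) \<in> ?U \<rightarrow>\<^sub>M subprob_algebra (conf_space (Suc n))"
      using pos_cond_measurable[of "Suc n"] by (simp cong: measurable_cong_sets)
    from measurable_compose[OF this measurable_measure_subprob_algebra[OF A]] show ?thesis .
  qed
  have le1: "measure (pos_cond (Suc n) x) B \<le> 1" for n x and B :: "(nat \<Rightarrow> 'a \<times> real) set"
  proof -
    have "pos_cond (Suc n) x \<in> space (subprob_algebra (conf_space (Suc n)))"
      by (rule measurable_space[OF pos_cond_measurable]) auto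
    thus ?thesis by (simp add: space_subprob_algebra subprob_space.subprob_measure_le_1)
  qed
  have "AE x in ?U. x \<in> Dbp Db R"
    by (rule AE_uniform_measureI) auto
  hence AE: "AE x in ?U. (\<lambda>n. measure (pos_cond (Suc n) x) (A (Suc n))) \<longlonglongrightarrow> 0"
    by eventually_elim (rule LIMSEQ_Suc[OF lim])
  have "(\<lambda>n. \<integral>x. measure (pos_cond (Suc n) x) (A (Suc n)) \<partial>?U) \<longlonglongrightarrow> (\<integral>x. 0 \<partial>?U)"
    by (rule integral_dominated_convergence[OF _ meas _ AE, of "\<lambda>_. 1"]) (use le1 in auto)
  hence "(\<lambda>n. measure (Pn Db R m M g E (Suc n)) (A (Suc n) \<times> space (conf_space (Suc n)))) \<longlonglongrightarrow> 0"
    using measure_Pn_eq_integral[OF x0 _ A] by simp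
  thus ?thesis by (rule LIMSEQ_imp_Suc)
qed

text \<open>Translation carries the ball integral from \<open>x0\<close> to \<open>x\<close>,
  equality of slice volumes carries the integrals over the complement. One solution thus serves
  every position in \<open>Dbp\<close>.\<close>

lemma tilt_at:
  assumes x0: "x0 \<in> Dbp Db R" and x: "x \<in> Dbp Db R" and "lam > 0" "yA \<ge> R"
    and "balance_eq Db R x0 m M yA lam" "energy_eq Db R x0 m M g E yA lam"
  shows "tilt Db R m M g E x lam yA"
proof -
  have "I_ball R x yA lam = I_ball R x0 yA lam"
    using I_ball_translate[of R x yA lam yA x0] by simp
  thus ?thesis
    using assms I_out_indep[OF x0 x, of lam yA]
    by unfold_locales (simp_all add: balance_eq_def energy_eq_def)
qed

end

text \<open>A test function is controlled on the container only, and off it even measurability may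
  fail, hence the case split. For measurable \<open>f\<close> the integral against the empirical
  measure is a sample mean, to which \<open>pos_cond_mean_tendsto\<close> applies.\<close>

lemma (in tilt) weak_conv_pos_cond:
  "weak_conv_in_prob (cyl Db) (\<lambda>n. Pn_cond Db R m M g E n x) (\<lambda>n \<omega>. empirical n (fst \<omega>)) (gas_law yA)"
  unfolding weak_conv_in_prob_def
proof (intro allI impI, elim conjE)
  fix f :: "'a \<times> real \<Rightarrow> real" and e :: real
  assume bdd: "bounded (f ` cyl Db)" and e: "e > 0"
  let ?S = "\<lambda>n. {\<omega> \<in> space (Pn_cond Db R m M g E n x).
     \<bar>(\<integral>z. f z \<partial>empirical n (fst \<omega>)) - (\<integral>z. f z \<partial>gas_law yA)\<bar> > e}"
  show "(\<lambda>n. measure (Pn_cond Db R m M g E n x) (?S n)) \<longlonglongrightarrow> 0"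
  proof (cases "f \<in> borel_measurable borel")
    case False
    \<comment> \<open>The Bochner integral of a function that is not Borel measurable is \<open>0\<close> on both sides.\<close>
    have "(\<integral>z. f z \<partial>N) = 0" if "sets N = sets borel" for N :: "('a \<times> real) measure"
    proof (rule not_integrable_integral_eq)
      show "\<not> integrable N f"
        using False borel_measurable_integrable[of N f] measurable_cong_sets[OF that refl, of borel] by blast
    qed
    hence "?S n = {}" for n using e by (simp add: empirical_def)
    thus ?thesis by (simp only: measure_empty tendsto_const)
  next
    case f: True
    obtain B where B: "\<And>z. z \<in> cyl Db \<Longrightarrow> \<bar>f z\<bar> \<le> B"
      using bdd unfolding bounded_iff by auto
    let ?A = "\<lambda>n. {p \<in> space (conf_space n). \<bar>(\<Sum>i<n. f (p i)) / n - (\<integral>z. f z \<partial>gas_law yA)\<bar> > e}"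
    note [measurable] = f
    have "measure (pos_cond n x) (?A n) = measure (Pn_cond Db R m M g E n x) (?S n)" if n: "n \<ge> 1" for n
    proof -
      have A: "?A n \<in> sets (conf_space n)" by measurable
      have "?S n = ?A n \<times> space (conf_space n)"
        by (auto simp: space_Pn_cond integral_empirical[OF f n])
      thus ?thesis unfolding measure_def using emeasure_Pn_cond[OF A] by simp
    qed
    hence "eventually (\<lambda>n. measure (pos_cond n x) (?A n) = measure (Pn_cond Db R m M g E n x) (?S n)) sequentially"
      by (auto intro: eventually_sequentiallyI[of 1])
    from tendsto_cong[OF this] pos_cond_mean_tendsto[OF f B e] show ?thesis by blast
  qed
qed

theorem theorem2p3:
  fixes Db :: "'a::euclidean_space set"
    and R m M g E lamS yA lamA :: real
    and xt :: 'a
  assumes Db_open: "open Db" and Db_conn: "connected Db" and Db_bdd: "bounded Db"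
    and Db_smooth: "smooth_boundary Db"
    and R_pos: "R > 0"
    and inner: "inner_ball_condition Db R"
    and ball_fits: "\<exists>z. cball z R \<subseteq> interior (cyl Db)"
    and m_pos: "m > 0" and M_pos: "M > 0" and g_pos: "g > 0"
    and E_gt: "E > M * g * R"
    and xt_in: "xt \<in> Dbp Db R"
    and lamS_pos: "lamS > 0"
    and lamS_eq: "energy_eq Db R xt m M g E R lamS"
    and lamS_unique: "\<forall>lam>0. energy_eq Db R xt m M g E R lam \<longrightarrow> lam = lamS"
    and hyp: "M < m * I_ball R xt R lamS / I_out Db R xt R lamS"
    and yA_ge: "yA \<ge> R" and lamA_pos: "lamA > 0"
    and A_balance: "balance_eq Db R xt m M yA lamA"
    and A_energy: "energy_eq Db R xt m M g E yA lamA"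
    and A_unique: "\<forall>y lam. y \<ge> R \<and> lam > 0 \<and> balance_eq Db R xt m M y lam
                      \<and> energy_eq Db R xt m M g E y lam \<longrightarrow> y = yA \<and> lam = lamA"
  shows "(\<forall>\<epsilon>>0. (\<lambda>n. measure (Pn Db R m M g E n)
             {\<omega> \<in> space (Pn Db R m M g E n). \<bar>snd (fst \<omega> n) - yA\<bar> > \<epsilon>}) \<longlonglongrightarrow> 0)
       \<and> (\<forall>n\<ge>1. distr (Pn Db R m M g E n) borel (\<lambda>\<omega>. fst (fst \<omega> n))
                  = uniform_measure lborel (Dbp Db R)
               \<and> Pn Db R m M g E n = uniform_measure lborel (Dbp Db R) \<bind> Pn_cond Db R m M g E n)
       \<and> (\<forall>x\<in>Dbp Db R. weak_conv_in_prob (cyl Db) (\<lambda>n. Pn_cond Db R m M g E n x)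
             (\<lambda>n \<omega>. empirical n (fst \<omega>)) (nu Db R x yA lamA))"
proof -
  interpret piston Db R m M g E
    by unfold_locales fact+
  have tilt: "tilt Db R m M g E x lamA yA" if "x \<in> Dbp Db R" for x
    by (rule tilt_at[OF xt_in that lamA_pos yA_ge A_balance A_energy])
  have "(\<lambda>n. measure (Pn Db R m M g E n)
      {\<omega> \<in> space (Pn Db R m M g E n). \<bar>snd (fst \<omega> n) - yA\<bar> > \<epsilon>}) \<longlonglongrightarrow> 0" if "\<epsilon> > 0" for \<epsilon>
  proof -
    have eq: "{\<omega> \<in> space (Pn Db R m M g E n). \<bar>snd (fst \<omega> n) - yA\<bar> > \<epsilon>}
        = {p \<in> space (conf_space n). \<bar>snd (p n) - yA\<bar> > \<epsilon>} \<times> space (conf_space n)" for n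
      by (auto simp: space_Pn)
    show ?thesis
      unfolding eq
      by (rule Pn_tendsto_0[OF xt_in tilt.far_sets[OF tilt[OF xt_in]] tilt.pos_cond_height_tendsto[OF tilt that]])
  qed
  moreover have "distr (Pn Db R m M g E n) borel (\<lambda>\<omega>. fst (fst \<omega> n)) = uniform_measure lborel (Dbp Db R)
      \<and> Pn Db R m M g E n = uniform_measure lborel (Dbp Db R) \<bind> Pn_cond Db R m M g E n" if "n \<ge> 1" for n
    using distr_Pn[OF xt_in that] Pn_eq_bind[OF xt_in that] by blast
  moreover have "weak_conv_in_prob (cyl Db) (\<lambda>n. Pn_cond Db R m M g E n x)
      (\<lambda>n \<omega>. empirical n (fst \<omega>)) (nu Db R x yA lamA)" if "x \<in> Dbp Db R" for x
    by (rule tilt.weak_conv_pos_cond[OF tilt[OF that]])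
  ultimately show ?thesis by blast
qed

end
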